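(* Let $K$ be a field of characteristic $\ne2,3$ and let $f$ be the $\mathrm{SL}_6$-invariant quartic form on $\wedge^3(K^6)$. Every linear transformation of $\wedge^3(K^6)$ that preserves $f$ is of the form $$v_1\wedge v_2\wedge v_3\mapsto c\,(gv_1\wedge gv_2\wedge gv_3)\quad\text{for some } c\in K^\times,\ g\in\mathrm{GL}_6(K)\text{ with } c^4(\det g)^2=1,\qquad( * )$$ or is the composition of a Hodge star operator with a transformation as in $( * )$.
   Context: The ring of $\mathrm{SL}_6$-invariant polynomial functions on $\wedge^3(K^6)$ is generated by a homogeneous polynomial $f$ of degree $4$, unique up to a nonzero scalar; this is "the invariant quartic form". It can be normalized as follows. Write $K^6=V_2\oplus V_4$ with $\dim V_d=d$, fix a basis $a,b$ of $V_2$, and let $w\colon V_2\otimes(\wedge^2V_4)\to\wedge^3K^6$ be the inclusion $c\otimes x\mapsto c\wedge x$. Then $f(w(a\otimes x+b\otimes y))=\langle x,y\rangle^2-4\,\mathrm{Pf}(x)\mathrm{Pf}(y)$, where $\mathrm{Pf}$ is the Pfaffian on $\wedge^2V_4$ and $\langle x,y\rangle$ is the coefficient of $t$ in $\mathrm{Pf}(x+ty)$; every $\mathrm{SL}_6(K)$-orbit in $\wedge^3K^6$ meets the image of $w$. A linear transformation $\phi$ preserves $f$ if $f\circ\phi=f$ as polynomials. A Hodge star operator on $\wedge^3(K^6)$ is, with respect to the standard basis $e_1,\dots,e_6$, the linear map sending $e_I$ to $\pm e_{I^c}$ for each $3$-element subset $I\subset\{1,\dots,6\}$, where the sign is defined by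 $e_I\wedge(\pm e_{I^c})=e_1\wedge\cdots\wedge e_6$. *)

theory Defs
  imports
    "HOL-Analysis.Analysis"
    "HOL-Library.Poly_Mapping"
begin

text \<open>
  The index type \<^typ>\<open>6\<close> has the elements \<open>0 < 1 < 2 < 3 < 4 < 5\<close> (its numeral \<open>6\<close> is \<open>0\<close>), so
  the standard basis \<open>e\<^sub>1, \<dots>, e\<^sub>6\<close> of \<open>K\<^sup>6\<close> is here \<open>axis 0 1, \<dots>, axis 5 1\<close>, in this order.
\<close>

typedef sub3 = "{I :: 6 set. card I = 3}"
  morphisms set_of_sub3 Sub3
proof -
  have "card ({0, 1, 2} :: 6 set) = 3" by simp
  then show ?thesis by blast
qed

instance sub3 :: finite
proof
  have "inj set_of_sub3"
    by (simp add: inj_on_def set_of_sub3_inject)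
  moreover have "finite (range set_of_sub3)"
    by (rule finite_subset[of _ UNIV]) auto
  ultimately show "finite (UNIV :: sub3 set)"
    by (rule finite_imageD[rotated])
qed

definition compl3 :: "sub3 \<Rightarrow> sub3" where
  "compl3 I = Sub3 (- set_of_sub3 I)"

lemma card_set_of_sub3: "card (set_of_sub3 I) = 3"
  using set_of_sub3[of I] by simp

lemma set_of_compl3: "set_of_sub3 (compl3 I) = - set_of_sub3 I"
  unfolding compl3_def by (rule Sub3_inverse) (simp add: card_set_of_sub3 Compl_eq_Diff_UNIV card_Diff_subset)

definition elems :: "sub3 \<Rightarrow> 6 list" where
  "elems I = sorted_list_of_set (set_of_sub3 I)"

text \<open>
  The exterior cube of \<open>K\<^sup>6\<close>, in coordinates with respect to the basis \<open>e\<^sub>I\<close>: the vector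
  \<open>axis I 1\<close> is \<open>e\<^sub>i \<and> e\<^sub>j \<and> e\<^sub>k\<close> for \<open>I = {i < j < k}\<close>, and the \<open>I\<close>-th coordinate of
  \<open>u \<and> v \<and> w\<close> is the minor of \<open>u, v, w\<close> in the columns \<open>I\<close>.  The lemma
  \<open>wedge3_universal\<close> below shows that this is the exterior cube.
\<close>
type_synonym 'a ext3 = "'a ^ sub3"

definition wedge3 :: "('a::field) ^ 6 \<Rightarrow> 'a ^ 6 \<Rightarrow> 'a ^ 6 \<Rightarrow> 'a ext3" where
  "wedge3 u v w = (\<chi> I. let i = elems I ! 0; j = elems I ! 1; k = elems I ! 2 in
     det (vector [vector [u $ i, u $ j, u $ k],
                  vector [v $ i, v $ j, v $ k],
                  vector [w $ i, w $ j, w $ k]] :: 'a ^ 3 ^ 3))"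

definition alternating3 :: "('a::field ^ 'm \<Rightarrow> 'a ^ 'm \<Rightarrow> 'a ^ 'm \<Rightarrow> 'a ^ 'n) \<Rightarrow> bool" where
  "alternating3 M \<longleftrightarrow>
     (\<forall>v w. Vector_Spaces.linear (*s) (*s) (\<lambda>u. M u v w)) \<and>
     (\<forall>u w. Vector_Spaces.linear (*s) (*s) (\<lambda>v. M u v w)) \<and>
     (\<forall>u v. Vector_Spaces.linear (*s) (*s) (\<lambda>w. M u v w)) \<and>
     (\<forall>u v. M u u v = 0 \<and> M u v u = 0 \<and> M v u u = 0)"

lemma elems_length: "length (elems I) = 3"
  by (simp add: elems_def card_set_of_sub3)

lemma elems_strict:
  "elems I ! 0 < elems I ! 1" "elems I ! 1 < elems I ! 2" "elems I ! 0 < elems I ! 2"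
  using elems_length[of I] strict_sorted_list_of_set[of "set_of_sub3 I"]
  unfolding elems_def[symmetric] by (auto simp: sorted_wrt_iff_nth_less)

lemma elems_eq: "elems I = [elems I ! 0, elems I ! 1, elems I ! 2]"
  using elems_length[of I]
  by (intro nth_equalityI) (auto simp: less_Suc_eq numeral_3_eq_3 numeral_2_eq_2)

lemma elems_inject: "elems I = elems J \<Longrightarrow> I = J"
  unfolding elems_def
  by (metis finite sorted_list_of_set.set_sorted_key_list_of_set set_of_sub3_inject)

lemma elems_surj:
  fixes i j k :: 6
  assumes "i < j" "j < k"
  obtains I where "elems I = [i, j, k]"
proof
  have lt: "i < k" using assms by order
  have "i \<noteq> j" "j \<noteq> k" "i \<noteq> k" using assms lt by order+
  then have "card {i, j, k} = 3" by simp
  then have "set_of_sub3 (Sub3 {i, j, k}) = {i, j, k}" by (simp add: Sub3_inverse)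
  moreover have "sorted_list_of_set (set [i, j, k]) = [i, j, k]"
    by (rule sorted_list_of_set.idem_if_sorted_distinct) (use assms lt in auto)
  ultimately show "elems (Sub3 {i, j, k}) = [i, j, k]"
    unfolding elems_def by simp
qed

lemma wedge3_component:
  "wedge3 u v w $ I = (let i = elems I ! 0; j = elems I ! 1; k = elems I ! 2 in
     u $ i * v $ j * w $ k + u $ j * v $ k * w $ i + u $ k * v $ i * w $ j
     - u $ i * v $ k * w $ j - u $ j * v $ i * w $ k - u $ k * v $ j * w $ i)"
  by (simp add: wedge3_def Let_def det_3 vector_3)

lemma vec_linearI:
  fixes f :: "('a::field)^'m \<Rightarrow> 'a^'n"
  assumes "\<And>x y. f (x + y) = f x + f y" "\<And>c x. f (c *s x) = c *s f x"
  shows "Vector_Spaces.linear (*s) (*s) f"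
  using assms by unfold_locales auto

lemma alternating3_wedge3: "alternating3 wedge3"
  unfolding alternating3_def
  by (intro conjI allI vec_linearI)
     (simp_all add: vec_eq_iff wedge3_component Let_def algebra_simps)

lemma wedge3_basis:
  assumes "elems I = [i, j, k]"
  shows "wedge3 (axis i 1) (axis j 1) (axis k 1) = (axis I 1 :: ('a::field) ext3)"
proof -
  have lt: "i < j" "j < k" "i < k" using elems_strict[of I] assms by auto
  have "wedge3 (axis i 1) (axis j 1) (axis k 1) $ J = (axis I 1 :: 'a ext3) $ J" for J
  proof (cases "J = I")
    case True
    then show ?thesis using lt assms by (auto simp: wedge3_component Let_def axis_def)
  next
    case False
    then have "\<not> (elems J ! 0 = i \<and> elems J ! 1 = j \<and> elems J ! 2 = k)"
      using elems_inject[of J I] assms elems_eq[of J] by metis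
    moreover have "axis I (1::'a) $ J = 0" using False by (auto simp: axis_def)
    ultimately show ?thesis
      using lt elems_strict[of J]
      by (auto simp: wedge3_component Let_def axis_def)
  qed
  then show ?thesis by (simp add: vec_eq_iff)
qed

lemma alternating3_swap:
  assumes "alternating3 M"
  shows "M v u w = - M u v w" "M u w v = - M u v w"
proof -
  have add: "M (x + y) v w = M x v w + M y v w" "M u (x + y) w = M u x w + M u y w"
    "M u v (x + y) = M u v x + M u v y" for u v w x y
    using assms unfolding alternating3_def Vector_Spaces.linear_iff by blast+
  have z: "M x x y = 0" "M y x x = 0" for x y
    using assms by (auto simp: alternating3_def)
  have "0 = M (u + v) (u + v) w" by (simp only: z)
  also have "\<dots> = M v u w + M u v w" unfolding add by (simp only: z add_0_left add_0_right add.commute)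
  finally show "M v u w = - M u v w" by (metis eq_neg_iff_add_eq_0)
  have "0 = M u (v + w) (v + w)" by (simp only: z)
  also have "\<dots> = M u w v + M u v w" unfolding add by (simp only: z add_0_left add_0_right add.commute)
  finally show "M u w v = - M u v w" by (metis eq_neg_iff_add_eq_0)
qed

lemma alternating3_zeroI:
  fixes M :: "('a::field) ^ 6 \<Rightarrow> 'a ^ 6 \<Rightarrow> 'a ^ 6 \<Rightarrow> 'a ^ 'n"
  assumes M: "alternating3 M"
    and basis: "\<And>i j k. i < j \<Longrightarrow> j < k \<Longrightarrow> M (axis i 1) (axis j 1) (axis k 1) = 0"
  shows "M u v w = 0"
proof -
  let ?e = "\<lambda>i. axis i (1::'a) :: 'a ^ 6"
  note swap = alternating3_swap[OF M]
  have z: "M x x y = 0" "M y x x = 0" "M x y x = 0" for x y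
    using M by (auto simp: alternating3_def)
  have e1: "M (?e i) (?e j) (?e k) = 0" if "i < j" for i j k
  proof -
    consider "j < k" | "j = k" | "i < k" "k < j" | "i = k" | "k < i" by force
    then show ?thesis
    proof cases
      case 1 then show ?thesis using basis that by blast
    next
      case 3 then show ?thesis using basis[of i k j] swap(2)[of "?e i" "?e k" "?e j"] by simp
    next
      case 5
      have "M (?e i) (?e j) (?e k) = - M (?e i) (?e k) (?e j)" by (rule swap(2))
      also have "M (?e i) (?e k) (?e j) = - M (?e k) (?e i) (?e j)" by (rule swap(1))
      finally show ?thesis using basis[of k i j] 5 that by simp
    qed (simp_all add: z)
  qed
  have e: "M (?e i) (?e j) (?e k) = 0" for i j k
    using e1[of i j k] e1[of j i k] swap(1)[of "?e i" "?e j" "?e k"] z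
    by (cases i j rule: linorder_cases) auto
  have ext: "f x = 0" if "Vector_Spaces.linear (*s) (*s) f" "\<And>i. f (?e i) = 0"
    for f :: "'a ^ 6 \<Rightarrow> 'a ^ 'n" and x
  proof -
    interpret Vector_Spaces.linear "(*s)" "(*s)" f by fact
    have "f x = f (\<Sum>i\<in>UNIV. x $ i *s ?e i)" by (simp add: basis_expansion)
    also have "\<dots> = 0" by (simp add: sum scale that(2))
    finally show ?thesis .
  qed
  have lin: "Vector_Spaces.linear (*s) (*s) (\<lambda>u. M u v w)"
    "Vector_Spaces.linear (*s) (*s) (\<lambda>u. M v u w)"
    "Vector_Spaces.linear (*s) (*s) (\<lambda>u. M v w u)" for v w
    using M by (auto simp: alternating3_def)
  have "M (?e i) (?e j) w = 0" for i j w by (rule ext[OF lin(3)]) (rule e)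
  then have "M (?e i) v w = 0" for i v w by (rule ext[OF lin(2)])
  then show ?thesis by (rule ext[OF lin(1)])
qed

definition ext3_lift :: "(('a::field) ^ 6 \<Rightarrow> 'a ^ 6 \<Rightarrow> 'a ^ 6 \<Rightarrow> 'a ^ 'n) \<Rightarrow> 'a ext3 \<Rightarrow> 'a ^ 'n" where
  "ext3_lift M x = (\<Sum>I\<in>UNIV. x $ I *s
     M (axis (elems I ! 0) 1) (axis (elems I ! 1) 1) (axis (elems I ! 2) 1))"

lemma linear_ext3_lift: "Vector_Spaces.linear (*s) (*s) (ext3_lift M)"
  by (rule vec_linearI)
     (simp_all add: ext3_lift_def vec.scale_left_distrib sum.distrib vec.scale_sum_right)

lemma ext3_lift_axis:
  "ext3_lift M (axis I 1) =
     M (axis (elems I ! 0) 1) (axis (elems I ! 1) 1) (axis (elems I ! 2) 1)"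
proof -
  have "ext3_lift M (axis I 1) = (\<Sum>J\<in>UNIV. if J = I then
     M (axis (elems J ! 0) 1) (axis (elems J ! 1) 1) (axis (elems J ! 2) 1) else 0)"
    unfolding ext3_lift_def by (rule sum.cong) (auto simp: axis_def)
  then show ?thesis by simp
qed

lemma ext3_lift_wedge3:
  assumes M: "alternating3 M"
  shows "ext3_lift M (wedge3 u v w) = M u v w"
proof -
  interpret L: Vector_Spaces.linear "(*s)" "(*s)" "ext3_lift M" by (rule linear_ext3_lift)
  define D where "D u v w = ext3_lift M (wedge3 u v w) - M u v w" for u v w
  have "alternating3 D"
    unfolding alternating3_def
  proof (intro conjI allI vec_linearI)
    fix x y v w c
    have A: "M (x + y) v w = M x v w + M y v w" "M v (x + y) w = M v x w + M v y w"
      "M v w (x + y) = M v w x + M v w y" "M (c *s x) v w = c *s M x v w"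
      "M v (c *s x) w = c *s M v x w" "M v w (c *s x) = c *s M v w x"
      "M x x y = 0" "M x y x = 0" "M y x x = 0"
      using M unfolding alternating3_def Vector_Spaces.linear_iff by blast+
    have W: "wedge3 (x + y) v w = wedge3 x v w + wedge3 y v w"
      "wedge3 v (x + y) w = wedge3 v x w + wedge3 v y w"
      "wedge3 v w (x + y) = wedge3 v w x + wedge3 v w y"
      "wedge3 (c *s x) v w = c *s wedge3 x v w" "wedge3 v (c *s x) w = c *s wedge3 v x w"
      "wedge3 v w (c *s x) = c *s wedge3 v w x"
      "wedge3 x x y = 0" "wedge3 x y x = 0" "wedge3 y x x = 0"
      using alternating3_wedge3[where 'a = 'a]
      unfolding alternating3_def Vector_Spaces.linear_iff by blast+
    show "D (x + y) v w = D x v w + D y v w" "D (c *s x) v w = c *s D x v w"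
      "D v (x + y) w = D v x w + D v y w" "D v (c *s x) w = c *s D v x w"
      "D v w (x + y) = D v w x + D v w y" "D v w (c *s x) = c *s D v w x"
      "D x x y = 0" "D x y x = 0" "D y x x = 0"
      by (simp_all only: D_def A W L.add L.scale L.zero vec.scale_right_diff_distrib
          diff_self add_diff_add)
  qed
  moreover have "D (axis i 1) (axis j 1) (axis k 1) = 0" if ij: "i < j" "j < k" for i j k
  proof -
    obtain I where I: "elems I = [i, j, k]" by (rule elems_surj[OF ij])
    have nth: "elems I ! 0 = i" "elems I ! 1 = j" "elems I ! 2 = k" by (simp_all add: I)
    show ?thesis
      unfolding D_def wedge3_basis[OF I] ext3_lift_axis nth by (rule diff_self)
  qed
  ultimately have "D u v w = 0" by (rule alternating3_zeroI)
  then show ?thesis by (simp add: D_def)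
qed

theorem wedge3_universal:
  fixes M :: "('a::field) ^ 6 \<Rightarrow> 'a ^ 6 \<Rightarrow> 'a ^ 6 \<Rightarrow> 'a ^ 'n"
  assumes "alternating3 M"
  shows "\<exists>!L. Vector_Spaces.linear (*s) (*s) L \<and> (\<forall>u v w. L (wedge3 u v w) = M u v w)"
proof (intro ex1I conjI allI)
  show "Vector_Spaces.linear (*s) (*s) (ext3_lift M)" by (rule linear_ext3_lift)
  show "ext3_lift M (wedge3 u v w) = M u v w" for u v w by (rule ext3_lift_wedge3[OF assms])
next
  fix L :: "'a ext3 \<Rightarrow> 'a ^ 'n"
  assume L: "Vector_Spaces.linear (*s) (*s) L \<and> (\<forall>u v w. L (wedge3 u v w) = M u v w)"
  then interpret Vector_Spaces.linear "(*s)" "(*s)" L by blast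
  show "L = ext3_lift M"
  proof
    fix x :: "'a ext3"
    have "L x = L (\<Sum>I\<in>UNIV. x $ I *s axis I 1)" by (simp add: basis_expansion)
    also have "\<dots> = (\<Sum>I\<in>UNIV. x $ I *s L (axis I 1))" by (simp add: sum scale)
    also have "\<dots> = ext3_lift M x"
      unfolding ext3_lift_def
      by (intro sum.cong refl arg_cong[where f = "(*s) _"]) (metis L elems_eq wedge3_basis)
    finally show "L x = ext3_lift M x" .
  qed
qed

definition wedge3_map :: "('a::field) ^ 6 ^ 6 \<Rightarrow> 'a ext3 \<Rightarrow> 'a ext3" where
  "wedge3_map g = ext3_lift (\<lambda>u v w. wedge3 (g *v u) (g *v v) (g *v w))"

lemma wedge3_map_wedge3:
  "wedge3_map g (wedge3 u v w) = wedge3 (g *v u) (g *v v) (g *v w)"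
proof -
  have "alternating3 (\<lambda>u v w. wedge3 (g *v u) (g *v v) (g *v w))"
    using alternating3_wedge3 unfolding alternating3_def
    by (auto simp: Vector_Spaces.linear_iff matrix_vector_right_distrib vector_scalar_commute)
  then show ?thesis unfolding wedge3_map_def by (rule ext3_lift_wedge3)
qed

text \<open>
  The coefficient of \<open>e\<^sub>1 \<and> \<dots> \<and> e\<^sub>6\<close> in the wedge product of six vectors.
\<close>
definition wedge6 :: "(('a::field) ^ 6) list \<Rightarrow> 'a" where
  "wedge6 vs = det (\<chi> r. vs ! card {..<r})"

definition hodge_sign :: "sub3 \<Rightarrow> 'a::field" where
  "hodge_sign I = wedge6 (map (\<lambda>i. axis i 1) (elems I @ elems (compl3 I)))"

lemma hodge_sign_cases: "hodge_sign I = (1 :: 'a::field) \<or> hodge_sign I = (-1 :: 'a::field)"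
proof -
  define p :: "6 \<Rightarrow> 6" where "p r = (elems I @ elems (compl3 I)) ! card {..<r}" for r
  have len: "length (elems I @ elems (compl3 I)) = 6" by (simp add: elems_length)
  have lt: "card {..<r} < 6" for r :: 6
  proof -
    have "card {..<r} < card (UNIV :: 6 set)" by (rule psubset_card_mono) auto
    then show ?thesis by simp
  qed
  have dist: "distinct (elems I @ elems (compl3 I))"
    by (simp add: elems_def set_of_compl3)
  have "inj p"
  proof (rule injI)
    fix r s :: 6
    assume "p r = p s"
    then have "card {..<r} = card {..<s}"
      using nth_eq_iff_index_eq[OF dist] lt len by (metis p_def)
    then show "r = s"
      by (metis finite lessThan_strict_subset_iff nat_neq_iff neq_iff psubset_card_mono)
  qed
  then have "p permutes UNIV"
    by (metis UNIV_I bij_imp_permutes finite_UNIV_inj_surj finite bij_betw_def)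
  then have "det (\<chi> r. (mat 1 :: 'a ^ 6 ^ 6) $ p r) = of_int (sign p)"
    by (simp add: det_permute_rows)
  moreover have "(\<chi> r. (mat 1 :: 'a ^ 6 ^ 6) $ p r) =
      (\<chi> r. map (\<lambda>i. axis i 1) (elems I @ elems (compl3 I)) ! card {..<r})"
    using lt by (simp add: vec_eq_iff p_def mat_def axis_def len[simplified] nth_map del: map_append)
  ultimately have "hodge_sign I = (of_int (sign p) :: 'a)"
    by (simp add: hodge_sign_def wedge6_def)
  moreover have "sign p = 1 \<or> sign p = -1" by (simp add: sign_def)
  ultimately show ?thesis by (elim disjE) simp_all
qed

text \<open>
  Since \<open>hodge_sign I = \<plusminus>1\<close>, the equation \<open>e\<^sub>I \<and> \<epsilon> e\<^bsub>I\<^sup>c\<^esub> = e\<^sub>1 \<and> \<dots> \<and> e\<^sub>6\<close> for a sign \<open>\<epsilon>\<close> says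
  \<open>\<epsilon> = hodge_sign I\<close>.
\<close>
definition hodge_star :: "('a::field) ext3 \<Rightarrow> 'a ext3" where
  "hodge_star x = (\<Sum>I\<in>UNIV. x $ I *s (hodge_sign I *s axis (compl3 I) 1))"

text \<open>
  Polynomials on the exterior cube are formal: a polynomial in the coordinates \<open>x\<^sub>I\<close> is a finitely
  supported map from monomials (exponent vectors) to coefficients, with the convolution product
  of \<^theory>\<open>HOL-Library.Poly_Mapping\<close>.
\<close>
type_synonym 'a ext3_poly = "(sub3 \<Rightarrow>\<^sub>0 nat) \<Rightarrow>\<^sub>0 'a"

definition poly_var :: "sub3 \<Rightarrow> ('a::field) ext3_poly" where
  "poly_var I = Poly_Mapping.single (Poly_Mapping.single I 1) 1"

definition poly_const :: "'a \<Rightarrow> ('a::field) ext3_poly" where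
  "poly_const c = Poly_Mapping.single 0 c"

text \<open>
  The polynomial \<open>f \<circ> \<phi>\<close> for a linear map \<open>\<phi>\<close>: substitute for \<open>x\<^sub>I\<close> the linear form
  that gives the \<open>I\<close>-th coordinate of \<open>\<phi> x\<close>.
\<close>
definition pullback :: "(('a::field) ext3 \<Rightarrow> 'a ext3) \<Rightarrow> 'a ext3_poly \<Rightarrow> 'a ext3_poly" where
  "pullback \<phi> f = (\<Sum>m\<in>Poly_Mapping.keys f. poly_const (Poly_Mapping.lookup f m) *
     (\<Prod>I\<in>UNIV. (\<Sum>J\<in>UNIV. poly_const (\<phi> (axis J 1) $ I) * poly_var J) ^ Poly_Mapping.lookup m I))"

definition homogeneous :: "nat \<Rightarrow> ('a::field) ext3_poly \<Rightarrow> bool" where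
  "homogeneous d f \<longleftrightarrow>
     (\<forall>m\<in>Poly_Mapping.keys f. (\<Sum>I\<in>UNIV. Poly_Mapping.lookup m I) = d)"

text \<open>
  The invariant quartic form is only unique up to a nonzero scalar; this predicate holds for
  each of its nonzero multiples.
\<close>
definition SL6_invariant_quartic :: "('a::field) ext3_poly \<Rightarrow> bool" where
  "SL6_invariant_quartic f \<longleftrightarrow> f \<noteq> 0 \<and> homogeneous 4 f \<and>
     (\<forall>g :: 'a ^ 6 ^ 6. det g = 1 \<longrightarrow> pullback (wedge3_map g) f = f)"

definition scaled_GL6_map :: "(('a::field) ext3 \<Rightarrow> 'a ext3) \<Rightarrow> bool" where
  "scaled_GL6_map T \<longleftrightarrow> Vector_Spaces.linear (*s) (*s) T \<and>
     (\<exists>c (g :: 'a ^ 6 ^ 6). c \<noteq> 0 \<and> invertible g \<and> c ^ 4 * (det g)\<^sup>2 = 1 \<and>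
        (\<forall>v1 v2 v3. T (wedge3 v1 v2 v3) = c *s wedge3 (g *v v1) (g *v v2) (g *v v3)))"

end

theory Submission
  imports Defs "HOL-Computational_Algebra.Polynomial"
begin

text \<open>
  Split \<open>K\<^sup>6\<close> into two coordinate 3-spaces and write a trivector as \<open>(\<alpha>, A, B, \<beta>)\<close> with 3 by 3
  matrices \<open>A\<close>, \<open>B\<close>.  Invariance under the torus determines \<open>f\<close> up to a few constants on the slice
  \<open>A = 0\<close>, unipotent matrices move every vector with \<open>\<alpha> \<noteq> 0\<close> into this slice, and so \<open>f\<close> is a multiple of
  \<open>(\<alpha> \<beta> - \<langle>A, B\<rangle>)\<^sup>2 + 4 \<beta> det A + 4 \<alpha> det B - 4 \<langle>cof A, cof B\<rangle>\<close>.  A vector \<open>x\<close> is decomposable iff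
  \<open>f (x + t z) = l(z)\<^sup>2 t\<^sup>2 + O(t\<^sup>3)\<close> for a linear form \<open>l\<close>, so a preserver of \<open>f\<close> can be composed with an element of
  \<open>GL\<^sub>6\<close> to preserve the lines of \<open>e\<^sub>1 \<and> e\<^sub>2 \<and> e\<^sub>3\<close> and \<open>e\<^sub>4 \<and> e\<^sub>5 \<and> e\<^sub>6\<close>.  It then acts on \<open>A\<close> by a map
  scaling the determinant, which by Frobenius is \<open>A \<mapsto> P A R\<close> or \<open>A \<mapsto> P A\<^sup>T R\<close>, and this determines the
  action on \<open>B\<close>.  The first case comes from a block diagonal matrix; the transposition
  \<open>(\<alpha>, A, B, \<beta>) \<mapsto> (\<alpha>, A\<^sup>T, B\<^sup>T, \<beta>)\<close> is the composition of the Hodge star with an element of \<open>SL\<^sub>6\<close>.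
  Polynomial identities in one variable of degree at most 4 are tested at \<open>0\<close>, \<open>\<plusminus>1\<close>, \<open>\<plusminus>2\<close>, which are
  distinct in characteristic other than 2 and 3, so finite fields need no separate treatment.
\<close>

subsection \<open>Indices of the exterior cube\<close>

definition T3 :: "6 \<Rightarrow> 6 \<Rightarrow> 6 \<Rightarrow> sub3" where
  "T3 i j k = Sub3 {i, j, k}"

lemma UNIV_6: "(UNIV :: 6 set) = {0, 1, 2, 3, 4, 5}"
proof -
  have "card {0, 1, 2, 3, 4, 5 :: 6} = card (UNIV :: 6 set)" by simp
  then show ?thesis by (metis card_subset_eq finite subset_UNIV)
qed

lemma exhaust_6: "(x::6) = 0 \<or> x = 1 \<or> x = 2 \<or> x = 3 \<or> x = 4 \<or> x = 5"
  using UNIV_6 by blast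

lemma less6 [simp]: "(0::6) < 1" "(0::6) < 2" "(0::6) < 3" "(0::6) < 4" "(0::6) < 5"
  "(1::6) < 2" "(1::6) < 3" "(1::6) < 4" "(1::6) < 5" "(2::6) < 3" "(2::6) < 4" "(2::6) < 5"
  "(3::6) < 4" "(3::6) < 5" "(4::6) < 5"
  by (simp_all add: less_bit0_def bit0.Rep_0 bit0.Rep_1 bit0.Rep_numeral)

lemma elems_T3 [simp]:
  assumes "i < j" "j < k"
  shows "elems (T3 i j k) = [i, j, k]"
proof -
  obtain I where I: "elems I = [i, j, k]" by (rule elems_surj[OF assms])
  have "set_of_sub3 I = set (elems I)" by (simp add: elems_def)
  then have "I = T3 i j k"
    unfolding T3_def by (metis I set_of_sub3_inverse list.simps(15) empty_set)
  then show ?thesis using I by simp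
qed

lemma T3_eq_iff [simp]:
  assumes "i < j" "j < k" "i' < j'" "j' < k'"
  shows "T3 i j k = T3 i' j' k' \<longleftrightarrow> i = i' \<and> j = j' \<and> k = k'"
  using elems_T3[OF assms(1,2)] elems_T3[OF assms(3,4)] by (metis list.inject)

text \<open>The listed triples are distinct and there are 20 of them, which is 6 choose 3. Their
  order is that of \<open>pack\<close>: one coordinate, the nine entries of each block, one
  coordinate.\<close>

lemma UNIV_sub3: "(UNIV :: sub3 set) = set [T3 0 1 2,
   T3 1 2 3, T3 1 2 4, T3 1 2 5, T3 0 2 3, T3 0 2 4, T3 0 2 5, T3 0 1 3, T3 0 1 4, T3 0 1 5,
   T3 0 4 5, T3 0 3 5, T3 0 3 4, T3 1 4 5, T3 1 3 5, T3 1 3 4, T3 2 4 5, T3 2 3 5, T3 2 3 4,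
   T3 3 4 5]" (is "_ = set ?l")
proof -
  have "card (UNIV :: sub3 set) = card (range set_of_sub3)"
    by (rule card_image[symmetric]) (simp add: inj_on_def set_of_sub3_inject)
  also have "range set_of_sub3 = {I. I \<subseteq> (UNIV :: 6 set) \<and> card I = 3}"
    using type_definition.Rep_range[OF type_definition_sub3] by auto
  also have "card \<dots> = 20"
    by (subst n_subsets) (simp_all add: eval_nat_numeral)
  finally have "card (UNIV :: sub3 set) = 20" .
  moreover have "distinct ?l" by simp
  then have "card (set ?l) = 20" by (subst distinct_card) simp_all
  ultimately show ?thesis
    by (metis card_subset_eq finite subset_UNIV)
qed

lemma sum_sub3:
  fixes h :: "sub3 \<Rightarrow> 'b::comm_monoid_add"
  shows "(\<Sum>I\<in>UNIV. h I) = (\<Sum>I\<leftarrow>[T3 0 1 2,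
   T3 1 2 3, T3 1 2 4, T3 1 2 5, T3 0 2 3, T3 0 2 4, T3 0 2 5, T3 0 1 3, T3 0 1 4, T3 0 1 5,
   T3 0 4 5, T3 0 3 5, T3 0 3 4, T3 1 4 5, T3 1 3 5, T3 1 3 4, T3 2 4 5, T3 2 3 5, T3 2 3 4,
   T3 3 4 5]. h I)"
  unfolding UNIV_sub3 by (rule sum.distinct_set_conv_list) simp

lemma prod_sub3:
  fixes h :: "sub3 \<Rightarrow> 'b::comm_monoid_mult"
  shows "(\<Prod>I\<in>UNIV. h I) = (\<Prod>I\<leftarrow>[T3 0 1 2,
   T3 1 2 3, T3 1 2 4, T3 1 2 5, T3 0 2 3, T3 0 2 4, T3 0 2 5, T3 0 1 3, T3 0 1 4, T3 0 1 5,
   T3 0 4 5, T3 0 3 5, T3 0 3 4, T3 1 4 5, T3 1 3 5, T3 1 3 4, T3 2 4 5, T3 2 3 5, T3 2 3 4,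
   T3 3 4 5]. h I)"
  unfolding UNIV_sub3 by (rule prod.distinct_set_conv_list) simp

subsection \<open>Polynomials as functions\<close>

definition mon_eval :: "(sub3 \<Rightarrow>\<^sub>0 nat) \<Rightarrow> ('a::field) ext3 \<Rightarrow> 'a" where
  "mon_eval m x = (\<Prod>I\<in>UNIV. x $ I ^ Poly_Mapping.lookup m I)"

definition poly_eval :: "('a::field) ext3_poly \<Rightarrow> 'a ext3 \<Rightarrow> 'a" where
  "poly_eval f x = (\<Sum>m\<in>Poly_Mapping.keys f. Poly_Mapping.lookup f m * mon_eval m x)"

lemma poly_eval_superset:
  assumes "finite S" "Poly_Mapping.keys f \<subseteq> S"
  shows "poly_eval f x = (\<Sum>m\<in>S. Poly_Mapping.lookup f m * mon_eval m x)"
  unfolding poly_eval_def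
  by (rule sum.mono_neutral_left) (use assms in \<open>auto simp: in_keys_iff\<close>)

lemma poly_eval_0 [simp]: "poly_eval 0 x = 0"
  by (simp add: poly_eval_def)

lemma poly_eval_add: "poly_eval (f + g) x = poly_eval f x + poly_eval g x"
proof -
  let ?S = "Poly_Mapping.keys f \<union> Poly_Mapping.keys g"
  have "poly_eval h x = (\<Sum>m\<in>?S. Poly_Mapping.lookup h m * mon_eval m x)"
    if "h = f \<or> h = g \<or> h = f + g" for h
    by (rule poly_eval_superset) (use that keys_add[of f g] in auto)
  then show ?thesis by (simp add: lookup_add algebra_simps sum.distrib)
qed

lemma poly_eval_sum: "poly_eval (\<Sum>i\<in>A. h i) x = (\<Sum>i\<in>A. poly_eval (h i) x)"
  by (induction A rule: infinite_finite_induct) (simp_all add: poly_eval_add)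

lemma poly_eval_single [simp]: "poly_eval (Poly_Mapping.single m c) x = c * mon_eval m x"
  by (simp add: poly_eval_superset[of "{m}"])

lemma mon_eval_add: "mon_eval (m + n) x = mon_eval m x * mon_eval n x"
  by (simp add: mon_eval_def lookup_add power_add prod.distrib)

lemma sum_single_keys:
  "f = (\<Sum>m\<in>Poly_Mapping.keys f. Poly_Mapping.single m (Poly_Mapping.lookup f m))"
proof (rule poly_mapping_eqI)
  fix k
  show "Poly_Mapping.lookup f k = Poly_Mapping.lookup
    (\<Sum>m\<in>Poly_Mapping.keys f. Poly_Mapping.single m (Poly_Mapping.lookup f m)) k"
    by (simp add: lookup_sum lookup_single when_def in_keys_iff)
qed

lemma poly_eval_mult: "poly_eval (f * g) x = poly_eval f x * poly_eval g x"
proof -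
  let ?s = "\<lambda>f m. Poly_Mapping.single m (Poly_Mapping.lookup f m) :: 'a ext3_poly"
  have "f * g = (\<Sum>m\<in>Poly_Mapping.keys f. ?s f m) * (\<Sum>n\<in>Poly_Mapping.keys g. ?s g n)"
    by (simp only: sum_single_keys[symmetric])
  then have "poly_eval (f * g) x = (\<Sum>m\<in>Poly_Mapping.keys f. \<Sum>n\<in>Poly_Mapping.keys g.
      (Poly_Mapping.lookup f m * Poly_Mapping.lookup g n) * (mon_eval m x * mon_eval n x))"
    by (simp add: sum_product poly_eval_sum mult_single mon_eval_add)
  also have "\<dots> = poly_eval f x * poly_eval g x"
    by (simp add: poly_eval_def sum_product mult.assoc mult.left_commute)
  finally show ?thesis .
qed

lemma poly_eval_1 [simp]: "poly_eval 1 x = 1"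
  by (simp add: poly_eval_superset[of "{0}"] mon_eval_def)

lemma poly_eval_prod: "poly_eval (\<Prod>i\<in>A. h i) x = (\<Prod>i\<in>A. poly_eval (h i) x)"
  by (induction A rule: infinite_finite_induct) (simp_all add: poly_eval_mult)

lemma poly_eval_power: "poly_eval (f ^ n) x = poly_eval f x ^ n"
  by (induction n) (simp_all add: poly_eval_mult)

lemma poly_eval_const [simp]: "poly_eval (poly_const c) x = c"
  by (simp add: poly_const_def mon_eval_def)

lemma poly_eval_var [simp]: "poly_eval (poly_var I) x = x $ I"
proof -
  have "mon_eval (Poly_Mapping.single I 1) x = (\<Prod>J\<in>UNIV. if J = I then x $ I else 1)"
    unfolding mon_eval_def by (rule prod.cong) (auto simp: lookup_single when_def)
  then show ?thesis by (simp add: poly_var_def)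
qed

lemma linear_expand:
  fixes \<phi> :: "('a::field) ^ 'm \<Rightarrow> 'a ^ 'n"
  assumes "Vector_Spaces.linear (*s) (*s) \<phi>"
  shows "\<phi> x = (\<Sum>J\<in>UNIV. x $ J *s \<phi> (axis J 1))"
proof -
  interpret Vector_Spaces.linear "(*s)" "(*s)" \<phi> by fact
  have "\<phi> x = \<phi> (\<Sum>J\<in>UNIV. x $ J *s axis J 1)" by (simp add: basis_expansion)
  then show ?thesis by (simp add: sum scale)
qed

text \<open>Turns the formal identity \<open>pullback \<phi> f = f\<close> into invariance of the
  values of \<open>f\<close>, the form in which it is used for a preserver.\<close>

lemma poly_eval_pullback:
  assumes "Vector_Spaces.linear (*s) (*s) \<phi>"
  shows "poly_eval (pullback \<phi> f) x = poly_eval f (\<phi> x)"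
proof -
  have "(\<Sum>J\<in>UNIV. \<phi> (axis J 1) $ I * x $ J) = \<phi> x $ I" for I
    by (subst (2) linear_expand[OF assms]) (simp add: mult.commute)
  then show ?thesis
    by (simp add: pullback_def poly_eval_sum poly_eval_mult poly_eval_prod poly_eval_power
        poly_eval_def[of f] mon_eval_def)
qed

section \<open>Restriction of a quartic form to a line\<close>

lemma coeff_mult_degree_le:
  fixes p q :: "'a::comm_semiring_0 poly"
  assumes "degree p \<le> a" "degree q \<le> b"
  shows "coeff (p * q) (a + b) = coeff p a * coeff q b"
proof -
  have "coeff (p * q) (a + b) = (\<Sum>i\<le>a + b. if i = a then coeff p a * coeff q b else 0)"
    unfolding coeff_mult
  proof (rule sum.cong[OF refl])
    fix i assume "i \<in> {..a + b}"
    show "coeff p i * coeff q (a + b - i) = (if i = a then coeff p a * coeff q b else 0)"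
      using assms by (cases i a rule: linorder_cases) (auto simp: coeff_eq_0)
  qed
  then show ?thesis by simp
qed

text \<open>Degree bounds take the place of degrees because the coefficients at the bound may
  vanish.\<close>

lemma prod_degree_le_coeff:
  fixes p :: "'i \<Rightarrow> 'a::comm_semiring_1 poly"
  assumes "finite A" "\<And>i. i \<in> A \<Longrightarrow> degree (p i) \<le> n i"
  shows "degree (\<Prod>i\<in>A. p i) \<le> (\<Sum>i\<in>A. n i) \<and>
    coeff (\<Prod>i\<in>A. p i) (\<Sum>i\<in>A. n i) = (\<Prod>i\<in>A. coeff (p i) (n i))"
  using assms
proof (induction A rule: finite_induct)
  case (insert i A)
  then have "degree (\<Prod>i\<in>A. p i) \<le> (\<Sum>i\<in>A. n i)" "degree (p i) \<le> n i" by auto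
  moreover from this have "degree (p i * (\<Prod>i\<in>A. p i)) \<le> n i + (\<Sum>i\<in>A. n i)"
    by (meson add_mono degree_mult_le order.trans)
  ultimately show ?case using insert by (simp add: coeff_mult_degree_le)
qed simp

lemma linear_power_degree_coeff:
  fixes a b :: "'a::comm_semiring_1"
  shows "degree ([:a, b:] ^ n) \<le> n \<and> coeff ([:a, b:] ^ n) n = b ^ n"
  using prod_degree_le_coeff[of "{..<n}" "\<lambda>_. [:a, b:]" "\<lambda>_. 1"] by simp

lemma sum_atMost_4:
  fixes h :: "nat \<Rightarrow> 'b::comm_monoid_add"
  shows "(\<Sum>k\<le>4. h k) = h 0 + h 1 + h 2 + h 3 + h 4"
  by (simp add: eval_nat_numeral)

text \<open>Along the line each monomial is a product of four linear factors in t, so the extreme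
  coefficients are the values of the form at x and at y.\<close>

lemma quartic_line:
  fixes f :: "('a::field) ext3_poly"
  assumes "homogeneous 4 f"
  obtains c1 c2 c3 where "\<And>t. poly_eval f (x + t *s y) =
    poly_eval f x + c1 * t + c2 * t\<^sup>2 + c3 * t ^ 3 + poly_eval f y * t ^ 4"
proof -
  define P where "P m = (\<Prod>I\<in>UNIV. [:x $ I, y $ I:] ^ Poly_Mapping.lookup m I)" for m
  define p where "p = (\<Sum>m\<in>Poly_Mapping.keys f. Polynomial.smult (Poly_Mapping.lookup f m) (P m))"
  have P: "degree (P m) \<le> 4 \<and> coeff (P m) 4 = mon_eval m y" if "m \<in> Poly_Mapping.keys f" for m
  proof -
    have "(\<Sum>I\<in>UNIV. Poly_Mapping.lookup m I) = 4"
      using assms that by (simp add: homogeneous_def)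
    then show ?thesis
      using prod_degree_le_coeff[of UNIV "\<lambda>I. [:x $ I, y $ I:] ^ Poly_Mapping.lookup m I"
          "Poly_Mapping.lookup m"]
      by (simp add: P_def mon_eval_def linear_power_degree_coeff)
  qed
  have "degree p \<le> 4"
    unfolding p_def by (rule degree_sum_le) (auto intro: order.trans[OF degree_smult_le] P[THEN conjunct1])
  have ev: "poly p t = poly_eval f (x + t *s y)" for t
    by (simp add: p_def P_def poly_sum poly_prod poly_eval_def mon_eval_def)
  have "poly p t = coeff p 0 + coeff p 1 * t + coeff p 2 * t\<^sup>2 + coeff p 3 * t ^ 3 + coeff p 4 * t ^ 4" for t
  proof -
    have "poly p t = (\<Sum>k\<le>4. coeff p k * t ^ k)"
      unfolding poly_altdef
      by (rule sum.mono_neutral_left) (use \<open>degree p \<le> 4\<close> in \<open>auto simp: coeff_eq_0\<close>)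
    then show ?thesis by (simp add: sum_atMost_4)
  qed
  moreover have "coeff p 0 = poly_eval f x"
    using ev[of 0] by (simp add: poly_0_coeff_0)
  moreover have "coeff p 4 = poly_eval f y"
    using P by (simp add: p_def coeff_sum poly_eval_def)
  ultimately show ?thesis using that ev by metis
qed

text \<open>Adding the values at t and -t separates the even coefficients. The even and the odd part
  then both lead to a linear system with rows (1, 1) and (1, 4), of determinant 3.\<close>

lemma quartic_zero:
  fixes a0 :: "'a::field"
  assumes "(2::'a) \<noteq> 0" "(3::'a) \<noteq> 0"
    and z: "\<And>t. a0 + a1 * t + a2 * t\<^sup>2 + a3 * t ^ 3 + a4 * t ^ 4 = 0"
  shows "a0 = 0 \<and> a1 = 0 \<and> a2 = 0 \<and> a3 = 0 \<and> a4 = 0"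
proof -
  note z1 = z[of 1] and z2 = z[of "-1"] and z3 = z[of 2] and z4 = z[of "-2"]
  have a0: "a0 = 0" using z[of 0] by simp
  have e1: "2 * (a2 + a4) = 0" using z1 z2 a0 by simp algebra
  have "2 * 2 * 2 * (a2 + 4 * a4) = 0" using z3 z4 a0 by simp algebra
  then have e2: "a2 + 4 * a4 = 0" using assms by (metis mult_eq_0_iff)
  have e1': "a2 + a4 = 0" using mult_eq_0_iff[THEN iffD1, OF e1] assms(1) by blast
  have "3 * a4 = 0" using e1' e2 by algebra
  then have a4: "a4 = 0" using assms by (metis mult_eq_0_iff)
  then have a2: "a2 = 0" using e1' by simp
  have e3: "a1 + a3 = 0" using z1 a0 a2 a4 by simp
  have "2 * (a1 + 4 * a3) = 0" using z3 a0 a2 a4 by simp algebra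
  then have "a1 + 4 * a3 = 0" using assms by (metis mult_eq_0_iff)
  then have "3 * a3 = 0" using e3 by algebra
  then have "a3 = 0" using assms by (metis mult_eq_0_iff)
  then show ?thesis using a0 a2 a4 e3 by simp
qed

lemma quartic_coeffs_eq:
  fixes a0 :: "'a::field"
  assumes "(2::'a) \<noteq> 0" "(3::'a) \<noteq> 0"
    and "\<And>t. a0 + a1 * t + a2 * t\<^sup>2 + a3 * t ^ 3 + a4 * t ^ 4
      = b0 + b1 * t + b2 * t\<^sup>2 + b3 * t ^ 3 + b4 * t ^ 4"
  shows "a0 = b0 \<and> a1 = b1 \<and> a2 = b2 \<and> a3 = b3 \<and> a4 = b4"
proof -
  have "(a0 - b0) + (a1 - b1) * t + (a2 - b2) * t\<^sup>2 + (a3 - b3) * t ^ 3 + (a4 - b4) * t ^ 4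
      = (a0 + a1 * t + a2 * t\<^sup>2 + a3 * t ^ 3 + a4 * t ^ 4) - (b0 + b1 * t + b2 * t\<^sup>2 + b3 * t ^ 3 + b4 * t ^ 4)" for t
    by (simp add: left_diff_distrib)
  then have "(a0 - b0) + (a1 - b1) * t + (a2 - b2) * t\<^sup>2 + (a3 - b3) * t ^ 3 + (a4 - b4) * t ^ 4 = 0" for t
    by (simp only: assms(3) diff_self)
  from quartic_zero[OF assms(1,2) this] show ?thesis by simp
qed

lemma CHAR_neq_prime:
  assumes "CHAR('a::field) \<noteq> p" "prime p"
  shows "(of_nat p :: 'a) \<noteq> 0"
  using assms prime_nat_iff by (auto simp: of_nat_eq_0_iff_char_dvd)

text \<open>A nonzero polynomial of degree at most 4 in one variable has a nonzero value at
  \<open>0\<close>, \<open>\<plusminus>1\<close> or \<open>\<plusminus>2\<close>.\<close>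
lemma monomials_independent:
  fixes c :: "'m \<Rightarrow> 'a::field" and e :: "'m \<Rightarrow> 'i \<Rightarrow> nat"
  assumes char: "(2::'a) \<noteq> 0" "(3::'a) \<noteq> 0"
    and "finite S" "finite M" "\<And>m i. m \<in> M \<Longrightarrow> e m i \<le> 4"
    and "\<And>x. (\<Sum>m\<in>M. c m * (\<Prod>i\<in>S. x i ^ e m i)) = 0"
  shows "(\<Sum>m | m \<in> M \<and> (\<forall>i\<in>S. e m i = r i). c m) = 0"
  using assms(3-)
proof (induction S arbitrary: M rule: finite_induct)
  case (insert j S)
  \<comment> \<open>Terms are collected by the exponent k of the variable j; with the other
    variables fixed, the sum is a polynomial in the value t of that variable.\<close>
  define G where "G x k = (\<Sum>m | m \<in> M \<and> e m j = k. c m * (\<Prod>i\<in>S. x i ^ e m i))" for x k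
  have G0: "G x k = 0" for x k
  proof (cases "k \<le> 4")
    case True
    have "G x 0 + G x 1 * t + G x 2 * t\<^sup>2 + G x 3 * t ^ 3 + G x 4 * t ^ 4 = 0" for t
    proof -
      have "(\<Prod>i\<in>insert j S. (x(j := t)) i ^ e m i) = t ^ e m j * (\<Prod>i\<in>S. x i ^ e m i)" for m
      proof -
        have "(\<Prod>i\<in>S. (x(j := t)) i ^ e m i) = (\<Prod>i\<in>S. x i ^ e m i)"
          by (rule prod.cong) (use insert.hyps in auto)
        then show ?thesis using insert.hyps by simp
      qed
      then have "0 = (\<Sum>m\<in>M. t ^ e m j * (c m * (\<Prod>i\<in>S. x i ^ e m i)))"
        using insert.prems(3)[of "x(j := t)"] by (simp add: mult.left_commute)
      also have "\<dots> = (\<Sum>k\<le>4. \<Sum>m | m \<in> M \<and> e m j = k. t ^ e m j * (c m * (\<Prod>i\<in>S. x i ^ e m i)))"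
        by (rule sum.group[symmetric]) (use insert.prems in auto)
      also have "\<dots> = (\<Sum>k\<le>4. G x k * t ^ k)"
        unfolding G_def sum_distrib_right by (intro sum.cong refl) auto
      finally show ?thesis by (simp add: sum_atMost_4)
    qed
    from quartic_zero[OF char this] True show ?thesis
      by (auto simp: le_Suc_eq eval_nat_numeral)
  next
    case False
    then have "{m. m \<in> M \<and> e m j = k} = {}" using insert.prems(2)[of _ j] by auto
    then show ?thesis by (simp only: G_def sum.empty)
  qed
  have "(\<Sum>m | m \<in> {m \<in> M. e m j = r j} \<and> (\<forall>i\<in>S. e m i = r i). c m) = 0"
    by (rule insert.IH) (use insert.prems G0[of _ "r j"] in \<open>auto simp: G_def\<close>)
  also have "{m. m \<in> {m \<in> M. e m j = r j} \<and> (\<forall>i\<in>S. e m i = r i)} =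
      {m. m \<in> M \<and> (\<forall>i\<in>insert j S. e m i = r i)}" by auto
  finally show ?case .
qed simp

text \<open>Exponents in a form of degree 4 are at most 4, so distinct monomials are independent as
  functions even over the field with five elements.\<close>

lemma poly_eval_eq_0:
  fixes f :: "('a::field) ext3_poly"
  assumes char: "(2::'a) \<noteq> 0" "(3::'a) \<noteq> 0"
    and hom: "homogeneous 4 f" and z: "\<And>x. poly_eval f x = 0"
  shows "f = 0"
proof (rule poly_mapping_eqI)
  fix n
  have "Poly_Mapping.lookup m I \<le> 4" if "m \<in> Poly_Mapping.keys f" for m I
    using hom that member_le_sum[of I UNIV "Poly_Mapping.lookup m"] by (simp add: homogeneous_def)
  moreover have "(\<Sum>m\<in>Poly_Mapping.keys f. Poly_Mapping.lookup f m *
      (\<Prod>I\<in>UNIV. x I ^ Poly_Mapping.lookup m I)) = 0" for x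
    using z[of "\<chi> I. x I"] by (simp add: poly_eval_def mon_eval_def)
  ultimately have "(\<Sum>m | m \<in> Poly_Mapping.keys f \<and> (\<forall>I\<in>UNIV. Poly_Mapping.lookup m I = Poly_Mapping.lookup n I).
      Poly_Mapping.lookup f m) = 0"
    by (intro monomials_independent[OF char]) auto
  moreover have "{m. m \<in> Poly_Mapping.keys f \<and> (\<forall>I\<in>UNIV. Poly_Mapping.lookup m I = Poly_Mapping.lookup n I)}
     = (if n \<in> Poly_Mapping.keys f then {n} else {})"
    by (auto intro: poly_mapping_eqI) (metis poly_mapping_eqI)
  ultimately show "Poly_Mapping.lookup f n = Poly_Mapping.lookup 0 n"
    by (auto simp: in_keys_iff split: if_splits)
qed

subsection \<open>Weights of an invariant quartic\<close>

lemma linear_wedge3_map: "Vector_Spaces.linear (*s) (*s) (wedge3_map g)"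
  unfolding wedge3_map_def by (rule linear_ext3_lift)

lemma ext3_linear_eqI:
  fixes L L' :: "('a::field) ext3 \<Rightarrow> 'a ^ 'n"
  assumes "Vector_Spaces.linear (*s) (*s) L" "Vector_Spaces.linear (*s) (*s) L'"
    and "\<And>u v w. L (wedge3 u v w) = L' (wedge3 u v w)"
  shows "L = L'"
proof
  fix x
  have "L (axis I 1) = L' (axis I 1)" for I
    using assms(3) wedge3_basis[OF elems_eq[of I]] by metis
  then show "L x = L' x"
    by (simp add: linear_expand[OF assms(1), of x] linear_expand[OF assms(2), of x])
qed

lemma linear_compose_vec:
  fixes f :: "('a::field) ^ 'm \<Rightarrow> 'a ^ 'n" and g :: "'a ^ 'n \<Rightarrow> 'a ^ 'k"
  assumes "Vector_Spaces.linear (*s) (*s) f" "Vector_Spaces.linear (*s) (*s) g"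
  shows "Vector_Spaces.linear (*s) (*s) (\<lambda>x. g (f x))"
  using Vector_Spaces.linear_compose[OF assms] by (simp add: o_def)

lemma wedge3_map_mult: "wedge3_map (g ** h) = (\<lambda>x. wedge3_map g (wedge3_map h x))"
  by (rule ext3_linear_eqI)
     (simp_all add: linear_compose_vec linear_wedge3_map wedge3_map_wedge3 matrix_vector_mul_assoc)

lemma wedge3_map_1 [simp]: "wedge3_map (mat 1) x = x"
proof -
  have "wedge3_map (mat 1) = (\<lambda>x :: 'a ext3. x)"
    by (rule ext3_linear_eqI)
       (simp_all add: linear_wedge3_map wedge3_map_wedge3 vec_linearI)
  then show ?thesis by simp
qed

lemma wedge3_rules:
  "wedge3 (x + y) v w = wedge3 x v w + wedge3 y v w"
  "wedge3 v (x + y) w = wedge3 v x w + wedge3 v y w"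
  "wedge3 v w (x + y) = wedge3 v w x + wedge3 v w y"
  "wedge3 (c *s x) v w = c *s wedge3 x v w" "wedge3 v (c *s x) w = c *s wedge3 v x w"
  "wedge3 v w (c *s x) = c *s wedge3 v w x"
  using alternating3_wedge3[where 'a = 'a]
  unfolding alternating3_def Vector_Spaces.linear_iff by blast+

lemma matrix_mult_axis_component [simp]:
  "((A :: 'a::semiring_1 ^ 'n ^ 'm) *v axis k 1) $ i = A $ i $ k"
  by (simp add: matrix_vector_mult_def axis_def if_distrib cong: if_cong)

text \<open>The elementary matrix with entry t at (i, j), written as a row operation so that
  \<open>det_row_operation\<close> gives its determinant.\<close>

definition transvection :: "6 \<Rightarrow> 6 \<Rightarrow> 'a::field \<Rightarrow> 'a ^ 6 ^ 6" where
  "transvection i j t = (\<chi> r. if r = i then row i (mat 1) + t *s row j (mat 1) else row r (mat 1))"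

lemma det_transvection: "i \<noteq> j \<Longrightarrow> det (transvection i j t) = 1"
  unfolding transvection_def by (subst det_row_operation) auto

lemma transvection_axis:
  "i \<noteq> j \<Longrightarrow> transvection i j t *v axis k 1 = (if k = j then axis k 1 + t *s axis i 1 else axis k 1)"
  by (auto simp: vec_eq_iff) (simp_all add: transvection_def row_def mat_def axis_def)

definition diag6 :: "(6 \<Rightarrow> 'a::field) \<Rightarrow> 'a ^ 6 ^ 6" where
  "diag6 d = (\<chi> r s. if r = s then d r else 0)"

lemma diag6_mult: "diag6 d ** diag6 e = diag6 (\<lambda>r. d r * e r)"
proof -
  have "(\<Sum>k\<in>UNIV. (if i = k then d i else 0) * (if k = j then e k else 0)) =
      (\<Sum>k\<in>UNIV. if k = i then (if i = j then d i * e i else 0) else 0)" for i j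
    by (rule sum.cong) auto
  then show ?thesis by (simp add: diag6_def vec_eq_iff matrix_matrix_mult_def)
qed

lemma det_diag6: "det (diag6 d) = (\<Prod>r\<in>UNIV. d r)"
  by (subst det_diagonal) (simp_all add: diag6_def)

lemma diag6_axis: "diag6 d *v axis k 1 = d k *s axis k 1"
  by (auto simp: vec_eq_iff) (simp_all add: diag6_def axis_def)

lemma set_of_sub3_elems: "set_of_sub3 I = {elems I ! 0, elems I ! 1, elems I ! 2}"
proof -
  have "set_of_sub3 I = set (elems I)" by (simp add: elems_def)
  then show ?thesis by (subst (asm) elems_eq) simp
qed

lemma wedge3_map_diag6_axis:
  "wedge3_map (diag6 d) (axis I 1) = (\<Prod>i\<in>set_of_sub3 I. d i) *s axis I 1"
proof -
  have "(\<Prod>i\<in>set_of_sub3 I. d i) = d (elems I ! 0) * (d (elems I ! 1) * d (elems I ! 2))"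
    using elems_strict[of I, THEN less_imp_neq] by (simp add: set_of_sub3_elems)
  moreover have "axis I 1 = wedge3 (axis (elems I ! 0) 1) (axis (elems I ! 1) 1) (axis (elems I ! 2) (1::'a))"
    by (rule wedge3_basis[OF elems_eq, symmetric])
  ultimately show ?thesis
    by (simp add: wedge3_map_wedge3 diag6_axis wedge3_rules mult.assoc)
qed

lemma prod_single:
  "finite A \<Longrightarrow> (\<Prod>i\<in>A. Poly_Mapping.single (a i) (b i)) =
    (Poly_Mapping.single (\<Sum>i\<in>A. a i) (\<Prod>i\<in>A. b i) :: ('i::comm_monoid_add) \<Rightarrow>\<^sub>0 'a::comm_semiring_1)"
  by (induction A rule: finite_induct) (simp_all add: mult_single)

lemma power_single_single:
  "Poly_Mapping.single (Poly_Mapping.single I 1) c ^ n =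
    (Poly_Mapping.single (Poly_Mapping.single I n) (c ^ n) :: ('i \<Rightarrow>\<^sub>0 nat) \<Rightarrow>\<^sub>0 'a::comm_semiring_1)"
  by (induction n) (simp_all add: mult_single single_add[symmetric])

lemma sum_single_lookup:
  fixes m :: "('i::finite) \<Rightarrow>\<^sub>0 nat"
  shows "(\<Sum>I\<in>UNIV. Poly_Mapping.single I (Poly_Mapping.lookup m I)) = m"
  by (rule poly_mapping_eqI) (simp add: lookup_sum lookup_single when_def)

text \<open>A diagonal substitution rescales each monomial separately, so invariance under it is a
  condition on every monomial that occurs.\<close>

lemma lookup_pullback_diagonal:
  fixes f :: "('a::field) ext3_poly"
  assumes "\<And>J. \<phi> (axis J 1) = c J *s axis J 1"
  shows "Poly_Mapping.lookup (pullback \<phi> f) m = Poly_Mapping.lookup f m * (\<Prod>I\<in>UNIV. c I ^ Poly_Mapping.lookup m I)"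
proof -
  have comp: "\<phi> (axis J 1) $ I = (if J = I then c I else 0)" for I J
    unfolding assms by (simp add: axis_def)
  have lin: "(\<Sum>J\<in>UNIV. poly_const (\<phi> (axis J 1) $ I) * poly_var J) =
      Poly_Mapping.single (Poly_Mapping.single I 1) (c I)" for I
  proof -
    have "(\<Sum>J\<in>UNIV. poly_const (\<phi> (axis J 1) $ I) * poly_var J) =
      (\<Sum>J\<in>UNIV. if J = I then Poly_Mapping.single (Poly_Mapping.single I 1) (c I) else 0)"
      by (rule sum.cong) (auto simp: comp poly_const_def poly_var_def mult_single)
    then show ?thesis by simp
  qed
  have "pullback \<phi> f = (\<Sum>m\<in>Poly_Mapping.keys f. Poly_Mapping.single m
     (Poly_Mapping.lookup f m * (\<Prod>I\<in>UNIV. c I ^ Poly_Mapping.lookup m I)))"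
    unfolding pullback_def
    by (simp only: lin power_single_single prod_single[OF finite_class.finite_UNIV] sum_single_lookup)
       (simp only: poly_const_def mult_single add_0_left)
  then show ?thesis
    by (simp add: lookup_sum lookup_single when_def in_keys_iff)
qed

locale invariant_quartic =
  fixes f :: "('a::field) ext3_poly"
  assumes two: "(2::'a) \<noteq> 0" and three: "(3::'a) \<noteq> 0"
    and inv: "SL6_invariant_quartic f"
begin

abbreviation F :: "'a ext3 \<Rightarrow> 'a" where "F \<equiv> poly_eval f"

lemma hom: "homogeneous 4 f"
  using inv by (simp add: SL6_invariant_quartic_def)

lemma F_invariant: "det g = 1 \<Longrightarrow> F (wedge3_map g x) = F x"
  using inv poly_eval_pullback[OF linear_wedge3_map, of g f x]
  by (simp add: SL6_invariant_quartic_def)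

text \<open>For an index i outside I, a transvection moves \<open>w i\<close> along the line with
  direction \<open>w a = axis I 1\<close>. F is constant on this line, and
  \<open>F (axis I 1)\<close> is its coefficient of \<open>t ^ 4\<close> there.\<close>

lemma F_axis: "F (axis I 1) = 0"
proof -
  define a b c where "a = elems I ! 0" "b = elems I ! 1" "c = elems I ! 2"
  define w where "w i = wedge3 (axis i 1) (axis b 1) (axis c (1::'a))" for i
  have neq: "a \<noteq> b" "a \<noteq> c" using elems_strict[of I] by (simp_all add: a_b_c_def)
  have "card {a, b, c} \<noteq> card (UNIV :: 6 set)"
    using card_set_of_sub3[of I] by (simp add: set_of_sub3_elems a_b_c_def)
  then obtain i where i: "i \<notin> {a, b, c}" by (metis UNIV_eq_I)
  obtain c1 c2 c3 where c: "\<And>t. F (w i + t *s w a) =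
      F (w i) + c1 * t + c2 * t\<^sup>2 + c3 * t ^ 3 + F (w a) * t ^ 4"
    using quartic_line[OF hom] by blast
  have "F (w i + t *s w a) = F (w i)" for t
  proof -
    have "wedge3_map (transvection a i t) (w i) = w i + t *s w a"
      using i neq by (auto simp: w_def wedge3_map_wedge3 transvection_axis wedge3_rules)
    then show ?thesis using F_invariant[OF det_transvection[of a i t], of "w i"] i by auto
  qed
  then have "c1 * t + c2 * t\<^sup>2 + c3 * t ^ 3 + F (w a) * t ^ 4 = 0" for t
    using c[of t] by (simp add: add.assoc)
  then have "F (w a) = 0" using quartic_zero[OF two three, of 0 c1 c2 c3 "F (w a)"] by simp
  moreover have "w a = axis I 1"
    unfolding w_def a_b_c_def by (rule wedge3_basis[OF elems_eq])
  ultimately show ?thesis by simp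
qed

text \<open>Equality of all the weights of a monomial follows from invariance under the diagonal matrices
  with entries \<open>t\<close>, \<open>1 / t\<close>, \<open>1\<close>, except that for \<open>K = \<bbbF>\<^sub>5\<close> these do not
  separate the exponents 0 and 4; the surviving monomials are then fourth powers.\<close>
lemma weight:
  assumes m: "m \<in> Poly_Mapping.keys f"
  shows "(\<Sum>I | i \<in> set_of_sub3 I. Poly_Mapping.lookup m I) = 2"
proof -
  define n where "n i = (\<Sum>I | i \<in> set_of_sub3 I. Poly_Mapping.lookup m I)" for i
  have total: "(\<Sum>I\<in>UNIV. Poly_Mapping.lookup m I) = 4"
    using hom m by (simp add: homogeneous_def)
  have le: "n i \<le> 4" for i
    unfolding n_def total[symmetric] by (rule sum_mono2) auto
  have pow: "t ^ n i = t ^ n j" if "t \<noteq> 0" for t :: 'a and i j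
  proof (cases "i = j")
    case False
    define d where "d = (\<lambda>r. if r = i then t else if r = j then 1 / t else 1)"
    have "(\<Prod>r\<in>UNIV. d r) = (\<Prod>r\<in>{i, j}. d r)"
      by (rule prod.mono_neutral_right) (auto simp: d_def)
    then have "det (diag6 d) = 1" using False that by (simp add: det_diag6 d_def)
    then have "pullback (wedge3_map (diag6 d)) f = f"
      using inv by (simp add: SL6_invariant_quartic_def)
    with lookup_pullback_diagonal[of "wedge3_map (diag6 d)", OF wedge3_map_diag6_axis, of f m]
    have 1: "(\<Prod>I\<in>UNIV. (\<Prod>r\<in>set_of_sub3 I. d r) ^ Poly_Mapping.lookup m I) = 1"
      using m by (simp add: in_keys_iff)
    have "(\<Prod>r\<in>set_of_sub3 I. d r) = (if i \<in> set_of_sub3 I then t else 1) * (if j \<in> set_of_sub3 I then 1 / t else 1)" for I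
    proof -
      have "(\<Prod>r\<in>set_of_sub3 I. d r) = (\<Prod>r\<in>set_of_sub3 I. (if r = i then t else 1) * (if r = j then 1 / t else 1))"
        by (rule prod.cong) (use False in \<open>auto simp: d_def\<close>)
      then show ?thesis by (simp add: prod.distrib)
    qed
    with 1 have "(\<Prod>I\<in>UNIV. (if i \<in> set_of_sub3 I then t else 1) ^ Poly_Mapping.lookup m I) *
       (\<Prod>I\<in>UNIV. (if j \<in> set_of_sub3 I then 1 / t else 1) ^ Poly_Mapping.lookup m I) = 1"
      by (simp add: power_mult_distrib prod.distrib)
    moreover have "(\<Prod>I\<in>UNIV. (if k \<in> set_of_sub3 I then u else 1) ^ Poly_Mapping.lookup m I) = u ^ n k"
      for k and u :: 'a
    proof -
      have "(\<Prod>I\<in>UNIV. (if k \<in> set_of_sub3 I then u else 1) ^ Poly_Mapping.lookup m I) =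
        (\<Prod>I | k \<in> set_of_sub3 I. u ^ Poly_Mapping.lookup m I)"
        by (rule prod.mono_neutral_cong_right) auto
      then show ?thesis by (simp add: n_def power_sum)
    qed
    ultimately have "t ^ n i * (1 / t) ^ n j = 1" by simp
    then show ?thesis using that by (simp add: field_simps)
  qed simp
  have dich: "n i = n j \<or> n i = 0 \<and> n j = 4 \<or> n i = 4 \<and> n j = 0" for i j
  proof -
    \<comment> \<open>The choice t = -1 excludes odd d, and t = 2 excludes d = 2 because 4 - 1 = 3
      is nonzero.\<close>
    have d: "d = 0 \<or> d = 4" if "(2::'a) ^ d = 1" "(-1::'a) ^ d = 1" "d \<le> 4" for d :: nat
    proof -
      have "d = 0 \<or> d = 1 \<or> d = 2 \<or> d = 3 \<or> d = 4" using that(3) by arith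
      moreover have "(-1::'a) \<noteq> 1" using two by (metis add.inverse_inverse neg_eq_iff_add_eq_0 one_add_one)
      moreover have "(4::'a) \<noteq> 1"
      proof
        assume "(4::'a) = 1"
        moreover have "(3::'a) = 4 - 1" by simp
        ultimately have "(3::'a) = 0" by (metis diff_self)
        then show False using three by simp
      qed
      ultimately show ?thesis using that(1,2) by auto
    qed
    have "n j - n i = 0 \<or> n j - n i = 4" if "n i \<le> n j" for i j
    proof (rule d)
      have "n j = n i + (n j - n i)" using that by simp
      then have "t ^ n i * t ^ (n j - n i) = t ^ n i" if "t \<noteq> 0" for t :: 'a
        using pow[OF that, of i j] by (metis power_add)
      from this[of 2] this[of "-1"] two
      show "(2::'a) ^ (n j - n i) = 1" "(-1::'a) ^ (n j - n i) = 1" by simp_all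
    qed (use le[of j] in simp)
    from this[of i j] this[of j i] show ?thesis using le[of i] le[of j] by linarith
  qed
  show ?thesis
  proof (cases "\<forall>i j. n i = n j")
    case True
    \<comment> \<open>Each variable counts in three of the six weights, so the weights add up to 3 *
      4 = 12.\<close>
    have "(\<Sum>i\<in>UNIV. n i) = (\<Sum>i\<in>UNIV. \<Sum>I\<in>UNIV. if i \<in> set_of_sub3 I then Poly_Mapping.lookup m I else 0)"
      by (simp add: n_def sum.If_cases)
    also have "\<dots> = (\<Sum>I\<in>UNIV. \<Sum>i\<in>UNIV. if i \<in> set_of_sub3 I then Poly_Mapping.lookup m I else 0)"
      by (rule sum.swap)
    also have "\<dots> = (\<Sum>I\<in>UNIV. 3 * Poly_Mapping.lookup m I)"
      by (simp add: sum.If_cases card_set_of_sub3)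
    also have "\<dots> = 12" by (simp add: sum_distrib_left[symmetric] total)
    finally have "(\<Sum>i\<in>UNIV. n i) = 12" .
    moreover have "(\<Sum>j\<in>UNIV. n j) = (\<Sum>j\<in>(UNIV :: 6 set). n i)"
      by (rule sum.cong) (use True in auto)
    ultimately show ?thesis by (simp add: n_def)
  next
    case False
    then have n04: "n i = 0 \<or> n i = 4" for i using dich by metis
    obtain J where J: "Poly_Mapping.lookup m J \<noteq> 0" using total by fastforce
    \<comment> \<open>A weight 4 at i means that every variable of m has i in its index set. This
      holds for all i in J, so J is the only index occurring in m.\<close>
    have K: "Poly_Mapping.lookup m K = 0" if "K \<noteq> J" for K
    proof (rule ccontr)
      assume mK: "Poly_Mapping.lookup m K \<noteq> 0"
      have "set_of_sub3 J \<subseteq> set_of_sub3 K"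
      proof
        fix i assume i: "i \<in> set_of_sub3 J"
        then have "n i \<noteq> 0" using J by (auto simp: n_def)
        then have n4: "n i = 4" using n04[of i] by simp
        have "(\<Sum>I\<in>UNIV. Poly_Mapping.lookup m I) = n i + (\<Sum>I | i \<notin> set_of_sub3 I. Poly_Mapping.lookup m I)"
          unfolding n_def by (subst sum.union_disjoint[symmetric]) (auto intro: sum.cong)
        then have "(\<Sum>I | i \<notin> set_of_sub3 I. Poly_Mapping.lookup m I) = 0"
          using total n4 by simp
        then show "i \<in> set_of_sub3 K" using mK by auto
      qed
      then have "set_of_sub3 J = set_of_sub3 K"
        by (intro card_subset_eq) (simp_all add: card_set_of_sub3)
      then show False using that set_of_sub3_inject by metis
    qed
    \<comment> \<open>At the basis vector of J only m has a nonzero value, so its coefficient is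
      \<open>F (axis J 1)\<close>, which vanishes.\<close>
    have "mon_eval m' (axis J 1) = (if m' = m then 1 else 0 :: 'a)" if m': "m' \<in> Poly_Mapping.keys f" for m'
    proof (cases "\<forall>K. K \<noteq> J \<longrightarrow> Poly_Mapping.lookup m' K = 0")
      case True
      have "(\<Sum>I\<in>UNIV. Poly_Mapping.lookup m' I) = 4" using hom m' by (simp add: homogeneous_def)
      moreover have "(\<Sum>I\<in>UNIV. Poly_Mapping.lookup q I) = (\<Sum>I\<in>{J}. Poly_Mapping.lookup q I)"
        if "\<forall>K. K \<noteq> J \<longrightarrow> Poly_Mapping.lookup q K = 0" for q :: "sub3 \<Rightarrow>\<^sub>0 nat"
        by (rule sum.mono_neutral_right) (use that in auto)
      ultimately have "Poly_Mapping.lookup m' J = Poly_Mapping.lookup m J"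
        using K True total by simp
      then have "m' = m" by (intro poly_mapping_eqI) (metis K True)
      moreover have "mon_eval m (axis J 1) = (\<Prod>I\<in>(UNIV :: sub3 set). 1 :: 'a)"
        unfolding mon_eval_def by (rule prod.cong) (use K in \<open>auto simp: axis_def\<close>)
      ultimately show ?thesis by simp
    next
      case False
      then obtain K' where K': "K' \<noteq> J" "Poly_Mapping.lookup m' K' \<noteq> 0" by blast
      then have "axis J (1::'a) $ K' ^ Poly_Mapping.lookup m' K' = 0" by (simp add: axis_def)
      then have "mon_eval m' (axis J 1) = (0::'a)"
        unfolding mon_eval_def by (intro prod_zero) auto
      moreover have "m' \<noteq> m" using K[OF K'(1)] K'(2) by auto
      ultimately show ?thesis by simp
    qed
    then have "F (axis J 1) = (\<Sum>m'\<in>Poly_Mapping.keys f. Poly_Mapping.lookup f m' * (if m' = m then 1 else 0))"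
      unfolding poly_eval_def by (intro sum.cong) auto
    also have "\<dots> = (\<Sum>m'\<in>Poly_Mapping.keys f. if m' = m then Poly_Mapping.lookup f m else 0)"
      by (rule sum.cong) auto
    also have "\<dots> = Poly_Mapping.lookup f m"
      using m by simp
    finally show ?thesis using F_axis[of J] m by (simp add: in_keys_iff)
  qed
qed

text \<open>Every monomial has weight 2 in the index i, hence picks up the factor s^2.\<close>

lemma F_diag6_0:
  "F (wedge3_map (diag6 (\<lambda>r. if r = i then s else 1)) x) = s\<^sup>2 * F x"
proof -
  let ?d = "\<lambda>r. if r = i then s else 1"
  have c: "wedge3_map (diag6 ?d) (axis I 1) = (if i \<in> set_of_sub3 I then s else 1) *s axis I 1" for I
    by (simp add: wedge3_map_diag6_axis)
  have "Poly_Mapping.lookup (pullback (wedge3_map (diag6 ?d)) f) m = s\<^sup>2 * Poly_Mapping.lookup f m" for m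
  proof (cases "m \<in> Poly_Mapping.keys f")
    case True
    have "(\<Prod>I\<in>UNIV. (if i \<in> set_of_sub3 I then s else 1) ^ Poly_Mapping.lookup m I) =
        (\<Prod>I | i \<in> set_of_sub3 I. s ^ Poly_Mapping.lookup m I)"
      by (rule prod.mono_neutral_cong_right) auto
    also have "\<dots> = s\<^sup>2" using weight[OF True, of i] by (metis power_sum)
    finally show ?thesis by (simp add: lookup_pullback_diagonal[OF c])
  qed (simp add: lookup_pullback_diagonal[OF c] in_keys_iff)
  then have "pullback (wedge3_map (diag6 ?d)) f = poly_const (s\<^sup>2) * f"
    by (intro poly_mapping_eqI)
       (simp add: poly_const_def mult_map_scale_conv_mult[symmetric] map.rep_eq when_def)
  then show ?thesis
    using poly_eval_pullback[OF linear_wedge3_map, of "diag6 ?d" f x] by (simp add: poly_eval_mult)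
qed

text \<open>Write g as a matrix of determinant 1 times a diagonal matrix whose only entry other than
  1 is det g.\<close>

lemma F_wedge3_map:
  assumes "det g \<noteq> 0"
  shows "F (wedge3_map g x) = (det g)\<^sup>2 * F x"
proof -
  define D where "D s = diag6 (\<lambda>r. if r = 0 then s else (1::'a))" for s
  have DD: "D s ** D t = D (s * t)" for s t
    unfolding D_def diag6_mult by (rule arg_cong[of _ _ diag6]) auto
  have D1: "D 1 = mat 1" by (auto simp: D_def diag6_def vec_eq_iff mat_def)
  have detD: "det (D s) = s" for s by (simp add: D_def det_diag6)
  define h where "h = g ** D (1 / det g)"
  have "det h = 1" using assms by (simp add: h_def det_mul detD)
  moreover have "g = h ** D (det g)"
    using assms by (simp add: h_def matrix_mul_assoc[symmetric] DD D1)
  ultimately have "F (wedge3_map g x) = F (wedge3_map (D (det g)) x)"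
    using F_invariant wedge3_map_mult by metis
  then show ?thesis by (simp add: D_def F_diag6_0)
qed

end

subsection \<open>Block coordinates\<close>

definition ext3_fst :: "'a ext3 \<Rightarrow> 'a" where "ext3_fst x = x $ T3 0 1 2"
definition ext3_snd :: "'a ext3 \<Rightarrow> 'a" where "ext3_snd x = x $ T3 3 4 5"

text \<open>
  \<open>A\<^sub>i\<^sub>j\<close> is the coordinate of \<open>e\<^sub>1 \<and> e\<^sub>2 \<and> e\<^sub>3\<close> with \<open>e\<^sub>i\<close> replaced by \<open>e\<close> of index \<open>3 + j\<close>, and
  \<open>B\<^sub>i\<^sub>j\<close> that of \<open>e\<^sub>4 \<and> e\<^sub>5 \<and> e\<^sub>6\<close> with \<open>e\<close> of index \<open>3 + j\<close> replaced by \<open>e\<^sub>i\<close>; this accounts for the signs.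
\<close>
definition ext3_A :: "('a::field) ext3 \<Rightarrow> 'a ^ 3 ^ 3" where
  "ext3_A x = vector [vector [x $ T3 1 2 3, x $ T3 1 2 4, x $ T3 1 2 5],
     vector [- x $ T3 0 2 3, - x $ T3 0 2 4, - x $ T3 0 2 5],
     vector [x $ T3 0 1 3, x $ T3 0 1 4, x $ T3 0 1 5]]"

definition ext3_B :: "('a::field) ext3 \<Rightarrow> 'a ^ 3 ^ 3" where
  "ext3_B x = vector [vector [x $ T3 0 4 5, - x $ T3 0 3 5, x $ T3 0 3 4],
     vector [x $ T3 1 4 5, - x $ T3 1 3 5, x $ T3 1 3 4],
     vector [x $ T3 2 4 5, - x $ T3 2 3 5, x $ T3 2 3 4]]"

definition pack :: "'a \<Rightarrow> 'a ^ 3 ^ 3 \<Rightarrow> 'a ^ 3 ^ 3 \<Rightarrow> 'a \<Rightarrow> ('a::field) ext3" where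
  "pack \<alpha> A B \<beta> = (\<chi> I.
     if I = T3 0 1 2 then \<alpha> else
     if I = T3 1 2 3 then A $ 1 $ 1 else if I = T3 1 2 4 then A $ 1 $ 2 else if I = T3 1 2 5 then A $ 1 $ 3 else
     if I = T3 0 2 3 then - A $ 2 $ 1 else if I = T3 0 2 4 then - A $ 2 $ 2 else if I = T3 0 2 5 then - A $ 2 $ 3 else
     if I = T3 0 1 3 then A $ 3 $ 1 else if I = T3 0 1 4 then A $ 3 $ 2 else if I = T3 0 1 5 then A $ 3 $ 3 else
     if I = T3 0 4 5 then B $ 1 $ 1 else if I = T3 0 3 5 then - B $ 1 $ 2 else if I = T3 0 3 4 then B $ 1 $ 3 else
     if I = T3 1 4 5 then B $ 2 $ 1 else if I = T3 1 3 5 then - B $ 2 $ 2 else if I = T3 1 3 4 then B $ 2 $ 3 else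
     if I = T3 2 4 5 then B $ 3 $ 1 else if I = T3 2 3 5 then - B $ 3 $ 2 else if I = T3 2 3 4 then B $ 3 $ 3 else
     \<beta>)"

lemma mat3_eq_iff: "(A = (B :: 'a ^ 3 ^ 3)) \<longleftrightarrow>
   A $ 1 $ 1 = B $ 1 $ 1 \<and> A $ 1 $ 2 = B $ 1 $ 2 \<and> A $ 1 $ 3 = B $ 1 $ 3 \<and>
   A $ 2 $ 1 = B $ 2 $ 1 \<and> A $ 2 $ 2 = B $ 2 $ 2 \<and> A $ 2 $ 3 = B $ 2 $ 3 \<and>
   A $ 3 $ 1 = B $ 3 $ 1 \<and> A $ 3 $ 2 = B $ 3 $ 2 \<and> A $ 3 $ 3 = B $ 3 $ 3"
  by (simp add: vec_eq_iff forall_3)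

text \<open>On a matrix \<open>*s\<close> takes a row as its scalar, so multiplication by an element
  of the field gets its own operation.\<close>

definition smat :: "'a \<Rightarrow> ('a::times) ^ 'n ^ 'm \<Rightarrow> 'a ^ 'n ^ 'm" where
  "smat c A = (\<chi> i j. c * A $ i $ j)"

lemma smat_nth [simp]: "smat c A $ i $ j = c * A $ i $ j"
  by (simp add: smat_def)

lemma pack_T3 [simp]:
  "pack \<alpha> A B \<beta> $ T3 0 1 2 = \<alpha>" "pack \<alpha> A B \<beta> $ T3 3 4 5 = \<beta>"
  "pack \<alpha> A B \<beta> $ T3 1 2 3 = A $ 1 $ 1" "pack \<alpha> A B \<beta> $ T3 1 2 4 = A $ 1 $ 2"
  "pack \<alpha> A B \<beta> $ T3 1 2 5 = A $ 1 $ 3" "pack \<alpha> A B \<beta> $ T3 0 2 3 = - A $ 2 $ 1"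
  "pack \<alpha> A B \<beta> $ T3 0 2 4 = - A $ 2 $ 2" "pack \<alpha> A B \<beta> $ T3 0 2 5 = - A $ 2 $ 3"
  "pack \<alpha> A B \<beta> $ T3 0 1 3 = A $ 3 $ 1" "pack \<alpha> A B \<beta> $ T3 0 1 4 = A $ 3 $ 2"
  "pack \<alpha> A B \<beta> $ T3 0 1 5 = A $ 3 $ 3"
  "pack \<alpha> A B \<beta> $ T3 0 4 5 = B $ 1 $ 1" "pack \<alpha> A B \<beta> $ T3 0 3 5 = - B $ 1 $ 2"
  "pack \<alpha> A B \<beta> $ T3 0 3 4 = B $ 1 $ 3" "pack \<alpha> A B \<beta> $ T3 1 4 5 = B $ 2 $ 1"
  "pack \<alpha> A B \<beta> $ T3 1 3 5 = - B $ 2 $ 2" "pack \<alpha> A B \<beta> $ T3 1 3 4 = B $ 2 $ 3"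
  "pack \<alpha> A B \<beta> $ T3 2 4 5 = B $ 3 $ 1" "pack \<alpha> A B \<beta> $ T3 2 3 5 = - B $ 3 $ 2"
  "pack \<alpha> A B \<beta> $ T3 2 3 4 = B $ 3 $ 3"
  by (simp_all add: pack_def)

lemma ext3_pack [simp]:
  "ext3_fst (pack \<alpha> A B \<beta>) = \<alpha>" "ext3_snd (pack \<alpha> A B \<beta>) = \<beta>"
  "ext3_A (pack \<alpha> A B \<beta>) = A" "ext3_B (pack \<alpha> A B \<beta>) = B"
  by (simp_all add: ext3_fst_def ext3_snd_def ext3_A_def ext3_B_def mat3_eq_iff vector_3)

lemma all_sub3:
  "(\<forall>I. P I) \<longleftrightarrow> P (T3 0 1 2) \<and> P (T3 3 4 5) \<and>
    P (T3 1 2 3) \<and> P (T3 1 2 4) \<and> P (T3 1 2 5) \<and>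
    P (T3 0 2 3) \<and> P (T3 0 2 4) \<and> P (T3 0 2 5) \<and>
    P (T3 0 1 3) \<and> P (T3 0 1 4) \<and> P (T3 0 1 5) \<and>
    P (T3 0 4 5) \<and> P (T3 0 3 5) \<and> P (T3 0 3 4) \<and>
    P (T3 1 4 5) \<and> P (T3 1 3 5) \<and> P (T3 1 3 4) \<and>
    P (T3 2 4 5) \<and> P (T3 2 3 5) \<and> P (T3 2 3 4)"
proof -
  have "(\<forall>I. P I) \<longleftrightarrow> (\<forall>I\<in>UNIV. P I)" by simp
  then show ?thesis unfolding UNIV_sub3 by auto
qed

lemma ext3_eqI:
  fixes x y :: "('a::field) ext3"
  assumes "ext3_fst x = ext3_fst y" "ext3_A x = ext3_A y" "ext3_B x = ext3_B y" "ext3_snd x = ext3_snd y"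
  shows "x = y"
proof -
  have "\<forall>I. x $ I = y $ I"
    unfolding all_sub3
    using assms by (simp add: ext3_fst_def ext3_snd_def ext3_A_def ext3_B_def mat3_eq_iff vector_3)
  then show ?thesis by (simp add: vec_eq_iff)
qed

lemma pack_ext3 [simp]: "pack (ext3_fst x) (ext3_A x) (ext3_B x) (ext3_snd x) = x"
  by (rule ext3_eqI) simp_all

lemma ext3_lin [simp]:
  "ext3_fst (x + y) = ext3_fst x + ext3_fst y" "ext3_snd (x + y) = ext3_snd x + ext3_snd y"
  "ext3_A (x + y) = ext3_A x + ext3_A y" "ext3_B (x + y) = ext3_B x + ext3_B y"
  "ext3_fst (c *s x) = c * ext3_fst x" "ext3_snd (c *s x) = c * ext3_snd x"
  "ext3_A (c *s x) = smat c (ext3_A x)" "ext3_B (c *s x) = smat c (ext3_B x)"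
  "ext3_fst 0 = 0" "ext3_snd 0 = 0" "ext3_A 0 = 0" "ext3_B 0 = 0"
  by (simp_all add: ext3_fst_def ext3_snd_def ext3_A_def ext3_B_def mat3_eq_iff vector_3)

lemma pack_add: "pack \<alpha> A B \<beta> + pack \<alpha>' A' B' \<beta>' = pack (\<alpha> + \<alpha>') (A + A') (B + B') (\<beta> + \<beta>')"
  by (rule ext3_eqI) simp_all

lemma pack_scale: "c *s pack \<alpha> A B \<beta> = pack (c * \<alpha>) (smat c A) (smat c B) (c * \<beta>)"
  by (rule ext3_eqI) simp_all

text \<open>The matrix of cofactors, the transpose of the adjugate; the cyclic order of the indices
  absorbs the signs.\<close>

definition cof :: "('a::field) ^ 3 ^ 3 \<Rightarrow> 'a ^ 3 ^ 3" where
  "cof A = vector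
    [vector [A$2$2 * A$3$3 - A$2$3 * A$3$2, A$2$3 * A$3$1 - A$2$1 * A$3$3, A$2$1 * A$3$2 - A$2$2 * A$3$1],
     vector [A$3$2 * A$1$3 - A$3$3 * A$1$2, A$3$3 * A$1$1 - A$3$1 * A$1$3, A$3$1 * A$1$2 - A$3$2 * A$1$1],
     vector [A$1$2 * A$2$3 - A$1$3 * A$2$2, A$1$3 * A$2$1 - A$1$1 * A$2$3, A$1$1 * A$2$2 - A$1$2 * A$2$1]]"

lemma cof_nth [simp]:
  "cof A $ 1 $ 1 = A$2$2 * A$3$3 - A$2$3 * A$3$2" "cof A $ 1 $ 2 = A$2$3 * A$3$1 - A$2$1 * A$3$3"
  "cof A $ 1 $ 3 = A$2$1 * A$3$2 - A$2$2 * A$3$1" "cof A $ 2 $ 1 = A$3$2 * A$1$3 - A$3$3 * A$1$2"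
  "cof A $ 2 $ 2 = A$3$3 * A$1$1 - A$3$1 * A$1$3" "cof A $ 2 $ 3 = A$3$1 * A$1$2 - A$3$2 * A$1$1"
  "cof A $ 3 $ 1 = A$1$2 * A$2$3 - A$1$3 * A$2$2" "cof A $ 3 $ 2 = A$1$3 * A$2$1 - A$1$1 * A$2$3"
  "cof A $ 3 $ 3 = A$1$1 * A$2$2 - A$1$2 * A$2$1"
  by (simp_all add: cof_def vector_3)

text \<open>The trace form tr(A^T B), through which the two matrix blocks are dual to each
  other.\<close>

definition mdot :: "('a::field) ^ 3 ^ 3 \<Rightarrow> 'a ^ 3 ^ 3 \<Rightarrow> 'a" where
  "mdot A B = (\<Sum>i\<in>UNIV. \<Sum>j\<in>UNIV. A $ i $ j * B $ i $ j)"

lemma mdot_expand: "mdot A B =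
    A $ 1 $ 1 * B $ 1 $ 1 + A $ 1 $ 2 * B $ 1 $ 2 + A $ 1 $ 3 * B $ 1 $ 3 +
   (A $ 2 $ 1 * B $ 2 $ 1 + A $ 2 $ 2 * B $ 2 $ 2 + A $ 2 $ 3 * B $ 2 $ 3) +
   (A $ 3 $ 1 * B $ 3 $ 1 + A $ 3 $ 2 * B $ 3 $ 2 + A $ 3 $ 3 * B $ 3 $ 3)"
  by (simp add: mdot_def sum_3)

text \<open>This is the third compound matrix: x_I is multiplied by the minor of g with rows J and
  columns I.\<close>

lemma wedge3_map_component:
  "wedge3_map g x $ J = (\<Sum>I\<in>UNIV. x $ I * (let i = elems I ! 0; j = elems I ! 1; k = elems I ! 2;
     a = elems J ! 0; b = elems J ! 1; c = elems J ! 2 in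
     g $ a $ i * g $ b $ j * g $ c $ k + g $ b $ i * g $ c $ j * g $ a $ k + g $ c $ i * g $ a $ j * g $ b $ k
     - g $ a $ i * g $ c $ j * g $ b $ k - g $ b $ i * g $ a $ j * g $ c $ k - g $ c $ i * g $ b $ j * g $ a $ k))"
  by (simp add: wedge3_map_def ext3_lift_def wedge3_component Let_def)

definition half :: "6 \<Rightarrow> 3" where
  "half a = (if a = 0 \<or> a = 3 then 1 else if a = 1 \<or> a = 4 then 2 else 3)"

definition block :: "'a ^ 3 ^ 3 \<Rightarrow> 'a ^ 3 ^ 3 \<Rightarrow> 'a ^ 3 ^ 3 \<Rightarrow> 'a ^ 3 ^ 3 \<Rightarrow> 'a ^ 6 ^ 6" where
  "block P S U R = (\<chi> a b. (if a < 3 then if b < 3 then P else S else if b < 3 then U else R) $ half a $ half b)"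

lemma half_simps [simp]: "half 0 = 1" "half 1 = 2" "half 2 = 3" "half 3 = 1" "half 4 = 2" "half 5 = 3"
  by (simp_all add: half_def)

lemma not_less6 [simp]: "\<not> (3::6) < 3" "\<not> (4::6) < 3" "\<not> (5::6) < 3"
  using less6 by (simp_all add: not_less less_imp_le)

text \<open>The matrix adds to the i-th of the first three basis vectors the combination of the last
  three given by row i of U. The difference \<open>cof (A + U) - cof A - cof U\<close> is the
  polarization of the quadratic map \<open>cof\<close>.\<close>

lemma wedge3_map_upper:
  "wedge3_map (block (mat 1) 0 (transpose U) (mat 1)) (pack \<alpha> A B \<beta>) =
    pack \<alpha> (A + smat \<alpha> U) (B + (cof (A + U) - cof A - cof U) + smat \<alpha> (cof U))
      (\<beta> + mdot B U + mdot A (cof U) + \<alpha> * det U)"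
  by (rule ext3_eqI;
      simp add: ext3_fst_def ext3_snd_def ext3_A_def ext3_B_def mat3_eq_iff vector_3
         wedge3_map_component sum_sub3 Let_def block_def mat_def transpose_def mdot_expand det_3;
      simp add: algebra_simps)

text \<open>Coordinates in A use two vectors of the first half and one of the second, those in B the
  reverse; so P acts on A, and R on B, through 2 by 2 minors.\<close>

lemma wedge3_map_diag:
  "wedge3_map (block P 0 0 R) (pack \<alpha> A B \<beta>) =
    pack (det P * \<alpha>) (cof P ** A ** transpose R) (P ** B ** transpose (cof R)) (det R * \<beta>)"
  by (rule ext3_eqI;
      simp add: ext3_fst_def ext3_snd_def ext3_A_def ext3_B_def mat3_eq_iff vector_3
         wedge3_map_component sum_sub3 Let_def block_def transpose_def matrix_matrix_mult_def sum_3 det_3;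
      simp add: algebra_simps)

lemma wedge3_map_swap:
  "wedge3_map (block 0 (mat 1) (- mat 1) 0) (pack \<alpha> A B \<beta>) =
    pack \<beta> (- transpose B) (transpose A) (- \<alpha>)"
  by (rule ext3_eqI;
      simp add: ext3_fst_def ext3_snd_def ext3_A_def ext3_B_def mat3_eq_iff vector_3
         wedge3_map_component sum_sub3 Let_def block_def mat_def transpose_def)

section \<open>The Hodge star in block coordinates\<close>

lemma all_6: "(\<forall>r::6. P r) \<longleftrightarrow> P 0 \<and> P 1 \<and> P 2 \<and> P 3 \<and> P 4 \<and> P 5"
  using exhaust_6 by metis

lemma set_of_T3 [simp]: "i < j \<Longrightarrow> j < k \<Longrightarrow> set_of_sub3 (T3 i j k) = {i, j, k}"
  using set_of_sub3_elems[of "T3 i j k"] by simp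

lemma compl3_T3:
  assumes "i < j" "j < k" "a < b" "b < c" "\<forall>r. r \<in> {a, b, c} \<longleftrightarrow> r \<notin> {i, j, k}"
  shows "compl3 (T3 i j k) = T3 a b c"
  using assms by (subst set_of_sub3_inject[symmetric]) (auto simp: set_of_compl3)

lemma compl3_T3_simps [simp]:
  "compl3 (T3 0 1 2) = T3 3 4 5" "compl3 (T3 3 4 5) = T3 0 1 2"
  "compl3 (T3 1 2 3) = T3 0 4 5" "compl3 (T3 1 2 4) = T3 0 3 5" "compl3 (T3 1 2 5) = T3 0 3 4"
  "compl3 (T3 0 2 3) = T3 1 4 5" "compl3 (T3 0 2 4) = T3 1 3 5" "compl3 (T3 0 2 5) = T3 1 3 4"
  "compl3 (T3 0 1 3) = T3 2 4 5" "compl3 (T3 0 1 4) = T3 2 3 5" "compl3 (T3 0 1 5) = T3 2 3 4"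
  "compl3 (T3 0 4 5) = T3 1 2 3" "compl3 (T3 0 3 5) = T3 1 2 4" "compl3 (T3 0 3 4) = T3 1 2 5"
  "compl3 (T3 1 4 5) = T3 0 2 3" "compl3 (T3 1 3 5) = T3 0 2 4" "compl3 (T3 1 3 4) = T3 0 2 5"
  "compl3 (T3 2 4 5) = T3 0 1 3" "compl3 (T3 2 3 5) = T3 0 1 4" "compl3 (T3 2 3 4) = T3 0 1 5"
  by (rule compl3_T3; simp add: all_6)+

lemma card_lessThan_6:
  "card {..<0::6} = 0" "card {..<1::6} = 1" "card {..<2::6} = 2"
  "card {..<3::6} = 3" "card {..<4::6} = 4" "card {..<5::6} = 5"
proof -
  have "{..<0::6} = {}" "{..<1::6} = {0}" "{..<2::6} = {0, 1}" "{..<3::6} = {0, 1, 2}"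
    "{..<4::6} = {0, 1, 2, 3}" "{..<5::6} = {0, 1, 2, 3, 4}"
    unfolding set_eq_iff all_6
    by (simp_all add: less_bit0_def bit0.Rep_0 bit0.Rep_1 bit0.Rep_numeral)
  then show "card {..<0::6} = 0" "card {..<1::6} = 1" "card {..<2::6} = 2"
    "card {..<3::6} = 3" "card {..<4::6} = 4" "card {..<5::6} = 5" by simp_all
qed

lemma wedge6_swap:
  fixes u0 :: "('a::field) ^ 6"
  shows "wedge6 [u1, u0, u2, u3, u4, u5] = - wedge6 [u0, u1, u2, u3, u4, u5]"
    and "wedge6 [u0, u2, u1, u3, u4, u5] = - wedge6 [u0, u1, u2, u3, u4, u5]"
    and "wedge6 [u0, u1, u3, u2, u4, u5] = - wedge6 [u0, u1, u2, u3, u4, u5]"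
    and "wedge6 [u0, u1, u2, u4, u3, u5] = - wedge6 [u0, u1, u2, u3, u4, u5]"
    and "wedge6 [u0, u1, u2, u3, u5, u4] = - wedge6 [u0, u1, u2, u3, u4, u5]"
proof -
  have swap: "wedge6 vs = - wedge6 us"
    if "i \<noteq> j" "\<forall>r. vs ! card {..<r} = us ! card {..<Transposition.transpose i j r}"
    for us vs :: "('a ^ 6) list" and i j :: 6
  proof -
    have "wedge6 vs = det (\<chi> r. (\<chi> r. us ! card {..<r}) $ Transposition.transpose i j r)"
      by (simp add: wedge6_def that(2))
    also have "\<dots> = of_int (sign (Transposition.transpose i j)) * wedge6 us"
      unfolding wedge6_def by (rule det_permute_rows) (simp add: permutes_swap_id)
    finally show ?thesis using that(1) by (simp add: sign_swap_id)
  qed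
  show "wedge6 [u1, u0, u2, u3, u4, u5] = - wedge6 [u0, u1, u2, u3, u4, u5]"
    by (rule swap[of 0 1]) (simp_all add: all_6 card_lessThan_6 Transposition.transpose_def)
  show "wedge6 [u0, u2, u1, u3, u4, u5] = - wedge6 [u0, u1, u2, u3, u4, u5]"
    by (rule swap[of 1 2]) (simp_all add: all_6 card_lessThan_6 Transposition.transpose_def)
  show "wedge6 [u0, u1, u3, u2, u4, u5] = - wedge6 [u0, u1, u2, u3, u4, u5]"
    by (rule swap[of 2 3]) (simp_all add: all_6 card_lessThan_6 Transposition.transpose_def)
  show "wedge6 [u0, u1, u2, u4, u3, u5] = - wedge6 [u0, u1, u2, u3, u4, u5]"
    by (rule swap[of 3 4]) (simp_all add: all_6 card_lessThan_6 Transposition.transpose_def)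
  show "wedge6 [u0, u1, u2, u3, u5, u4] = - wedge6 [u0, u1, u2, u3, u4, u5]"
    by (rule swap[of 4 5]) (simp_all add: all_6 card_lessThan_6 Transposition.transpose_def)
qed

text \<open>The condition \<open>b < a\<close> orients the equations, so that rewriting sorts the
  factors by adjacent transpositions and terminates.\<close>

lemma wedge6_sort:
  fixes a b :: 6
  assumes "b < a"
  shows "wedge6 [axis a 1, axis b 1, u2, u3, u4, u5] = - wedge6 [axis b 1, axis a (1::'a::field), u2, u3, u4, u5]"
    and "wedge6 [u0, axis a 1, axis b 1, u3, u4, u5] = - wedge6 [u0, axis b 1, axis a (1::'a), u3, u4, u5]"
    and "wedge6 [u0, u1, axis a 1, axis b 1, u4, u5] = - wedge6 [u0, u1, axis b 1, axis a (1::'a), u4, u5]"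
    and "wedge6 [u0, u1, u2, axis a 1, axis b 1, u5] = - wedge6 [u0, u1, u2, axis b 1, axis a (1::'a), u5]"
    and "wedge6 [u0, u1, u2, u3, axis a 1, axis b 1] = - wedge6 [u0, u1, u2, u3, axis b 1, axis a (1::'a)]"
  by (rule wedge6_swap)+

lemma wedge6_axis:
  "wedge6 [axis 0 1, axis 1 1, axis 2 1, axis 3 1, axis 4 1, axis 5 1] = (1 :: 'a::field)"
proof -
  have "(\<chi> r. [axis 0 1, axis 1 1, axis 2 1, axis 3 1, axis 4 1, axis 5 1] ! card {..<r}) = (mat 1 :: 'a ^ 6 ^ 6)"
    unfolding vec_eq_iff[of _ "mat 1"] all_6
    by (simp add: card_lessThan_6 vec_eq_iff mat_def axis_def)
  then show ?thesis by (simp add: wedge6_def)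
qed

lemma hodge_sign_T3:
  "hodge_sign (T3 0 1 2) = (1 :: 'a::field)" "hodge_sign (T3 3 4 5) = (-1 :: 'a)"
  "hodge_sign (T3 1 2 3) = (-1 :: 'a)" "hodge_sign (T3 1 2 4) = (1 :: 'a)" "hodge_sign (T3 1 2 5) = (-1 :: 'a)"
  "hodge_sign (T3 0 2 3) = (1 :: 'a)" "hodge_sign (T3 0 2 4) = (-1 :: 'a)" "hodge_sign (T3 0 2 5) = (1 :: 'a)"
  "hodge_sign (T3 0 1 3) = (-1 :: 'a)" "hodge_sign (T3 0 1 4) = (1 :: 'a)" "hodge_sign (T3 0 1 5) = (-1 :: 'a)"
  "hodge_sign (T3 0 4 5) = (1 :: 'a)" "hodge_sign (T3 0 3 5) = (-1 :: 'a)" "hodge_sign (T3 0 3 4) = (1 :: 'a)"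
  "hodge_sign (T3 1 4 5) = (-1 :: 'a)" "hodge_sign (T3 1 3 5) = (1 :: 'a)" "hodge_sign (T3 1 3 4) = (-1 :: 'a)"
  "hodge_sign (T3 2 4 5) = (1 :: 'a)" "hodge_sign (T3 2 3 5) = (-1 :: 'a)" "hodge_sign (T3 2 3 4) = (1 :: 'a)"
  by (simp_all add: hodge_sign_def wedge6_sort wedge6_axis)

lemma hodge_star_pack: "hodge_star (pack \<alpha> A B \<beta>) = pack (- \<beta>) B (- A) \<alpha>"
  by (rule ext3_eqI;
      simp add: ext3_fst_def ext3_snd_def ext3_A_def ext3_B_def mat3_eq_iff vector_3
         hodge_star_def sum_sub3 hodge_sign_T3 axis_def)

subsection \<open>The invariant quartic in block coordinates\<close>

lemma sum_6: "sum h (UNIV :: 6 set) = h 0 + h 1 + h 2 + h 3 + h 4 + h 5"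
proof -
  have U: "(UNIV :: 6 set) = set [0, 1, 2, 3, 4, 5]" by (simp add: UNIV_6)
  have "sum h (UNIV :: 6 set) = sum_list (map h [0, 1, 2, 3, 4, 5])"
    unfolding U by (rule sum.distinct_set_conv_list) simp
  then show ?thesis by (simp add: add.assoc)
qed

lemma block_mult:
  "block P S U R ** block P' S' U' R' =
    block (P ** P' + S ** U') (P ** S' + S ** R') (U ** P' + R ** U') (U ** S' + R ** R' :: 'a::comm_semiring_1 ^ 3 ^ 3)"
  unfolding vec_eq_iff all_6
  by (simp add: block_def matrix_matrix_mult_def sum_6 sum_3 algebra_simps)

lemma block_1: "block (mat 1) 0 0 (mat 1) = (mat 1 :: 'a::zero_neq_one ^ 6 ^ 6)"
  unfolding vec_eq_iff all_6 by (simp add: block_def mat_def)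

lemma det_lower_block: "det (block (mat 1) 0 U (mat 1)) = (1 :: 'a::comm_ring_1)"
proof -
  have "\<forall>i j. i < j \<longrightarrow> block (mat 1) 0 U (mat 1) $ i $ j = (0 :: 'a)"
    unfolding all_6
    by (simp add: block_def mat_def) (simp add: less_bit0_def bit0.Rep_0 bit0.Rep_1 bit0.Rep_numeral)
  then have "det (block (mat 1) 0 U (mat 1)) = (\<Prod>i\<in>UNIV. block (mat 1) 0 U (mat 1) $ i $ i :: 'a)"
    by (intro det_lowerdiagonal) blast
  also have "\<dots> = 1"
  proof (rule prod.neutral, rule ballI)
    fix i :: 6
    show "block (mat 1) 0 U (mat 1) $ i $ i = (1 :: 'a)"
      by (simp add: block_def mat_def)
  qed
  finally show ?thesis .
qed

lemma smat_0 [simp]: "smat c (0 :: 'a::mult_zero ^ 'n ^ 'm) = 0" "smat 0 A = (0 :: 'a::mult_zero ^ 'n ^ 'm)"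
  by (simp_all add: vec_eq_iff)

lemma smat_1 [simp]: "smat 1 A = (A :: 'a::monoid_mult ^ 'n ^ 'm)"
  by (simp add: vec_eq_iff)

text \<open>The Freudenthal quartic belonging to the cubic form \<open>det\<close> on 3 by 3
  matrices.\<close>

definition quartic :: "('a::field) ext3 \<Rightarrow> 'a" where
  "quartic x = (ext3_fst x * ext3_snd x - mdot (ext3_A x) (ext3_B x))\<^sup>2
     + 4 * ext3_snd x * det (ext3_A x) + 4 * ext3_fst x * det (ext3_B x)
     - 4 * mdot (cof (ext3_A x)) (cof (ext3_B x))"

lemma mat3_simps:
  fixes A B :: "('a::field) ^ 3 ^ 3"
  shows "cof (smat c A) = smat (c\<^sup>2) (cof A)" "det (smat c A) = c ^ 3 * det A"
    "cof (cof A) = smat (det A) A" "det (cof A) = (det A)\<^sup>2"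
    "mdot (smat c A) B = c * mdot A B" "mdot A (smat c B) = c * mdot A B"
    "A - smat c B = A + smat (- c) B"
  by (simp_all add: mat3_eq_iff det_3 mdot_expand) (simp_all add: algebra_simps power2_eq_square power3_eq_cube)

lemma mdot_commute: "mdot A B = mdot B A"
  by (simp add: mdot_expand mult.commute)

lemma det_add_mat3:
  fixes A B :: "('a::field) ^ 3 ^ 3"
  shows "det (A + B) = det A + mdot (cof A) B + mdot A (cof B) + det B"
  by (simp add: det_3 mdot_expand) (simp add: algebra_simps)

text \<open>The right-hand side is the value of \<open>quartic\<close> at the vector computed in
  \<open>wedge3_map_upper'\<close>, so this is invariance under the matrix that clears the
  A-block.\<close>

lemma quartic_upper:
  "quartic (pack \<alpha> (smat \<alpha> U) B \<beta>) =
    \<alpha>\<^sup>2 * (\<beta> - mdot B U + 2 * \<alpha> * det U)\<^sup>2 + 4 * \<alpha> * det (B - smat \<alpha> (cof U))"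
  unfolding quartic_def ext3_pack mat3_simps det_add_mat3 mdot_commute[of U B] mdot_commute[of "cof U"]
  by (simp add: algebra_simps power2_eq_square power3_eq_cube)

text \<open>The polarization of \<open>cof\<close> at (U, U) is 2 cof U, and <U, cof U> = 3 det U;
  this explains the coefficients -2 + 1 = -1 and 3 - 1 = 2.\<close>

lemma wedge3_map_upper':
  "wedge3_map (block (mat 1) 0 (- transpose U) (mat 1)) (pack \<alpha> (smat \<alpha> U) B \<beta>) =
    pack \<alpha> 0 (B - smat \<alpha> (cof U)) (\<beta> - mdot B U + 2 * \<alpha> * det U)"
proof -
  have "- transpose U = transpose (- U)" by (simp add: transpose_def vec_eq_iff)
  then show ?thesis
    by (simp only: wedge3_map_upper)
       (rule ext3_eqI; simp add: mat3_eq_iff mdot_expand det_3; simp add: algebra_simps)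
qed

definition swap_rows12 :: "'a::field ^ 3 ^ 3" where
  "swap_rows12 = vector [vector [0, 1, 0], vector [1, 0, 0], vector [0, 0, 1]]"

definition swap_rows23 :: "'a::field ^ 3 ^ 3" where
  "swap_rows23 = vector [vector [1, 0, 0], vector [0, 0, 1], vector [0, 1, 0]]"

text \<open>The matrix of the transposition of \<open>e\<^sub>1\<close> and \<open>e\<^sub>4\<close>.\<close>
definition swap_14 :: "'a::field ^ 6 ^ 6" where
  "swap_14 = (let D = vector [vector [0, 0, 0], vector [0, 1, 0], vector [0, 0, 1]];
     E = vector [vector [1, 0, 0], 0, 0] in block D E E D)"

lemma det_involution:
  fixes g :: "'a::comm_ring_1 ^ 'n ^ 'n"
  shows "g ** g = mat 1 \<Longrightarrow> (det g)\<^sup>2 = 1"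
  by (metis det_I det_mul power2_eq_square)

lemma swap_involutions:
  "block swap_rows12 0 0 (mat 1) ** block swap_rows12 0 0 (mat 1) = (mat 1 :: 'a::field ^ 6 ^ 6)"
  "block swap_rows23 0 0 (mat 1) ** block swap_rows23 0 0 (mat 1) = (mat 1 :: 'a::field ^ 6 ^ 6)"
  "swap_14 ** swap_14 = (mat 1 :: 'a::field ^ 6 ^ 6)"
  unfolding swap_14_def Let_def block_mult block_1[symmetric]
  by (intro arg_cong4[of _ _ _ _ _ _ _ _ block];
      simp add: mat3_eq_iff matrix_matrix_mult_def sum_3 mat_def swap_rows12_def swap_rows23_def vector_3)+

text \<open>A vector and its image, both with first coordinate 1, whose equal values under F relate
  the two constants of the slice.\<close>

lemma wedge3_map_swap_14:
  "wedge3_map swap_14 (pack 1 (mat 1) 0 0) =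
    pack 1 (vector [vector [1, 0, 0], 0, 0]) (vector [vector [0, 0, 0], vector [0, 1, 0], vector [0, 0, 1]]) (0::'a::field)"
  by (rule ext3_eqI;
      simp add: swap_14_def ext3_fst_def ext3_snd_def ext3_A_def ext3_B_def mat3_eq_iff vector_3
         wedge3_map_component sum_sub3 Let_def block_def mat_def)

text \<open>The exponents \<open>a\<close>, \<open>k\<^sub>i\<^sub>j\<close>, \<open>b\<close> of a monomial in the coordinates \<open>\<alpha>\<close>,
  \<open>B\<^sub>i\<^sub>j\<close>, \<open>\<beta>\<close>, all of whose weights are 2.\<close>
lemma slice_exponents:
  fixes a b k11 :: nat
  assumes "a + k11 + k12 + k13 = 2" "a + k21 + k22 + k23 = 2" "a + k31 + k32 + k33 = 2"
    and "b + k12 + k13 + k22 + k23 + k32 + k33 = 2" "b + k11 + k13 + k21 + k23 + k31 + k33 = 2"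
    and "b + k11 + k12 + k21 + k22 + k31 + k32 = 2"
  shows "a = 2 \<and> b = 2 \<and> k11 = 0 \<and> k12 = 0 \<and> k13 = 0 \<and> k21 = 0 \<and> k22 = 0 \<and> k23 = 0 \<and> k31 = 0 \<and> k32 = 0 \<and> k33 = 0 \<or>
    a = 1 \<and> b = 0 \<and> (
     k11 = 1 \<and> k22 = 1 \<and> k33 = 1 \<and> k12 = 0 \<and> k13 = 0 \<and> k21 = 0 \<and> k23 = 0 \<and> k31 = 0 \<and> k32 = 0 \<or>
     k12 = 1 \<and> k23 = 1 \<and> k31 = 1 \<and> k11 = 0 \<and> k13 = 0 \<and> k21 = 0 \<and> k22 = 0 \<and> k32 = 0 \<and> k33 = 0 \<or>
     k13 = 1 \<and> k21 = 1 \<and> k32 = 1 \<and> k11 = 0 \<and> k12 = 0 \<and> k22 = 0 \<and> k23 = 0 \<and> k31 = 0 \<and> k33 = 0 \<or>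
     k12 = 1 \<and> k21 = 1 \<and> k33 = 1 \<and> k11 = 0 \<and> k13 = 0 \<and> k22 = 0 \<and> k23 = 0 \<and> k31 = 0 \<and> k32 = 0 \<or>
     k11 = 1 \<and> k23 = 1 \<and> k32 = 1 \<and> k12 = 0 \<and> k13 = 0 \<and> k21 = 0 \<and> k22 = 0 \<and> k31 = 0 \<and> k33 = 0 \<or>
     k13 = 1 \<and> k22 = 1 \<and> k31 = 1 \<and> k11 = 0 \<and> k12 = 0 \<and> k21 = 0 \<and> k23 = 0 \<and> k32 = 0 \<and> k33 = 0)"
proof -
  have "a = 2 \<or> a = 1" using assms by linarith
  then show ?thesis
  proof
    assume "a = 2"
    then show ?thesis using assms by auto
  next
    assume a: "a = 1"
    have 1: "k11 = 1 \<and> k12 = 0 \<and> k13 = 0 \<or> k11 = 0 \<and> k12 = 1 \<and> k13 = 0 \<or> k11 = 0 \<and> k12 = 0 \<and> k13 = 1"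
      using assms(1) a by arith
    have 2: "k21 = 1 \<and> k22 = 0 \<and> k23 = 0 \<or> k21 = 0 \<and> k22 = 1 \<and> k23 = 0 \<or> k21 = 0 \<and> k22 = 0 \<and> k23 = 1"
      using assms(2) a by arith
    have 3: "k31 = 1 \<and> k32 = 0 \<and> k33 = 0 \<or> k31 = 0 \<and> k32 = 1 \<and> k33 = 0 \<or> k31 = 0 \<and> k32 = 0 \<and> k33 = 1"
      using assms(3) a by arith
    show ?thesis
      using 1 2 3 assms(4-6) a by (elim disjE conjE) simp_all
  qed
qed

context invariant_quartic
begin

text \<open>On A = 0 the condition that all six weights are 2 leaves
  \<open>\<alpha>\<^sup>2 * \<beta>\<^sup>2\<close> and \<alpha> times the six products occurring in
  a determinant.\<close>

lemma slice_expansion: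
  obtains c d1 d2 d3 d4 d5 d6 where "\<forall>\<alpha> B \<beta>. F (pack \<alpha> 0 B \<beta>) = c * \<alpha>\<^sup>2 * \<beta>\<^sup>2 + \<alpha> * (
    d1 * (B$1$1 * B$2$2 * B$3$3) + d2 * (B$1$2 * B$2$3 * B$3$1) + d3 * (B$1$3 * B$2$1 * B$3$2) +
    d4 * (B$1$2 * B$2$1 * B$3$3) + d5 * (B$1$1 * B$2$3 * B$3$2) + d6 * (B$1$3 * B$2$2 * B$3$1))"
proof -
  define S where "S P = (\<Sum>m | m \<in> Poly_Mapping.keys f \<and> P (Poly_Mapping.lookup m). Poly_Mapping.lookup f m)" for P
  \<comment> \<open>Each of these predicates prescribes exponents of sum 4, hence determines a
    monomial of degree 4.\<close>
  define P0 where "P0 l \<longleftrightarrow> l (T3 0 1 2) = 2 \<and> l (T3 3 4 5) = 2" for l :: "sub3 \<Rightarrow> nat"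
  define PP where "PP i j k l \<longleftrightarrow> l (T3 0 1 2) = 1 \<and> l i = 1 \<and> l j = 1 \<and> l k = 1" for l :: "sub3 \<Rightarrow> nat" and i j k
  define P1 where "P1 = PP (T3 0 4 5) (T3 1 3 5) (T3 2 3 4)"
  define P2 where "P2 = PP (T3 0 3 5) (T3 1 3 4) (T3 2 4 5)"
  define P3 where "P3 = PP (T3 0 3 4) (T3 1 4 5) (T3 2 3 5)"
  define P4 where "P4 = PP (T3 0 3 5) (T3 1 4 5) (T3 2 3 4)"
  define P5 where "P5 = PP (T3 0 4 5) (T3 1 3 4) (T3 2 3 5)"
  define P6 where "P6 = PP (T3 0 3 4) (T3 1 3 5) (T3 2 4 5)"
  note P_defs = P0_def PP_def P1_def P2_def P3_def P4_def P5_def P6_def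
  define R where "R P (c::'a) m = (if P (Poly_Mapping.lookup m) then c else 0)" for P c and m :: "sub3 \<Rightarrow>\<^sub>0 nat"
  \<comment> \<open>Every one of the six products has exactly one factor in the second column of B,
    whose coordinates carry a minus sign.\<close>
  have key: "mon_eval m (pack \<alpha> 0 B \<beta>) = R P0 (\<alpha>\<^sup>2 * \<beta>\<^sup>2) m
      + R P1 (- \<alpha> * (B$1$1 * B$2$2 * B$3$3)) m + R P2 (- \<alpha> * (B$1$2 * B$2$3 * B$3$1)) m
      + R P3 (- \<alpha> * (B$1$3 * B$2$1 * B$3$2)) m + R P4 (- \<alpha> * (B$1$2 * B$2$1 * B$3$3)) m
      + R P5 (- \<alpha> * (B$1$1 * B$2$3 * B$3$2)) m + R P6 (- \<alpha> * (B$1$3 * B$2$2 * B$3$1)) m"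
    if m: "m \<in> Poly_Mapping.keys f" for m \<alpha> B \<beta>
  proof -
    define l where "l = Poly_Mapping.lookup m"
    define p where "p = l (T3 1 2 3) + l (T3 1 2 4) + l (T3 1 2 5) + l (T3 0 2 3) + l (T3 0 2 4) + l (T3 0 2 5)
      + l (T3 0 1 3) + l (T3 0 1 4) + l (T3 0 1 5)"
    have w: "(\<Sum>I\<in>UNIV. if i \<in> set_of_sub3 I then l I else 0) = 2" for i
      using weight[OF m, of i] by (simp add: l_def sum.If_cases)
    note w' = w[of 0] w[of 1] w[of 2] w[of 3] w[of 4] w[of 5]
    have total: "(\<Sum>I\<in>UNIV. l I) = 4" using hom m by (simp add: l_def homogeneous_def)
    have ev: "mon_eval m x = (\<Prod>I\<in>UNIV. x $ I ^ l I)" for x :: "'a ext3"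
      by (simp add: mon_eval_def l_def)
    show ?thesis
    proof (cases "p = 0")
      case True
      then have z: "l (T3 1 2 3) = 0" "l (T3 1 2 4) = 0" "l (T3 1 2 5) = 0" "l (T3 0 2 3) = 0"
        "l (T3 0 2 4) = 0" "l (T3 0 2 5) = 0" "l (T3 0 1 3) = 0" "l (T3 0 1 4) = 0" "l (T3 0 1 5) = 0"
        by (simp_all add: p_def)
      have "(l (T3 0 1 2) = 2 \<and> l (T3 3 4 5) = 2 \<and> l (T3 0 4 5) = 0 \<and> l (T3 0 3 5) = 0 \<and> l (T3 0 3 4) = 0 \<and>
         l (T3 1 4 5) = 0 \<and> l (T3 1 3 5) = 0 \<and> l (T3 1 3 4) = 0 \<and> l (T3 2 4 5) = 0 \<and> l (T3 2 3 5) = 0 \<and> l (T3 2 3 4) = 0) \<or>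
         (l (T3 0 1 2) = 1 \<and> l (T3 3 4 5) = 0 \<and> (
         l (T3 0 4 5) = 1 \<and> l (T3 1 3 5) = 1 \<and> l (T3 2 3 4) = 1 \<and> l (T3 0 3 5) = 0 \<and> l (T3 0 3 4) = 0 \<and> l (T3 1 4 5) = 0 \<and> l (T3 1 3 4) = 0 \<and> l (T3 2 4 5) = 0 \<and> l (T3 2 3 5) = 0 \<or>
         l (T3 0 3 5) = 1 \<and> l (T3 1 3 4) = 1 \<and> l (T3 2 4 5) = 1 \<and> l (T3 0 4 5) = 0 \<and> l (T3 0 3 4) = 0 \<and> l (T3 1 4 5) = 0 \<and> l (T3 1 3 5) = 0 \<and> l (T3 2 3 5) = 0 \<and> l (T3 2 3 4) = 0 \<or>
         l (T3 0 3 4) = 1 \<and> l (T3 1 4 5) = 1 \<and> l (T3 2 3 5) = 1 \<and> l (T3 0 4 5) = 0 \<and> l (T3 0 3 5) = 0 \<and> l (T3 1 3 5) = 0 \<and> l (T3 1 3 4) = 0 \<and> l (T3 2 4 5) = 0 \<and> l (T3 2 3 4) = 0 \<or>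
         l (T3 0 3 5) = 1 \<and> l (T3 1 4 5) = 1 \<and> l (T3 2 3 4) = 1 \<and> l (T3 0 4 5) = 0 \<and> l (T3 0 3 4) = 0 \<and> l (T3 1 3 5) = 0 \<and> l (T3 1 3 4) = 0 \<and> l (T3 2 4 5) = 0 \<and> l (T3 2 3 5) = 0 \<or>
         l (T3 0 4 5) = 1 \<and> l (T3 1 3 4) = 1 \<and> l (T3 2 3 5) = 1 \<and> l (T3 0 3 5) = 0 \<and> l (T3 0 3 4) = 0 \<and> l (T3 1 4 5) = 0 \<and> l (T3 1 3 5) = 0 \<and> l (T3 2 4 5) = 0 \<and> l (T3 2 3 4) = 0 \<or>
         l (T3 0 3 4) = 1 \<and> l (T3 1 3 5) = 1 \<and> l (T3 2 4 5) = 1 \<and> l (T3 0 4 5) = 0 \<and> l (T3 0 3 5) = 0 \<and> l (T3 1 4 5) = 0 \<and> l (T3 1 3 4) = 0 \<and> l (T3 2 3 5) = 0 \<and> l (T3 2 3 4) = 0))"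
        by (rule slice_exponents) (use w' in \<open>simp_all add: sum_sub3 z\<close>)
      then show ?thesis
        unfolding ev R_def l_def[symmetric] P_defs
        by (elim disjE conjE) (simp_all add: prod_sub3 z)
    next
      case False
      then obtain I where I: "l I \<noteq> 0" "pack \<alpha> 0 B \<beta> $ I = 0"
        by (auto simp: p_def)
      then have "mon_eval m (pack \<alpha> 0 B \<beta>) = 0"
        unfolding ev by (intro prod_zero) auto
      moreover have "p + l (T3 0 1 2) + l (T3 0 4 5) + l (T3 0 3 5) + l (T3 0 3 4) + l (T3 1 4 5)
         + l (T3 1 3 5) + l (T3 1 3 4) + l (T3 2 4 5) + l (T3 2 3 5) + l (T3 2 3 4) + l (T3 3 4 5) = 4"
        using total by (simp add: sum_sub3 p_def)
      then have "\<not> P0 l" "\<not> P1 l" "\<not> P2 l" "\<not> P3 l" "\<not> P4 l" "\<not> P5 l" "\<not> P6 l"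
        unfolding P_defs using False by linarith+
      ultimately show ?thesis by (simp add: R_def l_def[symmetric])
    qed
  qed
  have RS: "(\<Sum>m\<in>Poly_Mapping.keys f. Poly_Mapping.lookup f m * R P c m) = S P * c" for P c
    unfolding S_def sum_distrib_right sum.inter_filter[OF finite_keys]
    by (rule sum.cong) (auto simp: R_def)
  have "F (pack \<alpha> 0 B \<beta>) = S P0 * (\<alpha>\<^sup>2 * \<beta>\<^sup>2)
      + S P1 * (- \<alpha> * (B$1$1 * B$2$2 * B$3$3)) + S P2 * (- \<alpha> * (B$1$2 * B$2$3 * B$3$1))
      + S P3 * (- \<alpha> * (B$1$3 * B$2$1 * B$3$2)) + S P4 * (- \<alpha> * (B$1$2 * B$2$1 * B$3$3))
      + S P5 * (- \<alpha> * (B$1$1 * B$2$3 * B$3$2)) + S P6 * (- \<alpha> * (B$1$3 * B$2$2 * B$3$1))" for \<alpha> B \<beta>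
    by (simp only: poly_eval_def key distrib_left sum.distrib RS cong: sum.cong)
  then have "F (pack \<alpha> 0 B \<beta>) = S P0 * \<alpha>\<^sup>2 * \<beta>\<^sup>2 + \<alpha> * (
    (- S P1) * (B$1$1 * B$2$2 * B$3$3) + (- S P2) * (B$1$2 * B$2$3 * B$3$1) + (- S P3) * (B$1$3 * B$2$1 * B$3$2) +
    (- S P4) * (B$1$2 * B$2$1 * B$3$3) + (- S P5) * (B$1$1 * B$2$3 * B$3$2) + (- S P6) * (B$1$3 * B$2$2 * B$3$1))" for \<alpha> B \<beta>
    by (simp add: algebra_simps)
  then show ?thesis by (intro that allI)
qed

lemma F_involution: "g ** g = mat 1 \<Longrightarrow> F (wedge3_map g x) = F x"
  using det_involution[of g] F_wedge3_map[of g x] by (metis mult_1 power_zero_numeral zero_neq_one)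

text \<open>A row transposition sends \<alpha> to -\<alpha> and exchanges two rows of B without
  changing F, so the six constants agree up to the signs of their permutations.\<close>

lemma slice:
  obtains c d where "\<forall>\<alpha> B \<beta>. F (pack \<alpha> 0 B \<beta>) = c * \<alpha>\<^sup>2 * \<beta>\<^sup>2 + d * \<alpha> * det B"
proof -
  obtain c d1 d2 d3 d4 d5 d6 where "\<forall>\<alpha> B \<beta>. F (pack \<alpha> 0 B \<beta>) = c * \<alpha>\<^sup>2 * \<beta>\<^sup>2 + \<alpha> * (
    d1 * (B$1$1 * B$2$2 * B$3$3) + d2 * (B$1$2 * B$2$3 * B$3$1) + d3 * (B$1$3 * B$2$1 * B$3$2) +
    d4 * (B$1$2 * B$2$1 * B$3$3) + d5 * (B$1$1 * B$2$3 * B$3$2) + d6 * (B$1$3 * B$2$2 * B$3$1))"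
    by (rule slice_expansion)
  note e = this[rule_format]
  have swap: "F (pack (- 1) 0 (P ** B) 0) = F (pack 1 0 B 0)"
    if "P = swap_rows12 \<or> P = swap_rows23" for P B
  proof -
    have "block P 0 0 (mat 1) ** block P 0 0 (mat 1) = (mat 1 :: 'a ^ 6 ^ 6)"
      using that swap_involutions(1,2) by blast
    moreover have "det P = - 1"
      using that by (auto simp: det_3 swap_rows12_def swap_rows23_def vector_3)
    moreover have "transpose (cof (mat 1)) = (mat 1 :: 'a ^ 3 ^ 3)"
      by (simp add: mat3_eq_iff transpose_def mat_def)
    ultimately show ?thesis
      using F_involution[of "block P 0 0 (mat 1)" "pack 1 0 B 0"] by (simp add: wedge3_map_diag)
  qed
  define r :: "nat \<Rightarrow> 'a ^ 3" where "r i = (if i = 1 then vector [1, 0, 0] else if i = 2 then vector [0, 1, 0] else vector [0, 0, 1])" for i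
  have s12: "F (pack (- 1) 0 (vector [v, u, w]) 0) = F (pack 1 0 (vector [u, v, w]) 0)" for u v w
  proof -
    have "vector [v, u, w] = swap_rows12 ** (vector [u, v, w] :: 'a ^ 3 ^ 3)"
      by (simp add: mat3_eq_iff matrix_matrix_mult_def sum_3 swap_rows12_def vector_3)
    then show ?thesis using swap by simp
  qed
  have s23: "F (pack (- 1) 0 (vector [u, w, v]) 0) = F (pack 1 0 (vector [u, v, w]) 0)" for u v w
  proof -
    have "vector [u, w, v] = swap_rows23 ** (vector [u, v, w] :: 'a ^ 3 ^ 3)"
      by (simp add: mat3_eq_iff matrix_matrix_mult_def sum_3 swap_rows23_def vector_3)
    then show ?thesis using swap by simp
  qed
  \<comment> \<open>With a permutation matrix for B only one of the six products survives on each
    side.\<close>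
  have d4: "d4 = - d1" using s12[of "r 2" "r 1" "r 3"] by (auto simp: e r_def vector_3)
  have d5: "d5 = - d1" using s23[of "r 1" "r 3" "r 2"] by (auto simp: e r_def vector_3)
  have d2: "d2 = - d4" using s23[of "r 2" "r 1" "r 3"] by (auto simp: e r_def vector_3)
  have d3: "d3 = - d5" using s12[of "r 1" "r 3" "r 2"] by (auto simp: e r_def vector_3)
  have d6: "d6 = - d2" using s12[of "r 2" "r 3" "r 1"] by (auto simp: e r_def vector_3)
  have "F (pack \<alpha> 0 B \<beta>) = c * \<alpha>\<^sup>2 * \<beta>\<^sup>2 + d1 * \<alpha> * det B" for \<alpha> B \<beta>
    unfolding e d2 d3 d4 d5 d6 det_3 by (simp add: algebra_simps)
  then show ?thesis by (intro that allI)
qed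

lemma F_quartic:
  obtains c where "c \<noteq> 0" "\<And>x. F x = c * quartic x"
proof -
  obtain c d where "\<forall>\<alpha> B \<beta>. F (pack \<alpha> 0 B \<beta>) = c * \<alpha>\<^sup>2 * \<beta>\<^sup>2 + d * \<alpha> * det B"
    by (rule slice)
  note e = this[rule_format]
  have upper: "F (pack \<alpha> (smat \<alpha> U) B \<beta>) =
      c * \<alpha>\<^sup>2 * (\<beta> - mdot B U + 2 * \<alpha> * det U)\<^sup>2 + d * \<alpha> * det (B - smat \<alpha> (cof U))" for \<alpha> U B \<beta>
    using F_invariant[OF det_lower_block, of "- transpose U" "pack \<alpha> (smat \<alpha> U) B \<beta>"]
    by (simp add: wedge3_map_upper' e)
  \<comment> \<open>The constants c and d are compared on one vector: exchanging two basis vectors,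
    which preserves F, takes the value 4 c - d to 0.\<close>
  have "F (pack 1 (mat 1) 0 0) = 4 * c - d"
    using upper[of 1 "mat 1" 0 0] by (simp add: mdot_expand det_3 mat_def)
  moreover have "F (wedge3_map swap_14 (pack 1 (mat 1) 0 0)) = 0"
    unfolding wedge3_map_swap_14
    using upper[of 1 "vector [vector [1, 0, 0], 0, 0]" "vector [vector [0, 0, 0], vector [0, 1, 0], vector [0, 0, 1]]" 0]
    by (simp add: mdot_expand det_3 vector_3)
  ultimately have d: "d = 4 * c"
    using F_involution[OF swap_involutions(3)] by simp
  have nz: "F x = c * quartic x" if "ext3_fst x \<noteq> 0" for x
  proof -
    let ?\<alpha> = "ext3_fst x"
    have "ext3_A x = smat ?\<alpha> (smat (1 / ?\<alpha>) (ext3_A x))" using that by (simp add: vec_eq_iff)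
    then have "x = pack ?\<alpha> (smat ?\<alpha> (smat (1 / ?\<alpha>) (ext3_A x))) (ext3_B x) (ext3_snd x)" by simp
    then obtain U where x: "x = pack ?\<alpha> (smat ?\<alpha> U) (ext3_B x) (ext3_snd x)" by blast
    show ?thesis by (subst (1 2) x) (simp only: upper quartic_upper d distrib_left mult_ac)
  qed
  have all: "F x = c * quartic x" for x
  proof (cases "ext3_fst x = 0")
    case True
    \<comment> \<open>For vanishing first coordinate, both sides are compared on a line that leaves
      this hyperplane. They agree for t nonzero, their difference is cubic in t, and its constant
      term is found from t = 1, -1, 2, -2.\<close>
    let ?y = "pack 1 0 0 0 :: 'a ext3"
    have "F ?y = 0" using e[of 1 0 0] by (simp add: det_3)
    then obtain c1 c2 c3 where l: "\<And>t. F (x + t *s ?y) = F x + c1 * t + c2 * t\<^sup>2 + c3 * t ^ 3"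
      using quartic_line[OF hom, of x ?y] by auto
    define q1 where "q1 = c * (4 * det (ext3_B x) - 2 * ext3_snd x * mdot (ext3_A x) (ext3_B x))"
    have "c * quartic (x + t *s ?y) = c * quartic x + q1 * t + c * (ext3_snd x)\<^sup>2 * t\<^sup>2" for t
      using True by (simp add: quartic_def q1_def algebra_simps power2_eq_square)
    then have z: "F x + c1 * t + c2 * t\<^sup>2 + c3 * t ^ 3 = c * quartic x + q1 * t + c * (ext3_snd x)\<^sup>2 * t\<^sup>2" if "t \<noteq> 0" for t
      using nz[of "x + t *s ?y"] that True l[of t] by simp
    define a where "a = F x - c * quartic x"
    define b where "b = c2 - c * (ext3_snd x)\<^sup>2"
    have z1: "a + (c1 - q1) * t + b * t\<^sup>2 + c3 * t ^ 3 = 0" if "t \<noteq> 0" for t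
    proof -
      have "a + (c1 - q1) * t + b * t\<^sup>2 + c3 * t ^ 3 = (F x + c1 * t + c2 * t\<^sup>2 + c3 * t ^ 3) -
          (c * quartic x + q1 * t + c * (ext3_snd x)\<^sup>2 * t\<^sup>2)"
        by (simp add: a_def b_def left_diff_distrib)
      then show ?thesis using z[OF that] by simp
    qed
    have "2 * (a + b) = (a + (c1 - q1) * 1 + b * 1\<^sup>2 + c3 * 1 ^ 3) + (a + (c1 - q1) * (-1) + b * (-1)\<^sup>2 + c3 * (-1) ^ 3)"
      by simp
    also have "\<dots> = 0" by (simp only: z1[of 1] z1[of "-1"] one_neq_zero neg_equal_0_iff_equal not_False_eq_True add_0)
    finally have 1: "a + b = 0" using two by (metis mult_eq_0_iff)
    have "2 * (a + 4 * b) = (a + (c1 - q1) * 2 + b * 2\<^sup>2 + c3 * 2 ^ 3) + (a + (c1 - q1) * (-2) + b * (-2)\<^sup>2 + c3 * (-2) ^ 3)"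
      by simp
    also have "\<dots> = 0" by (simp only: z1[of 2] z1[of "-2"] two neg_equal_0_iff_equal not_False_eq_True add_0)
    finally have "a + 4 * b = 0" using two by (metis mult_eq_0_iff)
    then have "3 * b = 0" using 1 by algebra
    then have "b = 0" using three by (metis mult_eq_0_iff)
    then show ?thesis using 1 by (simp add: a_def)
  qed (rule nz)
  have "c \<noteq> 0"
  proof
    assume "c = 0"
    then have "f = 0" using poly_eval_eq_0[OF two three hom] all by simp
    then show False using inv by (simp add: SL6_invariant_quartic_def)
  qed
  then show ?thesis using all that by blast
qed

end

subsection \<open>Linear maps of 3 by 3 matrices scaling the determinant\<close>

text \<open>Rank at most one, by vanishing of the 2 by 2 minors; the zero matrix is
  included.\<close>

definition rank1 :: "('a::field) ^ 3 ^ 3 \<Rightarrow> bool" where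
  "rank1 X \<longleftrightarrow> (\<forall>i j p q. X $ i $ j * X $ p $ q = X $ i $ q * X $ p $ j)"

lemma rank1_iff_cof: "rank1 X \<longleftrightarrow> cof X = 0"
proof
  assume "rank1 X"
  then have h: "X $ i $ j * X $ p $ q = X $ i $ q * X $ p $ j" for i j p q
    by (simp add: rank1_def)
  show "cof X = 0"
    by (simp add: mat3_eq_iff h[of 2 2 3 3] h[of 2 3 3 1] h[of 2 1 3 2] h[of 3 2 1 3] h[of 3 3 1 1]
        h[of 3 1 1 2] h[of 1 2 2 3] h[of 1 3 2 1] h[of 1 1 2 2])
next
  assume "cof X = 0"
  then show "rank1 X"
    unfolding rank1_def forall_3 by (simp add: mat3_eq_iff mult.commute)
qed

lemma rank1_outer:
  assumes "rank1 X"
  obtains u v where "\<And>i j. X $ i $ j = u i * v j"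
proof (cases "X = 0")
  case True
  then show ?thesis using that[of "\<lambda>_. 0" "\<lambda>_. 0"] by simp
next
  case False
  then obtain p q where pq: "X $ p $ q \<noteq> 0" by (auto simp: vec_eq_iff)
  have "X $ i $ j = X $ i $ q * (X $ p $ j / X $ p $ q)" for i j
    using assms pq by (simp add: rank1_def field_simps)
  then show ?thesis by (rule that)
qed

definition munit :: "3 \<Rightarrow> 3 \<Rightarrow> ('a::field) ^ 3 ^ 3" where
  "munit i j = (\<chi> p q. if p = i \<and> q = j then 1 else 0)"

lemma munit_nth [simp]: "munit i j $ p $ q = (if p = i \<and> q = j then 1 else 0)"
  by (simp add: munit_def)

lemma mdot_munit: "mdot A (munit i j) = A $ i $ j"
  using exhaust_3[of i] exhaust_3[of j] by (auto simp: mdot_expand)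

lemma cof_munits:
  "cof (munit 2 2 + munit 3 3) = munit 1 1" "cof (munit 2 3 + munit 3 1) = munit 1 2" "cof (munit 2 1 + munit 3 2) = munit 1 3"
  "cof (munit 3 2 + munit 1 3) = munit 2 1" "cof (munit 3 3 + munit 1 1) = munit 2 2" "cof (munit 3 1 + munit 1 2) = munit 2 3"
  "cof (munit 1 2 + munit 2 3) = munit 3 1" "cof (munit 1 3 + munit 2 1) = munit 3 2" "cof (munit 1 1 + munit 2 2) = munit 3 3"
  by (simp_all add: mat3_eq_iff)

lemma munit_is_cof: "\<exists>A. cof A = munit i j"
  using exhaust_3[of i] exhaust_3[of j] cof_munits by metis

text \<open>Each matrix unit is the cofactor matrix of a sum of two matrix units, so cofactor
  matrices span.\<close>

lemma mdot_cof_eq_0: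
  assumes "\<And>A. mdot (cof A) X = 0"
  shows "X = 0"
proof -
  have "X $ i $ j = 0" for i j
    using munit_is_cof[of i j] assms mdot_munit[of X i j] mdot_commute by metis
  then show ?thesis by (simp add: vec_eq_iff)
qed

text \<open>The term \<open>0 * t ^ 4\<close> gives the expansion the shape expected by
  \<open>quartic_coeffs_eq\<close>.\<close>

lemma det_line:
  fixes A B :: "('a::field) ^ 3 ^ 3"
  shows "det (A + smat t B) = det A + mdot (cof A) B * t + mdot A (cof B) * t\<^sup>2 + det B * t ^ 3 + 0 * t ^ 4"
  by (simp add: det_add_mat3 mat3_simps mult_ac)

lemma munit_expansion:
  fixes A :: "('a::field) ^ 3 ^ 3"
  shows "A = (smat (A$1$1) (munit 1 1) + smat (A$1$2) (munit 1 2) + smat (A$1$3) (munit 1 3)) +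
    (smat (A$2$1) (munit 2 1) + smat (A$2$2) (munit 2 2) + smat (A$2$3) (munit 2 3)) +
    (smat (A$3$1) (munit 3 1) + smat (A$3$2) (munit 3 2) + smat (A$3$3) (munit 3 3))"
  by (simp add: mat3_eq_iff)

locale det_similarity =
  fixes L :: "('a::field) ^ 3 ^ 3 \<Rightarrow> 'a ^ 3 ^ 3" and \<kappa> :: 'a
  assumes two: "(2::'a) \<noteq> 0" and three: "(3::'a) \<noteq> 0"
    and add: "L (A + B) = L A + L B" and scale: "L (smat c A) = smat c (L A)"
    and det: "det (L A) = \<kappa> * det A" and kappa: "\<kappa> \<noteq> 0" and surj: "surj L"
begin

text \<open>Compare the coefficients of t in det (L (A + t B)) = \<kappa> det (A + t B).\<close>

lemma mdot_cof: "mdot (cof (L A)) (L B) = \<kappa> * mdot (cof A) B"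
proof -
  have "det (L A) + mdot (cof (L A)) (L B) * t + mdot (L A) (cof (L B)) * t\<^sup>2 + det (L B) * t ^ 3 + 0 * t ^ 4 =
     \<kappa> * det A + (\<kappa> * mdot (cof A) B) * t + (\<kappa> * mdot A (cof B)) * t\<^sup>2 + (\<kappa> * det B) * t ^ 3 + 0 * t ^ 4" for t
  proof -
    have "det (L A + smat t (L B)) = \<kappa> * det (A + smat t B)" by (simp only: add[symmetric] scale[symmetric] det)
    then show ?thesis by (simp only: det_line distrib_left mult.assoc mult_zero_right mult_zero_left)
  qed
  from quartic_coeffs_eq[OF two three this] show ?thesis by simp
qed

lemma inj0: "L X = 0 \<Longrightarrow> X = 0"
proof (rule mdot_cof_eq_0)
  fix A assume "L X = 0"
  then have "mdot (cof (L A)) (L X) = 0" by (simp add: mdot_expand)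
  then show "mdot (cof A) X = 0" using kappa by (simp add: mdot_cof)
qed

text \<open>Rank at most one means that the gradient \<open>cof\<close> of the determinant vanishes.
  By \<open>mdot_cof\<close> and surjectivity this property passes to the image.\<close>

lemma rank1: "rank1 X \<Longrightarrow> rank1 (L X)"
proof -
  assume "rank1 X"
  then have 0: "mdot (cof (L X)) (L B) = 0" for B
    by (simp add: mdot_cof rank1_iff_cof) (simp add: mdot_expand)
  have "mdot (cof (L X)) Y = 0" for Y
    using 0 surj by (metis surjD)
  then have "cof (L X) $ i $ j = 0" for i j using mdot_munit by metis
  then show "rank1 (L X)" by (simp add: rank1_iff_cof vec_eq_iff)
qed

lemma L_expansion:
  "L A = (smat (A$1$1) (L (munit 1 1)) + smat (A$1$2) (L (munit 1 2)) + smat (A$1$3) (L (munit 1 3))) +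
    (smat (A$2$1) (L (munit 2 1)) + smat (A$2$2) (L (munit 2 2)) + smat (A$2$3) (L (munit 2 3))) +
    (smat (A$3$1) (L (munit 3 1)) + smat (A$3$2) (L (munit 3 2)) + smat (A$3$3) (L (munit 3 3)))"
  by (subst munit_expansion[of A]) (simp only: add scale)

lemma rank1_munit_row: "rank1 (munit i j)" "rank1 (munit i j + munit i k)" "rank1 (munit i j + munit k j)"
  by (auto simp: rank1_def)

end

text \<open>Once the diagonal matrix units are fixed, the image of an off-diagonal unit \<open>E\<^sub>i\<^sub>j\<close> has
  rank one, zero diagonal, and still rank one after adding \<open>E\<^sub>i\<^sub>i\<close> or \<open>E\<^sub>j\<^sub>j\<close>; this leaves only
  multiples of \<open>E\<^sub>i\<^sub>j\<close> or \<open>E\<^sub>j\<^sub>i\<close>.\<close>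
locale det_similarity_diag = det_similarity +
  assumes diag: "L (munit i i) = munit i i"
begin

text \<open>E_kk is the cofactor matrix of the sum of the other two diagonal units, and L fixes this
  sum; so \<open>mdot_cof\<close> reads off the (k, k) entry.\<close>

lemma diag_0:
  assumes "i \<noteq> j"
  shows "L (munit i j) $ k $ k = 0"
proof -
  obtain A where A: "cof A = munit k k" "L A = A"
    using exhaust_3[of k] cof_munits(1,5,9) add diag by metis
  have "mdot (cof A) (munit i j) = 0" using assms by (auto simp: A mdot_munit)
  then have "mdot (munit k k) (L (munit i j)) = 0"
    using mdot_cof[of A "munit i j"] by (simp add: A)
  then show ?thesis by (simp add: mdot_commute[of "munit k k"] mdot_munit)
qed

lemma off_diag:
  assumes ij: "i \<noteq> j" and pq: "(p, q) \<noteq> (i, j)" "(p, q) \<noteq> (j, i)"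
  shows "L (munit i j) $ p $ q = 0"
proof -
  let ?X = "L (munit i j)"
  have X: "?X $ a $ b * ?X $ c $ d = ?X $ a $ d * ?X $ c $ b" for a b c d
    using rank1[OF rank1_munit_row(1)] by (simp add: rank1_def)
  have Y: "rank1 (munit i i + ?X)" "rank1 (munit j j + ?X)"
    using rank1[OF rank1_munit_row(2)[of i i j]] rank1[OF rank1_munit_row(3)[of j j i]]
    by (simp_all add: add diag)
  have 1: "?X $ p $ q = 0" if "p \<noteq> i" "q \<noteq> i"
  proof -
    \<comment> \<open>This minor of E_ii + X exceeds the corresponding minor of X by exactly X_pq,
      and both vanish.\<close>
    have "(munit i i + ?X) $ i $ i * (munit i i + ?X) $ p $ q = (munit i i + ?X) $ i $ q * (munit i i + ?X) $ p $ i"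
      using Y(1) unfolding rank1_def by blast
    then show ?thesis using that X[of i i p q] diag_0[OF ij, of i] by simp
  qed
  have 2: "?X $ p $ q = 0" if "p \<noteq> j" "q \<noteq> j"
  proof -
    have "(munit j j + ?X) $ j $ j * (munit j j + ?X) $ p $ q = (munit j j + ?X) $ j $ q * (munit j j + ?X) $ p $ j"
      using Y(2) unfolding rank1_def by blast
    then show ?thesis using that X[of j j p q] diag_0[OF ij, of j] by simp
  qed
  show ?thesis using 1 2 diag_0[OF ij, of p] pq ij by (cases "p = q"; cases "q = i"; cases "p = i") auto
qed

text \<open>The image of E_ij is a_ij E_ij + b_ij E_ji. Since the images of E_ij, E_ij + E_ik and
  E_ij + E_kj have rank at most one, the two kinds cannot mix at one position, in a row or in a
  column.\<close>

lemma dichotomy: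
  "(\<forall>i j. i \<noteq> j \<longrightarrow> L (munit i j) $ j $ i = 0) \<or> (\<forall>i j. i \<noteq> j \<longrightarrow> L (munit i j) $ i $ j = 0)"
proof -
  define a where "a i j = L (munit i j) $ i $ j" for i j
  define b where "b i j = L (munit i j) $ j $ i" for i j
  have ab: "a i j \<noteq> 0 \<or> b i j \<noteq> 0" if "i \<noteq> j" for i j
  proof (rule ccontr)
    assume "\<not> ?thesis"
    then have "L (munit i j) $ p $ q = 0" for p q
      using off_diag[OF that, of p q] by (cases "(p, q) = (i, j) \<or> (p, q) = (j, i)") (auto simp: a_def b_def)
    then have "L (munit i j) = 0" by (simp add: vec_eq_iff)
    then have "munit i j $ i $ j = (0::'a)" using inj0 by fastforce
    then show False by simp
  qed
  have same: "a i j * b i j = 0" if "i \<noteq> j" for i j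
    using rank1[OF rank1_munit_row(1), of i j, unfolded rank1_def, rule_format, of i j j i] diag_0[OF that]
    by (simp add: a_def b_def)
  have row: "a i j * b i k = 0" if "i \<noteq> j" "i \<noteq> k" "j \<noteq> k" for i j k
    using rank1[OF rank1_munit_row(2), of i j k, unfolded rank1_def, rule_format, of i j k i] that
      diag_0[of i j i] diag_0[of i k i] off_diag[of i j k i] off_diag[of i k i j] off_diag[of i j k j] off_diag[of i k k j]
    by (simp add: add a_def b_def)
  have col: "a i j * b k j = 0" if "i \<noteq> j" "k \<noteq> j" "i \<noteq> k" for i j k
    using rank1[OF rank1_munit_row(3), of i j k, unfolded rank1_def, rule_format, of i j j k] that
      diag_0[of i j j] diag_0[of k j j] off_diag[of i j j k] off_diag[of k j i j] off_diag[of i j i k] off_diag[of k j i k]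
    by (simp add: add a_def b_def)
  show ?thesis
  \<comment> \<open>The kind at (1, 2) propagates to (1, 3) and (3, 2), then to (2, 3) and (3, 1),
    and last to (2, 1).\<close>
  proof (cases "a 1 2 = 0")
    case False
    have "b 1 2 = 0" "b 1 3 = 0" "b 3 2 = 0"
      using same[of 1 2] row[of 1 2 3] col[of 1 2 3] False by simp_all
    moreover have "b 2 3 = 0" using ab[of 1 3] col[of 1 3 2] calculation by simp
    moreover have "b 3 1 = 0" using ab[of 3 2] row[of 3 2 1] calculation by simp
    moreover have "b 2 1 = 0" using ab[of 2 3] row[of 2 3 1] calculation by simp
    ultimately show ?thesis unfolding forall_3 by (simp add: b_def)
  next
    case True
    then have "b 1 2 \<noteq> 0" using ab[of 1 2] by simp
    then have "a 1 3 = 0" "a 3 2 = 0" using row[of 1 3 2] col[of 3 2 1] by simp_all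
    moreover have "a 2 3 = 0" using ab[of 1 3] col[of 2 3 1] calculation by simp
    moreover have "a 3 1 = 0" using ab[of 3 2] row[of 3 1 2] calculation by simp
    moreover have "a 2 1 = 0" using ab[of 2 3] row[of 2 1 3] calculation by simp
    ultimately show ?thesis using True unfolding forall_3 by (simp add: a_def)
  qed
qed

lemma rank1_const: "rank1 ((\<chi> i j. 1) :: 'a ^ 3 ^ 3)"
  by (simp add: rank1_def)

text \<open>Up to transposition, L multiplies entries by factors l_ij. The all-ones matrix has image
  (l_ij), of rank at most one with l_11 = 1, so l_ij = l_i1 l_1j.\<close>

lemma normal_form:
  obtains d e where "\<And>A i j. L A $ i $ j = d i * A $ i $ j * e j"
  | d e where "\<And>A i j. L A $ i $ j = d i * A $ j $ i * e j"
proof -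
  have J: "L (\<chi> i j. 1) $ i $ j * L (\<chi> i j. 1) $ 1 $ 1 = L (\<chi> i j. 1) $ i $ 1 * L (\<chi> i j. 1) $ 1 $ j" for i j
    using rank1[OF rank1_const] by (simp add: rank1_def)
  show ?thesis
    using dichotomy
  proof
    assume z: "\<forall>i j. i \<noteq> j \<longrightarrow> L (munit i j) $ j $ i = 0"
    have c: "L A $ i $ j = A $ i $ j * L (munit i j) $ i $ j" for A i j
      using exhaust_3[of i] exhaust_3[of j]
      by (subst L_expansion[of A], elim disjE) (simp_all add: off_diag diag z)
    define l where "l i j = L (munit i j) $ i $ j" for i j
    have c': "L A $ i $ j = A $ i $ j * l i j" for A i j unfolding l_def by (rule c)
    have "l 1 1 = 1" by (simp add: l_def diag)
    then have "l i j = l i 1 * l 1 j" for i j using J[of i j] by (simp add: c')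
    then have "L A $ i $ j = l i 1 * A $ i $ j * l 1 j" for A i j
      unfolding c' by (metis mult.assoc mult.commute)
    then show ?thesis by (rule that(1))
  next
    assume z: "\<forall>i j. i \<noteq> j \<longrightarrow> L (munit i j) $ i $ j = 0"
    have c: "L A $ i $ j = A $ j $ i * L (munit j i) $ i $ j" for A i j
      using exhaust_3[of i] exhaust_3[of j]
      by (subst L_expansion[of A], elim disjE) (simp_all add: off_diag diag z)
    define l where "l i j = L (munit j i) $ i $ j" for i j
    have c': "L A $ i $ j = A $ j $ i * l i j" for A i j unfolding l_def by (rule c)
    have "l 1 1 = 1" by (simp add: l_def diag)
    then have "l i j = l i 1 * l 1 j" for i j using J[of i j] by (simp add: c')
    then have "L A $ i $ j = l i 1 * A $ j $ i * l 1 j" for A i j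
      unfolding c' by (metis mult.assoc mult.commute)
    then show ?thesis by (rule that(2))
  qed
qed

end

definition mdiag :: "(3 \<Rightarrow> 'a::field) \<Rightarrow> 'a ^ 3 ^ 3" where
  "mdiag d = (\<chi> i j. if i = j then d i else 0)"

lemma mdiag_mult: "mdiag d ** A ** mdiag e = (\<chi> i j. d i * A $ i $ j * e j)"
  by (simp add: mat3_eq_iff matrix_matrix_mult_def sum_3 mdiag_def)

lemma matrix_add_rdistrib: "((A :: 'a::semiring_1 ^ 'n ^ 'm) + B) ** C = A ** C + B ** C"
  by (simp add: matrix_matrix_mult_def vec_eq_iff distrib_right sum.distrib)

text \<open>The image of E_ii is a product of a column u_i and a row v_i. The matrices P of these
  columns and R of these rows satisfy PR = L(1), so they are invertible, and removing them from L
  leaves a map that fixes all E_ii.\<close>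

lemma (in det_similarity) frobenius:
  obtains P R where "det P * det R = \<kappa>"
    "(\<forall>A. L A = P ** A ** R) \<or> (\<forall>A. L A = P ** transpose A ** R)"
proof -
  have "\<exists>u v. \<forall>p q. L (munit i i) $ p $ q = u p * v q" for i
    using rank1_outer[OF rank1[OF rank1_munit_row(1)]] by metis
  then obtain u v where uv: "\<And>i p q. L (munit i i) $ p $ q = u i p * v i q" by metis
  define P where "P = (\<chi> p i. u i p)"
  define R where "R = (\<chi> i q. v i q)"
  have PER: "P ** munit i i ** R = L (munit i i)" for i
    using exhaust_3[of i]
    by (elim disjE) (simp_all add: mat3_eq_iff matrix_matrix_mult_def sum_3 P_def R_def uv)
  have one: "munit 1 1 + munit 2 2 + munit 3 3 = (mat 1 :: 'a ^ 3 ^ 3)" by (simp add: mat3_eq_iff mat_def)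
  have "P ** (munit 1 1 + munit 2 2 + munit 3 3) ** R = L (munit 1 1 + munit 2 2 + munit 3 3)"
    by (simp only: matrix_add_ldistrib matrix_add_rdistrib PER add)
  then have "P ** R = L (mat 1)" by (simp only: one matrix_mul_rid)
  then have detPR: "det P * det R = \<kappa>" using det[of "mat 1"] by (simp add: det_mul[symmetric])
  then have "det P \<noteq> 0" "det R \<noteq> 0" using kappa by auto
  then obtain P' R' where P': "P ** P' = mat 1" "P' ** P = mat 1" and R': "R ** R' = mat 1" "R' ** R = mat 1"
    by (metis invertible_det_nz invertible_def)
  define M where "M A = P' ** L A ** R'" for A
  have LM: "L A = P ** M A ** R" for A
    unfolding M_def by (metis P'(1) R'(2) matrix_mul_assoc matrix_mul_lid matrix_mul_rid)
  have detM: "det (M A) = det A" for A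
    using LM[of A] det[of A] detPR kappa by (auto simp: det_mul)
  interpret M: det_similarity_diag M 1
  proof
    show "M (A + B) = M A + M B" for A B
      by (simp add: M_def add matrix_add_ldistrib matrix_add_rdistrib)
    show "M (smat c A) = smat c (M A)" for c A
      by (simp add: M_def scale mat3_eq_iff matrix_matrix_mult_def sum_3 algebra_simps)
    show "det (M A) = 1 * det A" for A by (simp add: detM)
    show "surj M"
    proof (rule surjI)
      show "M (inv L (P ** Y ** R)) = Y" for Y
        unfolding M_def surj_f_inv_f[OF surj]
        by (metis P'(2) R'(1) matrix_mul_assoc matrix_mul_lid matrix_mul_rid)
    qed
    show "M (munit i i) = munit i i" for i
      unfolding M_def PER[symmetric]
      by (metis P'(2) R'(1) matrix_mul_assoc matrix_mul_lid matrix_mul_rid)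
  qed (use two three in auto)
  show ?thesis
  proof (cases rule: M.normal_form)
    case (1 d e)
    then have "M A = mdiag d ** A ** mdiag e" for A
      by (simp add: mdiag_mult vec_eq_iff)
    then have *: "L A = (P ** mdiag d) ** A ** (mdiag e ** R)" for A
      by (simp add: LM matrix_mul_assoc)
    have "det (P ** mdiag d) * det (mdiag e ** R) = \<kappa>"
      using *[of "mat 1"] det[of "mat 1"] by (simp add: det_mul)
    then show ?thesis using * that by blast
  next
    case (2 d e)
    then have "M A = mdiag d ** transpose A ** mdiag e" for A
      by (simp add: mdiag_mult vec_eq_iff transpose_def)
    then have *: "L A = (P ** mdiag d) ** transpose A ** (mdiag e ** R)" for A
      by (simp add: LM matrix_mul_assoc)
    have "det (P ** mdiag d) * det (mdiag e ** R) = \<kappa>"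
      using *[of "mat 1"] det[of "mat 1"] by (simp add: det_mul transpose_mat)
    then show ?thesis using * that by blast
  qed
qed

subsection \<open>Decomposable vectors\<close>

lemma wedge3_map_inverse:
  fixes g :: "('a::field) ^ 6 ^ 6"
  assumes "det g \<noteq> 0"
  obtains h where "det h * det g = 1" "\<And>x. wedge3_map h (wedge3_map g x) = x" "\<And>x. wedge3_map g (wedge3_map h x) = x"
proof -
  obtain h where h: "g ** h = mat 1" "h ** g = mat 1"
    using assms by (metis invertible_det_nz invertible_def)
  have "det h * det g = 1" by (metis det_I det_mul h(2))
  moreover have "wedge3_map h (wedge3_map g x) = x" "wedge3_map g (wedge3_map h x) = x" for x
    by (metis h wedge3_map_1 wedge3_map_mult)+
  ultimately show ?thesis by (rule that)
qed

lemma wedge3_map_linear: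
  "wedge3_map g (x + y) = wedge3_map g x + wedge3_map g y" "wedge3_map g (c *s x) = c *s wedge3_map g x"
  using linear_wedge3_map[of g] unfolding Vector_Spaces.linear_iff by blast+

text \<open>Such a \<open>g\<close> is the permutation matrix with rows \<open>e\<^sub>I\<close>, \<open>e\<^bsub>I\<^sup>c\<^esub>\<close>.\<close>
lemma wedge3_map_first_coordinate:
  fixes I :: sub3
  obtains g :: "('a::field) ^ 6 ^ 6" where "(det g)\<^sup>2 = 1" "\<And>x. ext3_fst (wedge3_map g x) = x $ I"
proof -
  define vs where "vs = map (\<lambda>i. axis i (1::'a) :: 'a ^ 6) (elems I @ elems (compl3 I))"
  define g :: "'a ^ 6 ^ 6" where "g = (\<chi> r. vs ! card {..<r})"
  have "det g = (hodge_sign I :: 'a)" by (simp add: g_def vs_def hodge_sign_def wedge6_def)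
  then have "(det g)\<^sup>2 = 1" using hodge_sign_cases[of I, where 'a = 'a] by auto
  moreover have g: "g $ 0 = axis (elems I ! 0) 1" "g $ 1 = axis (elems I ! 1) 1" "g $ 2 = axis (elems I ! 2) 1"
    unfolding g_def vs_def by (simp_all add: card_lessThan_6 nth_append elems_length)
  have row: "(g *v u) $ r = u $ k" if "g $ r = axis k 1" for r k u
  proof -
    have "(\<Sum>j\<in>UNIV. g $ r $ j * u $ j) = (\<Sum>j\<in>UNIV. if j = k then u $ k else 0)"
      by (rule sum.cong) (auto simp: that axis_def)
    then show ?thesis by (simp add: matrix_vector_mult_def)
  qed
  have "ext3_fst (wedge3_map g (wedge3 u v w)) = wedge3 u v w $ I" for u v w
    by (simp add: ext3_fst_def wedge3_map_wedge3 wedge3_component[of _ _ _ "T3 0 1 2"] wedge3_component[of _ _ _ I] Let_def row g)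
  then have b: "ext3_fst (wedge3_map g (axis J 1)) = axis J 1 $ I" for J
    using wedge3_basis[OF elems_eq[of J], where 'a = 'a] by metis
  have "ext3_fst (wedge3_map g x) = x $ I" for x
  proof -
    have "ext3_fst (wedge3_map g x) = (\<Sum>J\<in>UNIV. x $ J * ext3_fst (wedge3_map g (axis J 1)))"
      by (subst linear_expand[OF linear_wedge3_map]) (simp add: ext3_fst_def)
    also have "\<dots> = (\<Sum>J\<in>UNIV. if J = I then x $ I else 0)"
      unfolding b by (rule sum.cong) (auto simp: axis_def)
    finally show ?thesis by simp
  qed
  ultimately show ?thesis using that by blast
qed

lemma wedge3_map_kill_A:
  assumes "ext3_fst x \<noteq> 0"
  obtains U B \<beta> where "wedge3_map (block (mat 1) 0 U (mat 1)) x = pack (ext3_fst x) 0 B \<beta>"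
proof -
  let ?U = "smat (- 1 / ext3_fst x) (ext3_A x)"
  have "ext3_A x + smat (ext3_fst x) ?U = 0" using assms by (simp add: vec_eq_iff)
  then have "\<exists>B \<beta>. wedge3_map (block (mat 1) 0 (transpose ?U) (mat 1)) x = pack (ext3_fst x) 0 B \<beta>"
    using wedge3_map_upper[of ?U "ext3_fst x" "ext3_A x" "ext3_B x" "ext3_snd x"] by auto
  then show ?thesis using that by blast
qed

text \<open>Only the square of the determinant is controlled because the permutation used may be
  odd; the quartic is scaled by this square.\<close>

lemma wedge3_map_normalize:
  fixes x :: "('a::field) ext3"
  assumes "x \<noteq> 0"
  obtains g \<alpha> B \<beta> where "(det g)\<^sup>2 = 1" "\<alpha> \<noteq> 0" "wedge3_map g x = pack \<alpha> 0 B \<beta>"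
proof -
  obtain I where I: "x $ I \<noteq> 0" using assms by (auto simp: vec_eq_iff)
  obtain g where g: "(det g)\<^sup>2 = 1" "ext3_fst (wedge3_map g x) = x $ I"
    using wedge3_map_first_coordinate[of I] by metis
  then obtain U B \<beta> where "wedge3_map (block (mat 1) 0 U (mat 1)) (wedge3_map g x) = pack (x $ I) 0 B \<beta>"
    using wedge3_map_kill_A[of "wedge3_map g x"] I by metis
  moreover have "(det (block (mat 1) 0 U (mat 1) ** g))\<^sup>2 = 1"
    by (simp add: det_mul det_lower_block g)
  ultimately show ?thesis using that I wedge3_map_mult by metis
qed

text \<open>The nonzero special vectors are the decomposable ones.\<close>
definition special :: "('a::field) ext3 \<Rightarrow> bool" where
  "special x \<longleftrightarrow> (\<exists>l. (\<forall>y z. l (y + z) = l y + l z) \<and>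
     (\<forall>z. \<exists>c3 c4. \<forall>t. quartic (x + t *s z) = (l z)\<^sup>2 * t\<^sup>2 + c3 * t ^ 3 + c4 * t ^ 4))"

lemma quartic_line_fst:
  "quartic (pack a 0 0 0 + t *s z) = (a * ext3_snd z)\<^sup>2 * t\<^sup>2 +
    (2 * a * ext3_snd z * (ext3_fst z * ext3_snd z - mdot (ext3_A z) (ext3_B z)) + 4 * a * det (ext3_B z)) * t ^ 3 +
    quartic z * t ^ 4"
  by (simp add: quartic_def mat3_simps algebra_simps power2_eq_square power3_eq_cube power4_eq_xxxx)

lemma quartic_line_snd:
  "quartic (pack 0 0 0 b + t *s z) = (b * ext3_fst z)\<^sup>2 * t\<^sup>2 +
    (2 * b * ext3_fst z * (ext3_fst z * ext3_snd z - mdot (ext3_A z) (ext3_B z)) + 4 * b * det (ext3_A z)) * t ^ 3 +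
    quartic z * t ^ 4"
  by (simp add: quartic_def mat3_simps algebra_simps power2_eq_square power3_eq_cube power4_eq_xxxx)

lemma special_fst: "special (pack a 0 0 0)"
  unfolding special_def
  by (rule exI[of _ "\<lambda>z. a * ext3_snd z"]) (auto simp: quartic_line_fst distrib_left)

lemma special_snd: "special (pack 0 0 0 b)"
  unfolding special_def
  by (rule exI[of _ "\<lambda>z. b * ext3_fst z"]) (auto simp: quartic_line_snd distrib_left)

lemma quartic_scale: "quartic (c *s x) = c ^ 4 * quartic x"
  by (simp add: quartic_def mat3_simps algebra_simps power2_eq_square power3_eq_cube power4_eq_xxxx)

lemma special_transport:
  assumes "special x"
    and add: "\<And>y z. \<theta> (y + z) = \<theta> y + \<theta> z" and scale: "\<And>c y. \<theta> (c *s y) = c *s \<theta> y"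
    and inv: "\<And>y. \<theta>' (\<theta> y) = y" "\<And>y. \<theta> (\<theta>' y) = y" and Q: "\<And>y. quartic (\<theta> y) = quartic y"
  shows "special (\<theta> x)"
proof -
  obtain l where l: "\<And>y z. l (y + z) = l y + l z"
    "\<And>z. \<exists>c3 c4. \<forall>t. quartic (x + t *s z) = (l z)\<^sup>2 * t\<^sup>2 + c3 * t ^ 3 + c4 * t ^ 4"
    using assms(1) unfolding special_def by blast
  have "\<theta>' (y + z) = \<theta>' y + \<theta>' z" for y z by (metis add inv)
  moreover have "quartic (\<theta> x + t *s z) = quartic (x + t *s \<theta>' z)" for t z
    by (metis Q add inv(2) scale)
  ultimately show ?thesis
    unfolding special_def using l by (intro exI[of _ "\<lambda>z. l (\<theta>' z)"]) simp
qed

text \<open>Coefficients along \<open>pack 0 0 B' \<beta>'\<close> give \<beta> = 0 and show that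
  l^2 is \<alpha>^2 \<beta>'^2 + 4 \<alpha> <B, cof B'>. As l is additive, the missing cross term
  forces l to vanish at \<open>pack 0 0 B' 0\<close>, so B is orthogonal to all cofactor
  matrices.\<close>

lemma special_pack:
  assumes char: "(2::'a::field) \<noteq> 0" "(3::'a) \<noteq> 0"
    and sp: "special (pack \<alpha> 0 B \<beta>)" and \<alpha>: "\<alpha> \<noteq> (0::'a)"
  shows "B = 0 \<and> \<beta> = 0"
proof -
  obtain l where add: "\<And>y z. l (y + z) = l y + l z"
    and l: "\<And>z. \<exists>c3 c4. \<forall>t. quartic (pack \<alpha> 0 B \<beta> + t *s z) = (l z)\<^sup>2 * t\<^sup>2 + c3 * t ^ 3 + c4 * t ^ 4"
    using sp unfolding special_def by blast
  have four: "(4::'a) \<noteq> 0" using char(1) by (metis mult_2_right mult_eq_0_iff numeral_Bit0)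
  have co: "2 * \<alpha>\<^sup>2 * \<beta> * \<beta>' + 4 * \<alpha> * mdot (cof B) B' = 0 \<and> (l (pack 0 0 B' \<beta>'))\<^sup>2 = \<alpha>\<^sup>2 * \<beta>'\<^sup>2 + 4 * \<alpha> * mdot B (cof B')" for B' \<beta>'
  proof -
    obtain c3 c4 where c: "\<And>t. quartic (pack \<alpha> 0 B \<beta> + t *s pack 0 0 B' \<beta>') =
        (l (pack 0 0 B' \<beta>'))\<^sup>2 * t\<^sup>2 + c3 * t ^ 3 + c4 * t ^ 4"
      using l by blast
    have "0 + 0 * t + (l (pack 0 0 B' \<beta>'))\<^sup>2 * t\<^sup>2 + c3 * t ^ 3 + c4 * t ^ 4 =
       (\<alpha>\<^sup>2 * \<beta>\<^sup>2 + 4 * \<alpha> * det B) + (2 * \<alpha>\<^sup>2 * \<beta> * \<beta>' + 4 * \<alpha> * mdot (cof B) B') * t +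
       (\<alpha>\<^sup>2 * \<beta>'\<^sup>2 + 4 * \<alpha> * mdot B (cof B')) * t\<^sup>2 + (4 * \<alpha> * det B') * t ^ 3 + 0 * t ^ 4" for t
    proof -
      have "mdot 0 X = 0" "mdot (cof 0) X = 0" "det (0 :: 'a ^ 3 ^ 3) = 0" for X :: "'a ^ 3 ^ 3"
        by (simp_all add: mdot_expand det_3)
      then have "quartic (pack \<alpha> 0 B \<beta> + t *s pack 0 0 B' \<beta>') = \<alpha>\<^sup>2 * (\<beta> + t * \<beta>')\<^sup>2 + 4 * \<alpha> * det (B + smat t B')"
        by (simp add: pack_add pack_scale quartic_def power_mult_distrib)
      also have "\<dots> = (\<alpha>\<^sup>2 * \<beta>\<^sup>2 + 4 * \<alpha> * det B) + (2 * \<alpha>\<^sup>2 * \<beta> * \<beta>' + 4 * \<alpha> * mdot (cof B) B') * t +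
       (\<alpha>\<^sup>2 * \<beta>'\<^sup>2 + 4 * \<alpha> * mdot B (cof B')) * t\<^sup>2 + (4 * \<alpha> * det B') * t ^ 3 + 0 * t ^ 4"
        unfolding det_line by (simp add: algebra_simps power2_eq_square)
      finally show ?thesis unfolding c by simp
    qed
    from quartic_coeffs_eq[OF char this] show ?thesis by simp
  qed
  have mz: "mdot X 0 = 0" "cof 0 = (0 :: 'a ^ 3 ^ 3)" for X :: "'a ^ 3 ^ 3"
    by (simp_all add: mdot_expand mat3_eq_iff)
  have "2 * \<alpha>\<^sup>2 * \<beta> = 0" using co[of 1 0] by (simp add: mz)
  then have "\<beta> = 0" using char(1) \<alpha> by (metis mult_eq_0_iff power_eq_0_iff)
  define p where "p = l (pack 0 0 0 1)"
  have pp: "p\<^sup>2 = \<alpha>\<^sup>2" using co[of 1 0] by (simp add: p_def mz)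
  have "mdot B (cof B') = 0" for B'
  proof -
    define q where "q = l (pack 0 0 B' 0)"
    have q: "q\<^sup>2 = 4 * \<alpha> * mdot B (cof B')" using co[of 0 B'] by (simp add: q_def)
    have "pack 0 0 B' 1 = pack 0 0 B' 0 + pack 0 0 0 1" by (simp add: pack_add)
    then have "(q + p)\<^sup>2 = \<alpha>\<^sup>2 + 4 * \<alpha> * mdot B (cof B')" using co[of 1 B'] by (simp add: add q_def p_def)
    then have "2 * q * p = 0" using pp q by (simp add: power2_sum algebra_simps)
    moreover have "p \<noteq> 0" using pp \<alpha> by auto
    ultimately have "q = 0" using char(1) by (metis mult_eq_0_iff)
    then show ?thesis using q \<alpha> four by simp
  qed
  then have "B = 0" using mdot_cof_eq_0 mdot_commute by metis
  with \<open>\<beta> = 0\<close> show ?thesis by simp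
qed

section \<open>Maps acting separately on the two matrix blocks\<close>

lemma mdot_mult_left: "mdot (P ** X) Y = mdot X (transpose P ** Y)"
  by (simp add: mdot_expand matrix_matrix_mult_def sum_3 transpose_def algebra_simps)

lemma mdot_mult_right: "mdot (X ** R) Y = mdot X (Y ** transpose R)"
  by (simp add: mdot_expand matrix_matrix_mult_def sum_3 transpose_def algebra_simps)

lemma cof_mult:
  fixes P :: "('a::field) ^ 3 ^ 3"
  shows "transpose P ** cof P = smat (det P) (mat 1)" "cof P ** transpose P = smat (det P) (mat 1)"
  by (simp_all add: mat3_eq_iff matrix_matrix_mult_def sum_3 transpose_def mat_def det_3 algebra_simps)

lemma cof_transpose: "cof (transpose R) = transpose (cof R)"
  by (simp add: mat3_eq_iff transpose_def mult.commute)

lemma smat_mult: "smat c A ** (B :: ('a::field) ^ 3 ^ 3) = smat c (A ** B)" "B ** smat c A = smat c (B ** A)"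
  by (simp_all add: mat3_eq_iff matrix_matrix_mult_def sum_3 algebra_simps)

lemma mdot_cof_mult: "mdot (P ** A ** R) (cof P ** B ** cof R) = det P * det R * mdot A B"
proof -
  have "mdot (P ** A ** R) (cof P ** B ** cof R) = mdot A ((transpose P ** cof P) ** B ** (cof R ** transpose R))"
    by (simp only: mdot_mult_right[of "P ** A" R] mdot_mult_left[of P A] matrix_mul_assoc)
  also have "\<dots> = det P * det R * mdot A B"
    by (simp add: cof_mult smat_mult mat3_simps)
  finally show ?thesis .
qed

lemma mdot_eqI:
  assumes "surj L" "\<And>A. mdot (L A) X = mdot (L A) Y"
  shows "X = Y"
proof -
  have "mdot Z X = mdot Z Y" for Z using assms by (metis surjD)
  then have "X $ i $ j = Y $ i $ j" for i j by (metis mdot_commute mdot_munit)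
  then show ?thesis by (simp add: vec_eq_iff)
qed

lemma det_block_diag_nz:
  fixes P R :: "('a::field) ^ 3 ^ 3"
  assumes "det P \<noteq> 0" "det R \<noteq> 0"
  shows "det (block P 0 0 R) \<noteq> 0"
proof -
  obtain P' R' where "P ** P' = mat 1" "R ** R' = mat 1"
    using assms by (metis invertible_det_nz invertible_def)
  then have "block P 0 0 R ** block P' 0 0 R' = mat 1" by (simp add: block_mult block_1)
  then show ?thesis by (metis det_I det_mul mult_zero_left zero_neq_one)
qed

text \<open>Since \<open>P\<^sup>T cof P = det P\<close>, the entries of the block matrix are the solution of
  \<open>c det g\<^sub>1 = a\<close>, \<open>c det g\<^sub>2 = b\<close>, \<open>c (cof g\<^sub>1) A g\<^sub>2\<^sup>T = P A R\<close>.\<close>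
lemma block_diagonal_map:
  fixes a b :: "'a::field"
  assumes form: "\<And>x. \<psi> x = pack (a * ext3_fst x) (P ** ext3_A x ** R) (M (ext3_B x)) (b * ext3_snd x)"
    and ab: "(a * b)\<^sup>2 = 1" and det: "det P * det R * b = 1"
    and M: "\<And>A B. mdot (P ** A ** R) (M B) = a * b * mdot A B"
  obtains c g where "c \<noteq> 0" "det g \<noteq> 0" "\<And>x. \<psi> x = c *s wedge3_map g x"
proof -
  have nz: "a \<noteq> 0" "b \<noteq> 0" "det P \<noteq> 0" "det R \<noteq> 0" using ab det by auto
  \<comment> \<open>The lower block will be the transpose of R, so c is forced by the last
    coordinate and g1 by the A-block.\<close>
  define c where "c = b / det R"
  define g1 where "g1 = smat (a / det P) (cof P)"
  have PR: "det P * det R = 1 / b" using det nz by (simp add: field_simps)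
  have cb: "c / det P = b\<^sup>2"
  proof -
    have "c / det P = b / (det P * det R)" by (simp add: c_def)
    then show ?thesis by (simp add: PR power2_eq_square)
  qed
  have "det g1 = a ^ 3 / det P" using nz by (simp add: g1_def mat3_simps power3_eq_cube power2_eq_square field_simps)
  then have "c * det g1 = (c / det P) * a ^ 3" by simp
  also have "\<dots> = (a * b)\<^sup>2 * a" unfolding cb by (simp add: power_mult_distrib power3_eq_cube power2_eq_square)
  finally have c1: "c * det g1 = a" using ab by simp
  have "cof g1 = smat (a\<^sup>2 / det P) P" using nz by (simp add: g1_def mat3_simps vec_eq_iff power2_eq_square)
  then have c2: "smat c (cof g1 ** A ** R) = P ** A ** R" for A
  proof -
    have "c * (a\<^sup>2 / det P) = (c / det P) * a\<^sup>2" by simp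
    also have "\<dots> = (a * b)\<^sup>2" unfolding cb by (simp add: power_mult_distrib)
    finally have "c * (a\<^sup>2 / det P) = (a * b)\<^sup>2" .
    moreover have "smat c (smat d X) = smat (c * d) X" for d and X :: "'a ^ 3 ^ 3"
      by (simp add: vec_eq_iff mult.assoc)
    ultimately show ?thesis unfolding \<open>cof g1 = _\<close> smat_mult by (simp only: ab smat_1)
  qed
  have c3: "c * det R = b" using nz by (simp add: c_def)
  define N where "N B = smat c (g1 ** B ** cof R)" for B
  have N: "mdot (P ** A ** R) (N B) = a * b * mdot A B" for A B
    using nz by (simp add: N_def g1_def smat_mult mat3_simps mdot_cof_mult c_def)
  have "surj (\<lambda>A. P ** A ** R)"
  proof -
    obtain P' R' where "P ** P' = mat 1" "R' ** R = mat 1"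
      using nz by (metis invertible_det_nz invertible_def)
    then have "P ** (P' ** Y ** R') ** R = Y" for Y
      by (metis matrix_mul_assoc matrix_mul_lid matrix_mul_rid)
    then show ?thesis by (rule surjI)
  qed
  \<comment> \<open>The pairing is nondegenerate, so the action on A leaves only one possible action
    on B.\<close>
  then have MN: "M B = N B" for B by (rule mdot_eqI) (simp add: M N)
  have "\<psi> x = c *s wedge3_map (block g1 0 0 (transpose R)) x" for x
    by (subst (2) pack_ext3[symmetric], unfold wedge3_map_diag)
       (simp add: form pack_scale MN N_def cof_transpose c1[symmetric] c2 c3[symmetric] mult.assoc)
  moreover have "det (block g1 0 0 (transpose R)) \<noteq> 0"
    using nz c1 by (intro det_block_diag_nz) auto
  moreover have "c \<noteq> 0" using nz by (simp add: c_def)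
  ultimately show ?thesis using that by blast
qed

subsection \<open>Preservers of the quartic form\<close>

text \<open>The condition on c and det g comes from evaluating at \<open>pack 1 0 0 1\<close>, where
  the quartic is 1.\<close>

lemma scaled_GL6_mapI:
  fixes g :: "('a::field) ^ 6 ^ 6"
  assumes "c \<noteq> 0" "det g \<noteq> 0" and T: "\<And>x. T x = c *s wedge3_map g x"
    and Q: "\<And>x. quartic (wedge3_map g x) = (det g)\<^sup>2 * quartic x" "\<And>x. quartic (T x) = quartic x"
  shows "scaled_GL6_map T"
proof -
  have "Vector_Spaces.linear (*s) (*s) T"
    by (rule vec_linearI) (simp_all add: T wedge3_map_linear vec.scale_right_distrib mult.commute)
  moreover have "invertible g" using assms(2) by (simp add: invertible_det_nz)
  moreover have "quartic (T (pack 1 0 0 1)) = c ^ 4 * ((det g)\<^sup>2 * quartic (pack 1 0 0 1))"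
    by (simp add: T quartic_scale Q(1))
  then have "c ^ 4 * (det g)\<^sup>2 = 1" by (simp add: Q(2)) (simp add: quartic_def mdot_expand det_3)
  ultimately show ?thesis
    unfolding scaled_GL6_map_def using assms(1) by (auto simp: T wedge3_map_wedge3)
qed

lemma transpose_0 [simp]: "transpose 0 = (0 :: 'a::zero ^ 'n ^ 'm)"
  by (simp add: transpose_def vec_eq_iff)

lemma cof_0 [simp]: "cof 0 = 0"
  by (simp add: mat3_eq_iff)

definition transpose_map :: "('a::field) ext3 \<Rightarrow> 'a ext3" where
  "transpose_map x = pack (ext3_fst x) (transpose (ext3_A x)) (transpose (ext3_B x)) (ext3_snd x)"

lemma transpose_map_hodge: "transpose_map x = hodge_star (wedge3_map (block 0 (mat 1) (- mat 1) 0) x)"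
proof -
  have "hodge_star (wedge3_map (block 0 (mat 1) (- mat 1) 0) (pack \<alpha> A B \<beta>)) = pack \<alpha> (transpose A) (transpose B) \<beta>"
    for \<alpha> \<beta> :: 'a and A B
    by (simp add: wedge3_map_swap hodge_star_pack)
  then show ?thesis unfolding transpose_map_def by (metis pack_ext3)
qed

lemma transpose_map_invol [simp]: "transpose_map (transpose_map x) = x"
  by (simp add: transpose_map_def)

lemma quartic_transpose_map: "quartic (transpose_map x) = quartic x"
proof -
  have "mdot (transpose A) (transpose B) = mdot A B" for A B :: "'a ^ 3 ^ 3"
    by (simp add: mdot_expand transpose_def)
  then show ?thesis by (simp add: quartic_def transpose_map_def cof_transpose)
qed

lemma det_swap_block:
  "det (block 0 (mat 1) (- mat 1) 0 :: ('a::field) ^ 6 ^ 6) * det (block 0 (- mat 1) (mat 1) 0 :: 'a ^ 6 ^ 6) = 1"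
proof -
  have "block 0 (mat 1) (- mat 1) 0 ** block 0 (- mat 1) (mat 1) 0 = (mat 1 :: 'a ^ 6 ^ 6)"
    unfolding block_mult block_1[symmetric]
    by (intro arg_cong4[of _ _ _ _ _ _ _ _ block];
        simp add: mat3_eq_iff matrix_matrix_mult_def sum_3 mat_def)
  then show ?thesis by (metis det_I det_mul)
qed

text \<open>The coefficient of t is \<open>mdot (cof A) X\<close>, and cofactor matrices
  span.\<close>

lemma det_line_const:
  fixes X :: "('a::field) ^ 3 ^ 3"
  assumes char: "(2::'a) \<noteq> 0" "(3::'a) \<noteq> 0" and "\<And>Y t. det (Y + smat t X) = det Y"
  shows "X = 0"
proof (rule mdot_cof_eq_0)
  fix A
  have "det A + mdot (cof A) X * t + mdot A (cof X) * t\<^sup>2 + det X * t ^ 3 + 0 * t ^ 4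
     = det A + 0 * t + 0 * t\<^sup>2 + 0 * t ^ 3 + 0 * t ^ 4" for t
    using assms(3)[of A t] by (simp only: det_line) simp
  from quartic_coeffs_eq[OF char this] show "mdot (cof A) X = 0" by simp
qed

text \<open>\<open>Qg\<close> is inherited from an invariant form, of which \<open>quartic\<close>
  is a multiple; assuming it here keeps formal polynomials out of the classification.\<close>

locale quartic_preserver =
  fixes \<phi> :: "('a::field) ext3 \<Rightarrow> 'a ext3"
  assumes two: "(2::'a) \<noteq> 0" and three: "(3::'a) \<noteq> 0"
    and Qg: "\<And>(g :: 'a ^ 6 ^ 6) x. det g \<noteq> 0 \<Longrightarrow> quartic (wedge3_map g x) = (det g)\<^sup>2 * quartic x"
    and lin: "Vector_Spaces.linear (*s) (*s) \<phi>" and Q: "\<And>x. quartic (\<phi> x) = quartic x"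
begin

lemma add: "\<phi> (x + y) = \<phi> x + \<phi> y" and scale: "\<phi> (c *s x) = c *s \<phi> x"
  using lin unfolding Vector_Spaces.linear_iff by blast+

lemma eight: "(8::'a) \<noteq> 0"
proof -
  have "(8::'a) = 2 * 2 * 2" by simp
  then show ?thesis using two by (metis mult_eq_0_iff)
qed

text \<open>The quartic is constant in the direction of a kernel vector. After normalization, the
  line through \<open>pack 0 0 0 1\<close> in that direction has t^2 coefficient \<alpha>^2, which
  is nonzero.\<close>

lemma kernel:
  assumes "\<phi> z = 0" shows "z = 0"
proof (rule ccontr)
  assume "z \<noteq> 0"
  then obtain g \<alpha> B \<beta> where g: "(det g)\<^sup>2 = 1" "\<alpha> \<noteq> 0" "wedge3_map g z = pack \<alpha> 0 B \<beta>"
    by (rule wedge3_map_normalize)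
  then have nz: "det g \<noteq> 0" by auto
  then obtain h where h: "\<And>x. wedge3_map g (wedge3_map h x) = x" using wedge3_map_inverse by metis
  have "quartic (y + t *s pack \<alpha> 0 B \<beta>) = quartic y" for y t
  proof -
    have "quartic (wedge3_map h y + t *s z) = quartic (wedge3_map h y)"
      by (metis Q add scale assms add.right_neutral vec.scale_zero_right)
    then have "quartic (wedge3_map g (wedge3_map h y + t *s z)) = quartic (wedge3_map g (wedge3_map h y))"
      by (simp add: Qg nz)
    then show ?thesis by (simp add: wedge3_map_linear h g(3))
  qed
  from this[of "pack 0 0 0 1"] obtain u v where
    "\<And>t. \<alpha>\<^sup>2 * t\<^sup>2 + u * t ^ 3 + v * t ^ 4 = quartic (pack 0 0 0 1)"
    by (simp add: quartic_line_snd) blast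
  then have "0 + 0 * t + \<alpha>\<^sup>2 * t\<^sup>2 + u * t ^ 3 + v * t ^ 4 = 0" for t
    by (simp add: quartic_def mdot_expand det_3)
  from quartic_zero[OF two three this] show False using g(2) by simp
qed

lemma bij: "bij \<phi>"
proof -
  interpret Vector_Spaces.linear "(*s)" "(*s)" \<phi> by (rule lin)
  have "inj \<phi>" using kernel by (simp add: inj_iff_eq_0)
  then show ?thesis using vec.linear_injective_imp_surjective[OF lin] by (simp add: bij_def)
qed

lemma special_image: "special x \<Longrightarrow> special (\<phi> x)"
  by (rule special_transport[of x \<phi> "inv \<phi>"])
     (simp_all add: add scale Q bij_inv_eq_iff[OF bij] bij_is_inj[OF bij] bij_is_surj[OF bij] inv_f_f surj_f_inv_f)

lemma compose_wedge3_map: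
  assumes "(det g)\<^sup>2 = 1"
  shows "quartic_preserver (\<lambda>x. wedge3_map g (\<phi> x))"
proof (rule quartic_preserver.intro)
  show "Vector_Spaces.linear (*s) (*s) (\<lambda>x. wedge3_map g (\<phi> x))"
    by (rule linear_compose_vec[OF lin linear_wedge3_map])
  have "det g \<noteq> 0" using assms by auto
  then show "quartic (wedge3_map g (\<phi> x)) = quartic x" for x by (simp add: Qg Q assms)
qed (use two three Qg in auto)

text \<open>The image of a special vector is special, and a special vector in normalized position
  has only its first coordinate.\<close>

lemma normalize_first:
  obtains g a where "(det g)\<^sup>2 = 1" "a \<noteq> 0" "wedge3_map g (\<phi> (pack 1 0 0 0)) = pack a 0 0 0"
proof -
  have "pack 1 0 0 0 \<noteq> (0 :: 'a ext3)" by (metis ext3_lin(9) ext3_pack(1) zero_neq_one)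
  then have "\<phi> (pack 1 0 0 0) \<noteq> 0" using kernel by blast
  then obtain g \<alpha> B \<beta> where g: "(det g)\<^sup>2 = 1" "\<alpha> \<noteq> 0" "wedge3_map g (\<phi> (pack 1 0 0 0)) = pack \<alpha> 0 B \<beta>"
    by (rule wedge3_map_normalize)
  interpret g: quartic_preserver "\<lambda>x. wedge3_map g (\<phi> x)" by (rule compose_wedge3_map[OF g(1)])
  have "special (pack \<alpha> 0 B \<beta>)" using g.special_image[OF special_fst[of 1]] g(3) by simp
  then have "B = 0 \<and> \<beta> = 0" using special_pack[OF two three _ g(2)] by blast
  then show ?thesis using that g by blast
qed

text \<open>The two sides are the t^2 coefficients of the quartic on corresponding lines.\<close>

lemma snd_square:
  assumes "\<phi> (pack 1 0 0 0) = pack a 0 0 0"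
  shows "(a * ext3_snd (\<phi> y))\<^sup>2 = (ext3_snd y)\<^sup>2"
proof -
  have 1: "quartic (pack a 0 0 0 + t *s \<phi> y) = quartic (pack 1 0 0 0 + t *s y)" for t
    by (metis Q assms add scale)
  have "\<exists>u v u' v'. \<forall>t. 0 + 0 * t + (a * ext3_snd (\<phi> y))\<^sup>2 * t\<^sup>2 + u * t ^ 3 + v * t ^ 4
      = 0 + 0 * t + (ext3_snd y)\<^sup>2 * t\<^sup>2 + u' * t ^ 3 + v' * t ^ 4"
    using 1 unfolding quartic_line_fst by (simp only: mult_1 add_0 mult_zero_left) blast
  then show ?thesis using quartic_coeffs_eq[OF two three] by blast
qed

lemma fst_square:
  assumes "\<phi> (pack 0 0 0 1) = pack 0 0 0 b"
  shows "(b * ext3_fst (\<phi> y))\<^sup>2 = (ext3_fst y)\<^sup>2"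
proof -
  have 1: "quartic (pack 0 0 0 b + t *s \<phi> y) = quartic (pack 0 0 0 1 + t *s y)" for t
    by (metis Q assms add scale)
  have "\<exists>u v u' v'. \<forall>t. 0 + 0 * t + (b * ext3_fst (\<phi> y))\<^sup>2 * t\<^sup>2 + u * t ^ 3 + v * t ^ 4
      = 0 + 0 * t + (ext3_fst y)\<^sup>2 * t\<^sup>2 + u' * t ^ 3 + v' * t ^ 4"
    using 1 unfolding quartic_line_snd by (simp only: mult_1 add_0 mult_zero_left) blast
  then show ?thesis using quartic_coeffs_eq[OF two three] by blast
qed

text \<open>Exchanging the two halves makes the last coordinate the first, so
  \<open>wedge3_map_kill_A\<close> applies. Its matrix, conjugated back, fixes the first three basis
  vectors and hence \<open>pack a 0 0 0\<close>.\<close>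

lemma normalize_second:
  assumes a: "\<phi> (pack 1 0 0 0) = pack a 0 0 0" "a \<noteq> 0"
  obtains g b where "(det g)\<^sup>2 = 1" "wedge3_map g (pack a 0 0 0) = pack a 0 0 0"
    "wedge3_map g (\<phi> (pack 0 0 0 1)) = pack 0 0 0 b"
proof -
  let ?S = "block 0 (mat 1) (- mat 1) 0 :: 'a ^ 6 ^ 6"
  have detS: "det ?S \<noteq> 0" using det_swap_block by (metis mult_zero_left zero_neq_one)
  obtain S' where S': "det S' * det ?S = 1" "\<And>x. wedge3_map S' (wedge3_map ?S x) = x"
    using wedge3_map_inverse[OF detS] by metis
  define y where "y = \<phi> (pack 0 0 0 1)"
  have "ext3_snd y \<noteq> 0"
    using snd_square[OF a(1), of "pack 0 0 0 1"] by (auto simp: y_def)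
  moreover have Sy: "ext3_fst (wedge3_map ?S y) = ext3_snd y"
    using wedge3_map_swap[of "ext3_fst y" "ext3_A y" "ext3_B y" "ext3_snd y"] by simp
  ultimately have fst: "ext3_fst (wedge3_map ?S y) \<noteq> 0" by simp
  then obtain U B \<beta> where U: "wedge3_map (block (mat 1) 0 U (mat 1)) (wedge3_map ?S y) = pack (ext3_fst (wedge3_map ?S y)) 0 B \<beta>"
    by (rule wedge3_map_kill_A)
  let ?u = "block (mat 1) 0 U (mat 1) :: 'a ^ 6 ^ 6"
  define g where "g = S' ** (?u ** ?S)"
  have g: "wedge3_map g x = wedge3_map S' (wedge3_map ?u (wedge3_map ?S x))" for x
    by (simp add: g_def wedge3_map_mult)
  have "det g = 1" using S'(1) by (simp add: g_def det_mul det_lower_block)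
  then have detg: "(det g)\<^sup>2 = 1" by simp
  have "special (pack (ext3_fst (wedge3_map ?S y)) 0 B \<beta>)"
  proof -
    have "wedge3_map ?S (wedge3_map g y) = pack (ext3_fst (wedge3_map ?S y)) 0 B \<beta>"
    proof -
      obtain h where h: "\<And>x. wedge3_map h (wedge3_map S' x) = x"
        using wedge3_map_inverse[of S'] S'(1) by (metis mult_zero_left zero_neq_one)
      have "wedge3_map ?S (wedge3_map S' x) = x" for x by (metis S'(2) h)
      then show ?thesis by (simp add: g U)
    qed
    moreover have "(det (?S ** g))\<^sup>2 = 1"
    proof -
      \<comment> \<open>In dimension 6 the matrix -1 has determinant 1, so the square of
        \<open>det ?S\<close> is 1.\<close>
      have "?S ** ?S = - mat 1"
      proof -
        have "?S ** ?S = block (- mat 1) 0 0 (- mat 1)"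
          unfolding block_mult by (intro arg_cong4[of _ _ _ _ _ _ _ _ block];
            simp add: mat3_eq_iff matrix_matrix_mult_def sum_3 mat_def)
        also have "\<dots> = - mat 1" unfolding vec_eq_iff all_6 by (simp add: block_def mat_def)
        finally show ?thesis .
      qed
      then have "(det ?S)\<^sup>2 = det (- mat 1 :: 'a ^ 6 ^ 6)" by (metis det_mul power2_eq_square)
      also have "- mat 1 = diag6 (\<lambda>_. - 1 :: 'a)" by (simp add: vec_eq_iff diag6_def mat_def)
      also have "det \<dots> = 1" by (simp add: det_diag6)
      finally show ?thesis using detg by (simp add: det_mul power_mult_distrib)
    qed
    then interpret Sg: quartic_preserver "\<lambda>x. wedge3_map (?S ** g) (\<phi> x)" by (rule compose_wedge3_map)
    have "special (wedge3_map (?S ** g) (\<phi> (pack 0 0 0 1)))"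
      by (rule Sg.special_image[OF special_snd])
    ultimately show ?thesis by (simp add: wedge3_map_mult y_def)
  qed
  then have "B = 0 \<and> \<beta> = 0" using special_pack[OF two three _ fst] by blast
  have snd: "wedge3_map S' (pack x 0 0 0) = pack 0 0 0 x" for x
    using S'(2)[of "pack 0 0 0 x"] by (simp add: wedge3_map_swap)
  have "wedge3_map g y = pack 0 0 0 (ext3_snd y)"
    using U \<open>B = 0 \<and> \<beta> = 0\<close> snd by (simp add: g Sy)
  moreover have "wedge3_map ?u (pack 0 0 0 x) = pack 0 0 0 x" for x
    using wedge3_map_upper[of "transpose U" 0 0 0 x] by (simp add: mdot_expand)
  then have "wedge3_map g (pack a 0 0 0) = pack a 0 0 0"
    using S'(2)[of "pack a 0 0 0"] by (simp add: g wedge3_map_swap)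
  ultimately show ?thesis using that detg y_def by blast
qed

end

section \<open>Preservers of the lines spanned by the first and the last basis trivector\<close>

locale normalized_preserver = quartic_preserver \<phi>
  for \<phi> :: "('a::field) ext3 \<Rightarrow> 'a ext3" +
  fixes a b :: 'a
  assumes fst: "\<phi> (pack 1 0 0 0) = pack a 0 0 0" and snd: "\<phi> (pack 0 0 0 1) = pack 0 0 0 b"
begin

lemma fst_c: "\<phi> (pack c 0 0 0) = pack (a * c) 0 0 0" and snd_c: "\<phi> (pack 0 0 0 c) = pack 0 0 0 (b * c)"
  using scale[of c "pack 1 0 0 0"] scale[of c "pack 0 0 0 1"] by (simp_all add: pack_scale fst snd mult.commute)

lemma ab: "(a * b)\<^sup>2 = 1"
proof -
  have "\<phi> (pack 1 0 0 1) = pack a 0 0 b"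
    using add[of "pack 1 0 0 0" "pack 0 0 0 1"] by (simp add: pack_add fst snd)
  then have "quartic (pack a 0 0 b) = quartic (pack 1 0 0 1)" by (metis Q)
  then show ?thesis by (simp add: quartic_def mdot_expand det_3)
qed

lemma ab_nz: "a \<noteq> 0" "b \<noteq> 0"
  using ab by auto

lemma coord_zero:
  "ext3_snd (\<phi> y) = 0 \<longleftrightarrow> ext3_snd y = 0" "ext3_fst (\<phi> y) = 0 \<longleftrightarrow> ext3_fst y = 0"
  using snd_square[OF fst, of y] fst_square[OF snd, of y] ab_nz by auto

lemma middle: "\<phi> (pack 0 A B 0) = pack 0 (ext3_A (\<phi> (pack 0 A B 0))) (ext3_B (\<phi> (pack 0 A B 0))) 0"
  by (rule ext3_eqI) (simp_all add: coord_zero)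

text \<open>The quartic at \<open>pack s A B r\<close> is a polynomial in s and r; its coefficients
  at r, s and s r carry the three invariants.\<close>

lemma middle_invariants:
  assumes "\<phi> (pack 0 A B 0) = pack 0 A' B' 0"
  shows "b * det A' = det A" "a * det B' = det B" "mdot A' B' = a * b * mdot A B"
proof -
  define m m' where "m = mdot A B" "m' = mdot A' B'"
  define n n' where "n = mdot (cof A) (cof B)" "n' = mdot (cof A') (cof B')"
  have "\<phi> (pack s A B r) = pack (a * s) A' B' (b * r)" for s r
  proof -
    have "\<phi> (pack s 0 0 0 + pack 0 A B 0 + pack 0 0 0 r) =
        pack (a * s) 0 0 0 + pack 0 A' B' 0 + pack 0 0 0 (b * r)"
      by (simp only: add fst_c snd_c assms)
    then show ?thesis by (simp add: pack_add)
  qed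
  then have q: "(a * s * (b * r) - m')\<^sup>2 + 4 * (b * r) * det A' + 4 * (a * s) * det B' - 4 * n' =
      (s * r - m)\<^sup>2 + 4 * r * det A + 4 * s * det B - 4 * n" for s r
    using Q[of "pack s A B r"] by (simp add: quartic_def m_m'_def n_n'_def)
  \<comment> \<open>The difference of the values at s = 0, r = 1 and s = 0, r = -1 isolates the
    coefficient of r.\<close>
  have "8 * (b * det A' - det A) = ((a * 0 * (b * 1) - m')\<^sup>2 + 4 * (b * 1) * det A' + 4 * (a * 0) * det B' - 4 * n')
     - ((a * 0 * (b * -1) - m')\<^sup>2 + 4 * (b * -1) * det A' + 4 * (a * 0) * det B' - 4 * n') - 8 * det A"
    by (simp add: algebra_simps)
  also have "\<dots> = 0" unfolding q by (simp add: algebra_simps)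
  finally show A: "b * det A' = det A" using eight by (metis eq_iff_diff_eq_0 mult_eq_0_iff)
  have "8 * (a * det B' - det B) = ((a * 1 * (b * 0) - m')\<^sup>2 + 4 * (b * 0) * det A' + 4 * (a * 1) * det B' - 4 * n')
     - ((a * -1 * (b * 0) - m')\<^sup>2 + 4 * (b * 0) * det A' + 4 * (a * -1) * det B' - 4 * n') - 8 * det B"
    by (simp add: algebra_simps)
  also have "\<dots> = 0" unfolding q by (simp add: algebra_simps)
  finally show B: "a * det B' = det B" using eight by (metis eq_iff_diff_eq_0 mult_eq_0_iff)
  \<comment> \<open>The values at (1, 1) and (0, 0) are compared; the terms in s^2 r^2 cancel
    because (a b)^2 = 1.\<close>
  have "2 * (a * b * m' - m) = - (((a * 1 * (b * 1) - m')\<^sup>2 + 4 * (b * 1) * det A' + 4 * (a * 1) * det B' - 4 * n')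
     - ((a * 0 * (b * 0) - m')\<^sup>2 + 4 * (b * 0) * det A' + 4 * (a * 0) * det B' - 4 * n')
     - 1 - 4 * det A - 4 * det B) - 2 * m"
    using ab by (simp add: power2_diff A[symmetric] B[symmetric])
  also have "\<dots> = 0" unfolding q by (simp add: power2_diff)
  finally have "a * b * m' = m" using two by (metis eq_iff_diff_eq_0 mult_eq_0_iff)
  then have "a * b * m = (a * b)\<^sup>2 * m'" by (simp add: power2_eq_square mult.assoc)
  then show "mdot A' B' = a * b * mdot A B" using ab by (simp add: m_m'_def)
qed

definition L where "L A = ext3_A (\<phi> (pack 0 A 0 0))"
definition M where "M B = ext3_B (\<phi> (pack 0 0 B 0))"

lemma det_A: "b * det (ext3_A (\<phi> (pack 0 A B 0))) = det A"
  and det_B: "a * det (ext3_B (\<phi> (pack 0 A B 0))) = det B"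
  by (rule middle_invariants[OF middle])+

lemma surj_middle: "\<exists>A B. \<phi> (pack 0 A B 0) = pack 0 X Y 0"
proof -
  obtain y where y: "\<phi> y = pack 0 X Y 0" using bij_is_surj[OF bij] by (metis surjD)
  then have "ext3_fst y = 0" "ext3_snd y = 0" using coord_zero[of y] by simp_all
  then have "y = pack 0 (ext3_A y) (ext3_B y) 0" by (metis pack_ext3)
  then show ?thesis using y by metis
qed

text \<open>Adding t B to the B-part of the argument does not change the determinant of the A-part
  of the image. By surjectivity that A-part starts at an arbitrary Y, so
  \<open>det_line_const\<close> applies.\<close>

lemma A_of_B: "ext3_A (\<phi> (pack 0 0 B 0)) = 0"
proof (rule det_line_const[OF two three])
  fix Y :: "'a ^ 3 ^ 3" and t
  obtain A B' where AB: "\<phi> (pack 0 A B' 0) = pack 0 Y 0 0" using surj_middle by blast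
  have "\<phi> (pack 0 A (B' + smat t B) 0) = pack 0 Y 0 0 + t *s \<phi> (pack 0 0 B 0)"
    unfolding AB[symmetric] scale[symmetric] add[symmetric] by (simp add: pack_add pack_scale)
  then have "ext3_A (\<phi> (pack 0 A (B' + smat t B) 0)) = Y + smat t (ext3_A (\<phi> (pack 0 0 B 0)))" by simp
  moreover have "b * det (ext3_A (\<phi> (pack 0 A (B' + smat t B) 0))) = b * det Y"
    using det_A[of A "B' + smat t B"] det_A[of A B'] by (simp add: AB)
  ultimately show "det (Y + smat t (ext3_A (\<phi> (pack 0 0 B 0)))) = det Y"
    using ab_nz by simp
qed

lemma B_of_A: "ext3_B (\<phi> (pack 0 A 0 0)) = 0"
proof (rule det_line_const[OF two three])
  fix Y :: "'a ^ 3 ^ 3" and t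
  obtain A' B where AB: "\<phi> (pack 0 A' B 0) = pack 0 0 Y 0" using surj_middle by blast
  have "\<phi> (pack 0 (A' + smat t A) B 0) = pack 0 0 Y 0 + t *s \<phi> (pack 0 A 0 0)"
    unfolding AB[symmetric] scale[symmetric] add[symmetric] by (simp add: pack_add pack_scale)
  then have "ext3_B (\<phi> (pack 0 (A' + smat t A) B 0)) = Y + smat t (ext3_B (\<phi> (pack 0 A 0 0)))" by simp
  moreover have "a * det (ext3_B (\<phi> (pack 0 (A' + smat t A) B 0))) = a * det Y"
    using det_B[of "A' + smat t A" B] det_B[of A' B] by (simp add: AB)
  ultimately show "det (Y + smat t (ext3_B (\<phi> (pack 0 A 0 0)))) = det Y"
    using ab_nz by simp
qed

lemma phi_A: "\<phi> (pack 0 A 0 0) = pack 0 (L A) 0 0"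
  by (subst middle) (simp add: L_def B_of_A)

lemma phi_B: "\<phi> (pack 0 0 B 0) = pack 0 0 (M B) 0"
  by (subst middle) (simp add: M_def A_of_B)

lemma phi_AB: "\<phi> (pack 0 A B 0) = pack 0 (L A) (M B) 0"
  using add[of "pack 0 A 0 0" "pack 0 0 B 0"] by (simp add: pack_add phi_A phi_B)

lemma form: "\<phi> x = pack (a * ext3_fst x) (L (ext3_A x)) (M (ext3_B x)) (b * ext3_snd x)"
proof -
  have "\<phi> (pack (ext3_fst x) 0 0 0 + pack 0 (ext3_A x) 0 0 + pack 0 0 (ext3_B x) 0 + pack 0 0 0 (ext3_snd x)) =
      pack (a * ext3_fst x) (L (ext3_A x)) (M (ext3_B x)) (b * ext3_snd x)"
    by (simp only: add fst_c snd_c phi_A phi_B) (simp add: pack_add)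
  then show ?thesis by (simp add: pack_add)
qed

lemma mdot_LM: "mdot (L A) (M B) = a * b * mdot A B"
  by (rule middle_invariants(3)[OF phi_AB])

lemma det_similarity_L: "det_similarity L (1 / b)"
proof
  show "L (A + B) = L A + L B" for A B
    using add[of "pack 0 A 0 0" "pack 0 B 0 0"] by (simp add: L_def pack_add)
  show "L (smat c A) = smat c (L A)" for c A
    using scale[of c "pack 0 A 0 0"] by (simp add: L_def pack_scale)
  show "det (L A) = 1 / b * det A" for A
    using det_A[of A 0] ab_nz by (simp add: phi_A field_simps)
  show "surj L"
  proof (rule surjI)
    fix Y
    have "\<exists>A. L A = Y" using surj_middle[of Y 0] by (metis ext3_pack(3) phi_AB)
    then show "L (SOME A. L A = Y) = Y" by (rule someI_ex)
  qed
qed (use two three ab_nz in auto)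

text \<open>In the transposed case, composing first with \<open>transpose_map\<close> brings the
  action on A back to the form P A R.\<close>

lemma normal_form:
  obtains c g where "c \<noteq> 0" "det g \<noteq> 0"
    "(\<forall>x. \<phi> x = c *s wedge3_map g x) \<or> (\<forall>x. \<phi> (transpose_map x) = c *s wedge3_map g x)"
proof -
  interpret L: det_similarity L "1 / b" by (rule det_similarity_L)
  obtain P R where det: "det P * det R = 1 / b"
    and PR: "(\<forall>A. L A = P ** A ** R) \<or> (\<forall>A. L A = P ** transpose A ** R)" by (rule L.frobenius)
  have det': "det P * det R * b = 1" using det ab_nz by simp
  from PR show ?thesis
  proof
    assume P: "\<forall>A. L A = P ** A ** R"
    show ?thesis
    proof (rule block_diagonal_map[of \<phi> a P R M b, OF _ ab det'])
      show "\<phi> x = pack (a * ext3_fst x) (P ** ext3_A x ** R) (M (ext3_B x)) (b * ext3_snd x)" for x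
        by (subst form) (simp add: P)
      show "mdot (P ** A ** R) (M B) = a * b * mdot A B" for A B
        using mdot_LM P by metis
    qed (use that in blast)
  next
    assume P: "\<forall>A. L A = P ** transpose A ** R"
    have tr: "mdot (transpose A) (transpose B) = mdot A B" for A B :: "'a ^ 3 ^ 3"
      by (simp add: mdot_expand transpose_def)
    show ?thesis
    proof (rule block_diagonal_map[of "\<lambda>x. \<phi> (transpose_map x)" a P R "\<lambda>B. M (transpose B)" b, OF _ ab det'])
      show "\<phi> (transpose_map x) = pack (a * ext3_fst x) (P ** ext3_A x ** R) (M (transpose (ext3_B x))) (b * ext3_snd x)" for x
        by (subst form) (simp add: P transpose_map_def)
      show "mdot (P ** A ** R) (M (transpose B)) = a * b * mdot A B" for A B
        using mdot_LM[of "transpose A" "transpose B"] P by (simp add: tr)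
    qed (use that in blast)
  qed
qed

end

lemma (in quartic_preserver) inverse_preserver: "quartic_preserver (inv \<phi>)"
proof (rule quartic_preserver.intro)
  note s = surj_f_inv_f[OF bij_is_surj[OF bij]] and i = inv_f_f[OF bij_is_inj[OF bij]]
  show "Vector_Spaces.linear (*s) (*s) (inv \<phi>)"
    by (rule vec_linearI) (metis add i s, metis scale i s)
  show "quartic (inv \<phi> x) = quartic x" for x by (metis Q s)
qed (use two three Qg in auto)

text \<open>The normal form is applied to the inverse of \<phi>, where the transposition enters on
  the right. Inverting moves it to the left, where the Hodge star has to stand.\<close>

lemma (in quartic_preserver) classification:
  "scaled_GL6_map \<phi> \<or> (\<exists>T. scaled_GL6_map T \<and> \<phi> = hodge_star \<circ> T)"
proof -
  note i = inv_f_f[OF bij_is_inj[OF bij]]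
  interpret I: quartic_preserver "inv \<phi>" by (rule inverse_preserver)
  obtain g1 a where g1: "(det g1)\<^sup>2 = 1" "a \<noteq> 0" "wedge3_map g1 (inv \<phi> (pack 1 0 0 0)) = pack a 0 0 0"
    by (rule I.normalize_first)
  interpret I1: quartic_preserver "\<lambda>x. wedge3_map g1 (inv \<phi> x)" by (rule I.compose_wedge3_map[OF g1(1)])
  obtain g2 b where g2: "(det g2)\<^sup>2 = 1" "wedge3_map g2 (pack a 0 0 0) = pack a 0 0 0"
    "wedge3_map g2 (wedge3_map g1 (inv \<phi> (pack 0 0 0 1))) = pack 0 0 0 b"
    by (rule I1.normalize_second[OF g1(3,2)])
  define h where "h = g2 ** g1"
  have deth: "(det h)\<^sup>2 = 1" by (simp add: h_def det_mul power_mult_distrib g1 g2)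
  then have deth0: "det h \<noteq> 0" by auto
  interpret I2: quartic_preserver "\<lambda>x. wedge3_map h (inv \<phi> x)" by (rule I.compose_wedge3_map[OF deth])
  interpret I2: normalized_preserver "\<lambda>x. wedge3_map h (inv \<phi> x)" a b
    by unfold_locales (simp_all add: h_def wedge3_map_mult g1 g2)
  obtain c g where c: "c \<noteq> 0" and g: "det g \<noteq> 0" and
    cases: "(\<forall>x. wedge3_map h (inv \<phi> x) = c *s wedge3_map g x) \<or>
      (\<forall>x. wedge3_map h (inv \<phi> (transpose_map x)) = c *s wedge3_map g x)"
    by (rule I2.normal_form)
  obtain g' where g': "det g' * det g = 1" "\<And>x. wedge3_map g' (wedge3_map g x) = x"
    using wedge3_map_inverse[OF g] by metis
  then have detg': "det g' \<noteq> 0" by auto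
  from cases show ?thesis
  proof
    assume e: "\<forall>x. wedge3_map h (inv \<phi> x) = c *s wedge3_map g x"
    have "\<phi> y = (1 / c) *s wedge3_map (g' ** h) y" for y
    proof -
      have "wedge3_map h y = c *s wedge3_map g (\<phi> y)" using e i by metis
      then show ?thesis using c by (simp add: wedge3_map_mult wedge3_map_linear g')
    qed
    then have "scaled_GL6_map \<phi>"
      by (intro scaled_GL6_mapI[of "1 / c" "g' ** h"] Qg Q) (use c detg' deth0 in \<open>simp_all add: det_mul\<close>)
    then show ?thesis ..
  next
    assume e: "\<forall>x. wedge3_map h (inv \<phi> (transpose_map x)) = c *s wedge3_map g x"
    let ?S = "block 0 (mat 1) (- mat 1) 0 :: 'a ^ 6 ^ 6"
    have detS: "det ?S \<noteq> 0" using det_swap_block by (metis mult_zero_left zero_neq_one)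
    define T where "T y = (1 / c) *s wedge3_map (?S ** (g' ** h)) y" for y
    have T1: "transpose_map (\<phi> y) = (1 / c) *s wedge3_map (g' ** h) y" for y
    proof -
      have "wedge3_map h y = c *s wedge3_map g (transpose_map (\<phi> y))" using e i by (metis transpose_map_invol)
      then show ?thesis using c by (simp add: wedge3_map_mult wedge3_map_linear g')
    qed
    \<comment> \<open>By \<open>transpose_map_hodge\<close> the star of this vector is the
      transposition applied twice to \<phi> y.\<close>
    have TS: "T y = wedge3_map ?S (transpose_map (\<phi> y))" for y
      unfolding T1 by (simp add: T_def wedge3_map_mult[of ?S] wedge3_map_linear)
    have "\<phi> y = hodge_star (T y)" for y
      unfolding TS transpose_map_hodge[symmetric] by simp
    moreover have "quartic (T y) = quartic y" for y
    proof -
      have "(det ?S)\<^sup>2 = 1"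
      proof -
        have "quartic (wedge3_map ?S (pack 1 0 0 1)) = 1" "quartic (pack 1 0 0 (1::'a)) = 1"
          by (simp_all add: wedge3_map_swap quartic_def mdot_expand det_3 transpose_def)
        then show ?thesis using Qg[OF detS, of "pack 1 0 0 1"] by simp
      qed
      then show ?thesis by (simp add: TS Qg[OF detS] quartic_transpose_map Q)
    qed
    then have "scaled_GL6_map T"
      by (intro scaled_GL6_mapI[of "1 / c" "?S ** (g' ** h)"] Qg)
         (use c detg' deth0 detS in \<open>simp_all add: det_mul T_def\<close>)
    ultimately show ?thesis by (auto simp: fun_eq_iff)
  qed
qed

theorem corollary8p5:
  fixes f :: "('a::field) ext3_poly" and \<phi> :: "'a ext3 \<Rightarrow> 'a ext3"
  assumes "CHAR('a) \<noteq> 2" and "CHAR('a) \<noteq> 3"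
    and "SL6_invariant_quartic f"
    and "Vector_Spaces.linear (*s) (*s) \<phi>"
    and "pullback \<phi> f = f"
  shows "scaled_GL6_map \<phi> \<or> (\<exists>T. scaled_GL6_map T \<and> \<phi> = hodge_star \<circ> T)"
proof -
  have two: "(2::'a) \<noteq> 0" and three: "(3::'a) \<noteq> 0"
    using CHAR_neq_prime[OF assms(1)] CHAR_neq_prime[OF assms(2)] by simp_all
  interpret invariant_quartic f by unfold_locales (use two three assms(3) in auto)
  obtain c where c: "c \<noteq> 0" "\<And>x. F x = c * quartic x" using F_quartic by blast
  interpret quartic_preserver \<phi>
  proof (rule quartic_preserver.intro)
    show "quartic (wedge3_map g x) = (det g)\<^sup>2 * quartic x" if "det g \<noteq> 0" for g :: "'a ^ 6 ^ 6" and x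
      using F_wedge3_map[OF that, of x] c by simp
    show "quartic (\<phi> x) = quartic x" for x
      using poly_eval_pullback[OF assms(4), of f x] assms(5) c by simp
  qed (use two three assms(4) in auto)
  show ?thesis by (rule classification)
qed

end
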